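(* Let $\pi:E\to Q$ be a fibred manifold with $\dim Q=n$ and fibre dimension $m$, and let $r\ge 1$. The Cartan distribution $\mathcal C^r_\pi$ on $J^r\pi$ is an $N^r_\pi$-contact distribution, where $N^r_\pi=m\binom{n+r-1}{r-1}$. In every adapted coordinate system $(x^i,u^\alpha_I)$ on an open $U\subset J^r\pi$, an associated local $N^r_\pi$-contact form (i.e. one with kernel $\mathcal C^r_\pi|_U$) is $$\boldsymbol\eta^r_\pi=\sum_{\alpha=1}^m\sum_{|J|\le r-1}\eta^\alpha_J\otimes e^J_\alpha,\qquad \eta^\alpha_J=\sum_{L\ge J,\ |L|\le r-1}(-1)^{|L-J|}\frac{x^{L-J}}{(L-J)!}\,\theta^\alpha_L,$$ where $\{e^J_\alpha\}_{1\le\alpha\le m,\,|J|\le r-1}$ is the canonical basis of $\mathbb R^{N^r_\pi}$. The Reeb vector fields of $\boldsymbol\eta^r_\pi$ are $$R^J_\alpha=\sum_{I\le J}\frac{x^{J-I}}{(J-I)!}\frac{\partial}{\partial u^\alpha_I},\qquad |J|\le r-1,\ \alpha=1,\dots,m.$$ Moreover, the Spencer operator $\mathfrak S^r_\pi$ of $J^r\pi$ is locally represented in these coordinates by $$\mathfrak R\circ\boldsymbol\eta^r_\pi:=\sum_{\alpha=1}^m\sum_{|J|\le r-1}\eta^\alpha_J\otimes R^J_\alpha=\mathfrak S^r_\pi .$$ Additionally, the canonical structure form on $J^r\pi$ is given by the class $[\mathfrak R\circ\boldsymbol\eta^r_\pi]$, independently of the choice of the adapted coordinate system.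
   Context: All manifolds and maps are smooth. $J^r\pi$ is the bundle of $r$-jets of local sections of $\pi$ ($J^0\pi=E$), $\pi_r:J^r\pi\to Q$ and $\pi_{r,s}:J^r\pi\to J^s\pi$ are the canonical projections. Adapted coordinates $(x^i,u^\alpha_I)$, $1\le i\le n$, $1\le\alpha\le m$, $I\in\mathbb N_{\ge0}^n$, $|I|\le r$, are the jet coordinates induced by fibred coordinates $(x^i,u^\alpha)$ of $\pi$ (the domain $U$ being the preimage of the fibred chart). $\widehat e_i$ is the $i$-th unit multi-index; $J\ge I$ is componentwise; $J!=\prod_i j_i!$, $x^J=\prod_i (x^i)^{j_i}$. The contact forms are $\theta^\alpha_I=du^\alpha_I-\sum_i u^\alpha_{I+\widehat e_i}dx^i$, $|I|\le r-1$, and $\mathcal C^r_\pi=\bigcap_{\alpha,|I|\le r-1}\ker\theta^\alpha_I$ (globally well defined). A $k$-contact form on an open set $U$ is an $\mathbb R^k$-valued one-form $\boldsymbol\eta=\sum_A\eta^A\otimes e_A$ such that $\ker\boldsymbol\eta:=\bigcap_A\ker\eta^A$ is a non-zero distribution of corank $k$ and $\ker\boldsymbol\eta\oplus\ker d\boldsymbol\eta=TU$, where $\ker d\boldsymbol\eta:=\bigcap_A\ker d\eta^A$. A $k$-contact distribution is a regular corank-$k$ distribution that is, around every point, the kernel of a $k$-contact form. The Reeb vector fields of $\boldsymbol\eta$ are the unique vector fields $R_1,\dots,R_k$ with $\iota_{R_A}\eta^B=\delta^B_A$ and $\iota_{R_A}d\eta^B=0$. The Spencer operator, or canonical structure form,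 of $J^r\pi$ is the globally defined one-form with values in $\pi_{r,r-1}^*V\pi_{r-1}$ ($V\pi_{r-1}=\ker T\pi_{r-1}\subset TJ^{r-1}\pi$) that in adapted coordinates reads $\mathfrak S^r_\pi=\sum_\alpha\sum_{|I|\le r-1}\theta^\alpha_I\otimes\partial/\partial u^\alpha_I$. In the coordinate identity $\mathfrak R\circ\boldsymbol\eta^r_\pi=\mathfrak S^r_\pi$, the symbols $\partial/\partial u^\alpha_I$, $|I|\le r-1$, in $\mathfrak S^r_\pi$ are read as the coordinate vector fields on $U$. $[\,\cdot\,]$ denotes the class modulo $\ker T\pi_{r,r-1}$, and $TJ^r\pi/\ker T\pi_{r,r-1}$ is identified with $\pi_{r,r-1}^*TJ^{r-1}\pi$ via $T\pi_{r,r-1}$. $\mathfrak R$ is the (pointwise linear) Reeb lift $e^J_\alpha\mapsto R^J_\alpha$. *)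

theory Defs
  imports "HOL-Analysis.Analysis"
begin

section \<open>Smooth maps between Euclidean spaces\<close>

text \<open>Only meant for open \<open>S\<close>, where it is the usual notion of class \<open>C\<^sup>k\<close>.\<close>

primrec Ck_on :: "nat \<Rightarrow> 'a::euclidean_space set \<Rightarrow> ('a \<Rightarrow> 'b::euclidean_space) \<Rightarrow> bool" where
  "Ck_on 0 S f \<longleftrightarrow> continuous_on S f"
| "Ck_on (Suc k) S f \<longleftrightarrow>
     (\<forall>x\<in>S. f differentiable (at x)) \<and> (\<forall>v. Ck_on k S (\<lambda>x. frechet_derivative f (at x) v))"

definition smooth_on :: "'a::euclidean_space set \<Rightarrow> ('a \<Rightarrow> 'b::euclidean_space) \<Rightarrow> bool" where
  "smooth_on S f \<longleftrightarrow> (\<forall>k. Ck_on k S f)"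


section \<open>Manifolds\<close>

text \<open>A chart is a pair (domain, coordinate map); a manifold is a set of points with an atlas that
  need not be maximal. The topology is the one induced by the atlas.\<close>

type_synonym ('a, 'b) chart = "'a set \<times> ('a \<Rightarrow> 'b)"

record ('a, 'b) mfd =
  points :: "'a set"
  atlas :: "('a, 'b) chart set"

definition chart_inv :: "('a, 'b) chart \<Rightarrow> 'b \<Rightarrow> 'a" where
  "chart_inv c = inv_into (fst c) (snd c)"

definition is_chart :: "'a set \<Rightarrow> ('a, 'b::euclidean_space) chart \<Rightarrow> bool" where
  "is_chart X c \<longleftrightarrow> fst c \<subseteq> X \<and> inj_on (snd c) (fst c) \<and> open (snd c ` fst c)"

definition smooth_transition ::
    "('a, 'b::euclidean_space) chart \<Rightarrow> ('a, 'b) chart \<Rightarrow> bool" where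
  "smooth_transition c d \<longleftrightarrow>
     open (snd c ` (fst c \<inter> fst d)) \<and> smooth_on (snd c ` (fst c \<inter> fst d)) (snd d \<circ> chart_inv c)"

definition mtop :: "('a, 'b::euclidean_space) mfd \<Rightarrow> 'a topology" where
  "mtop M = topology (\<lambda>W. W \<subseteq> points M \<and> (\<forall>c\<in>atlas M. open (snd c ` (fst c \<inter> W))))"

definition smooth_manifold :: "('a, 'b::euclidean_space) mfd \<Rightarrow> bool" where
  "smooth_manifold M \<longleftrightarrow>
     (\<Union>c\<in>atlas M. fst c) = points M \<and>
     (\<forall>c\<in>atlas M. is_chart (points M) c) \<and>
     (\<forall>c\<in>atlas M. \<forall>d\<in>atlas M. smooth_transition c d) \<and>
     Hausdorff_space (mtop M) \<and> second_countable (mtop M)"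

text \<open>All charts of the manifold, i.e. the maximal atlas.\<close>

definition charts :: "('a, 'b::euclidean_space) mfd \<Rightarrow> ('a, 'b) chart set" where
  "charts M = {c. is_chart (points M) c \<and>
                  (\<forall>d\<in>atlas M. smooth_transition c d \<and> smooth_transition d c)}"

definition smooth_map ::
    "('a, 'b::euclidean_space) mfd \<Rightarrow> 'a set \<Rightarrow> ('c, 'd::euclidean_space) mfd \<Rightarrow> ('a \<Rightarrow> 'c) \<Rightarrow> bool" where
  "smooth_map M U N f \<longleftrightarrow>
     openin (mtop M) U \<and> f ` U \<subseteq> points N \<and>
     (\<forall>c\<in>atlas M. \<forall>d\<in>atlas N.
        open (snd c ` (fst c \<inter> U \<inter> f -` fst d)) \<and>
        smooth_on (snd c ` (fst c \<inter> U \<inter> f -` fst d)) (snd d \<circ> f \<circ> chart_inv c))"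


section \<open>Tangent vectors\<close>

text \<open>The tangent space at \<open>p\<close> is the model space itself: a tangent vector is stored by its components
  in a chart of the atlas around \<open>p\<close> that is selected once and for all. Its components in any
  other chart \<open>c\<close> are given by \<open>tcoord\<close>; conversely \<open>tvec\<close> yields the tangent vector that has
  prescribed components in the chart \<open>c\<close>.\<close>

definition chart_at :: "('a, 'b) mfd \<Rightarrow> 'a \<Rightarrow> ('a, 'b) chart" where
  "chart_at M p = (SOME c. c \<in> atlas M \<and> p \<in> fst c)"

definition tcoord :: "('a, 'b::euclidean_space) mfd \<Rightarrow> ('a, 'b) chart \<Rightarrow> 'a \<Rightarrow> 'b \<Rightarrow> 'b" where
  "tcoord M c p =
     frechet_derivative (snd c \<circ> chart_inv (chart_at M p)) (at (snd (chart_at M p) p))"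

definition tvec :: "('a, 'b::euclidean_space) mfd \<Rightarrow> ('a, 'b) chart \<Rightarrow> 'a \<Rightarrow> 'b \<Rightarrow> 'b" where
  "tvec M c p = frechet_derivative (snd (chart_at M p) \<circ> chart_inv c) (at (snd c p))"

definition tmap ::
    "('a, 'b::euclidean_space) mfd \<Rightarrow> ('c, 'd::euclidean_space) mfd \<Rightarrow> ('a \<Rightarrow> 'c) \<Rightarrow> 'a \<Rightarrow> 'b \<Rightarrow> 'd" where
  "tmap M N f p =
     frechet_derivative (snd (chart_at N (f p)) \<circ> f \<circ> chart_inv (chart_at M p))
       (at (snd (chart_at M p) p))"

definition smooth_vector_field ::
    "('a, 'b::euclidean_space) mfd \<Rightarrow> 'a set \<Rightarrow> ('a \<Rightarrow> 'b) \<Rightarrow> bool" where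
  "smooth_vector_field M U X \<longleftrightarrow>
     (\<forall>c\<in>atlas M. smooth_on (snd c ` (fst c \<inter> U))
        (\<lambda>y. tcoord M c (chart_inv c y) (X (chart_inv c y))))"

definition regular_distribution ::
    "('a, 'b::euclidean_space) mfd \<Rightarrow> 'a set \<Rightarrow> nat \<Rightarrow> ('a \<Rightarrow> 'b set) \<Rightarrow> bool" where
  "regular_distribution M U k D \<longleftrightarrow>
     (\<forall>p\<in>U. subspace (D p) \<and> dim (D p) + k = DIM('b)) \<and>
     (\<forall>p\<in>U. \<exists>V XX. openin (mtop M) V \<and> p \<in> V \<and> V \<subseteq> U \<and> finite XX \<and>
        (\<forall>X\<in>XX. smooth_vector_field M V X) \<and> (\<forall>q\<in>V. D q = span ((\<lambda>X. X q) ` XX)))"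


section \<open>Vector-valued one-forms and \<open>k\<close>-contact forms\<close>

text \<open>\<open>form_in M c \<eta> y u\<close> is the value of \<open>\<eta>\<close> at the point with coordinates \<open>y\<close> on the vector with
  components \<open>u\<close>, both with respect to the chart \<open>c\<close>.\<close>

definition form_in ::
    "('a, 'b::euclidean_space) mfd \<Rightarrow> ('a, 'b) chart \<Rightarrow> ('a \<Rightarrow> 'b \<Rightarrow> 'v::euclidean_space) \<Rightarrow> 'b \<Rightarrow> 'b \<Rightarrow> 'v" where
  "form_in M c \<eta> y u = \<eta> (chart_inv c y) (tvec M c (chart_inv c y) u)"

definition smooth_one_form ::
    "('a, 'b::euclidean_space) mfd \<Rightarrow> 'a set \<Rightarrow> ('a \<Rightarrow> 'b \<Rightarrow> 'v::euclidean_space) \<Rightarrow> bool" where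
  "smooth_one_form M U \<eta> \<longleftrightarrow>
     (\<forall>p\<in>U. linear (\<eta> p)) \<and>
     (\<forall>c\<in>atlas M. \<forall>u. smooth_on (snd c ` (fst c \<inter> U)) (\<lambda>y. form_in M c \<eta> y u))"

text \<open>The exterior derivative at \<open>p\<close>, computed in the chart \<open>chart_at M p\<close>, in which tangent vectors
  at \<open>p\<close> agree with their components.\<close>

definition ext_deriv ::
    "('a, 'b::euclidean_space) mfd \<Rightarrow> ('a \<Rightarrow> 'b \<Rightarrow> 'v::euclidean_space) \<Rightarrow> 'a \<Rightarrow> 'b \<Rightarrow> 'b \<Rightarrow> 'v" where
  "ext_deriv M \<eta> p v w =
     (let c = chart_at M p in
        frechet_derivative (\<lambda>y. form_in M c \<eta> y w) (at (snd c p)) v -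
        frechet_derivative (\<lambda>y. form_in M c \<eta> y v) (at (snd c p)) w)"

definition form_ker :: "('a \<Rightarrow> 'b \<Rightarrow> real^'k) \<Rightarrow> 'a \<Rightarrow> 'b set" where
  "form_ker \<eta> p = (\<Inter>A. {v. \<eta> p v $ A = 0})"

definition dform_ker ::
    "('a, 'b::euclidean_space) mfd \<Rightarrow> ('a \<Rightarrow> 'b \<Rightarrow> real^'k) \<Rightarrow> 'a \<Rightarrow> 'b set" where
  "dform_ker M \<eta> p = (\<Inter>A. {v. \<forall>w. ext_deriv M \<eta> p v w $ A = 0})"

definition contact_form ::
    "('a, 'b::euclidean_space) mfd \<Rightarrow> 'a set \<Rightarrow> ('a \<Rightarrow> 'b \<Rightarrow> real^'k) \<Rightarrow> bool" where
  "contact_form M U \<eta> \<longleftrightarrow>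
     openin (mtop M) U \<and> smooth_one_form M U \<eta> \<and>
     regular_distribution M U CARD('k) (form_ker \<eta>) \<and>
     (\<forall>p\<in>U. form_ker \<eta> p \<noteq> {0}) \<and>
     (\<forall>p\<in>U. form_ker \<eta> p \<inter> dform_ker M \<eta> p = {0} \<and>
            {v + w | v w. v \<in> form_ker \<eta> p \<and> w \<in> dform_ker M \<eta> p} = UNIV)"

text \<open>A \<open>k\<close>-contact distribution, where \<open>k\<close> is the cardinality of the type passed as argument.\<close>

definition contact_distribution ::
    "'k::finite itself \<Rightarrow> ('a, 'b::euclidean_space) mfd \<Rightarrow> ('a \<Rightarrow> 'b set) \<Rightarrow> bool" where
  "contact_distribution _ M D \<longleftrightarrow>
     regular_distribution M (points M) CARD('k) D \<and>
     (\<forall>p\<in>points M. \<exists>U (\<eta> :: 'a \<Rightarrow> 'b \<Rightarrow> real^'k).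
        p \<in> U \<and> contact_form M U \<eta> \<and> (\<forall>q\<in>U. D q = form_ker \<eta> q))"

definition reeb_conditions ::
    "('a, 'b::euclidean_space) mfd \<Rightarrow> 'a set \<Rightarrow> ('a \<Rightarrow> 'b \<Rightarrow> real^'k) \<Rightarrow> ('k \<Rightarrow> 'a \<Rightarrow> 'b) \<Rightarrow> bool" where
  "reeb_conditions M U \<eta> R \<longleftrightarrow>
     (\<forall>A. smooth_vector_field M U (R A)) \<and>
     (\<forall>p\<in>U. \<forall>A B. \<eta> p (R A p) $ B = (if A = B then 1 else 0)) \<and>
     (\<forall>p\<in>U. \<forall>A B w. ext_deriv M \<eta> p (R A p) w $ B = 0)"

text \<open>\<open>R\<close> is the (unique) family of Reeb vector fields of \<open>\<eta>\<close> on \<open>U\<close>.\<close>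

definition reeb_vector_fields ::
    "('a, 'b::euclidean_space) mfd \<Rightarrow> 'a set \<Rightarrow> ('a \<Rightarrow> 'b \<Rightarrow> real^'k) \<Rightarrow> ('k \<Rightarrow> 'a \<Rightarrow> 'b) \<Rightarrow> bool" where
  "reeb_vector_fields M U \<eta> R \<longleftrightarrow>
     reeb_conditions M U \<eta> R \<and>
     (\<forall>R'. reeb_conditions M U \<eta> R' \<longrightarrow> (\<forall>A. \<forall>p\<in>U. R' A p = R A p))"


section \<open>Multi-indices\<close>

definition mdeg :: "('n::finite \<Rightarrow> nat) \<Rightarrow> nat" where
  "mdeg I = (\<Sum>i\<in>UNIV. I i)"

definition mfact :: "('n::finite \<Rightarrow> nat) \<Rightarrow> real" where
  "mfact I = (\<Prod>i\<in>UNIV. fact (I i))"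

definition mpow :: "real^'n \<Rightarrow> ('n::finite \<Rightarrow> nat) \<Rightarrow> real" where
  "mpow x I = (\<Prod>i\<in>UNIV. (x $ i) ^ I i)"

text \<open>\<open>I + e\<^sub>i\<close>; the order and the difference of multi-indices are the pointwise ones of functions.\<close>

definition madd :: "('n \<Rightarrow> nat) \<Rightarrow> 'n \<Rightarrow> 'n \<Rightarrow> nat" where
  "madd I i = I(i := Suc (I i))"

definition mindices :: "nat \<Rightarrow> ('n::finite \<Rightarrow> nat) set" where
  "mindices s = {I. mdeg I \<le> s}"

definition pdiff :: "'n::finite \<Rightarrow> (real^'n \<Rightarrow> real) \<Rightarrow> real^'n \<Rightarrow> real" where
  "pdiff i f x = frechet_derivative f (at x) (axis i 1)"

text \<open>The iterated partial derivative of multi-index \<open>I\<close>. For smooth functions the order of the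
  differentiations is irrelevant, so an arbitrary one is selected.\<close>

definition mdiff :: "('n::finite \<Rightarrow> nat) \<Rightarrow> (real^'n \<Rightarrow> real) \<Rightarrow> real^'n \<Rightarrow> real" where
  "mdiff I f = foldr pdiff (SOME is. \<forall>i. count_list is i = I i) f"

lemma finite_mdeg_less: "finite {I :: 'n::finite \<Rightarrow> nat. mdeg I < s}"
proof (rule finite_subset)
  show "{I :: 'n \<Rightarrow> nat. mdeg I < s} \<subseteq> (\<Pi>\<^sub>E i\<in>UNIV. {..<s})"
  proof
    fix I :: "'n \<Rightarrow> nat" assume "I \<in> {I. mdeg I < s}"
    then have "I i < s" for i
      using member_le_sum[of i UNIV I] by (auto simp: mdeg_def)
    then show "I \<in> (\<Pi>\<^sub>E i\<in>UNIV. {..<s})"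
      by (auto simp: PiE_def)
  qed
  show "finite (\<Pi>\<^sub>E i\<in>(UNIV :: 'n set). {..<s})"
    by (intro finite_PiE) auto
qed

text \<open>The pairs \<open>(\<alpha>, I)\<close> with \<open>|I| < CARD('s)\<close>, as a type. These label the fibre coordinates of the
  bundle of jets of order \<open>CARD('s) - 1\<close>. Thus \<open>'k option\<close> stands for the jets of order
  \<open>r = CARD('k) \<ge> 1\<close> and \<open>'k\<close> for those of order \<open>r - 1\<close>; moreover \<open>('m, 'n, 'k) jidx\<close> labels the
  canonical basis of \<open>\<real>\<^sup>N\<close>, since there \<open>|J| \<le> r - 1\<close>.\<close>

typedef ('m, 'n::finite, 's::finite) jidx =
  "{(\<alpha> :: 'm, I :: 'n \<Rightarrow> nat). mdeg I < CARD('s)}"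
  by (rule exI[of _ "(undefined, \<lambda>_. 0)"]) (auto simp: mdeg_def)

instance jidx :: (finite, finite, finite) finite
proof
  have "finite ((UNIV :: 'a set) \<times> {I :: 'b \<Rightarrow> nat. mdeg I < CARD('c)})"
    by (intro finite_cartesian_product finite_mdeg_less) auto
  moreover have "Rep_jidx A \<in> (UNIV :: 'a set) \<times> {I. mdeg I < CARD('c)}"
    for A :: "('a, 'b, 'c) jidx"
    using Rep_jidx[of A] by auto
  ultimately have "finite (range (Rep_jidx :: ('a, 'b, 'c) jidx \<Rightarrow> _))"
    by (meson finite_subset image_subsetI)
  then show "finite (UNIV :: ('a, 'b, 'c) jidx set)"
    by (rule finite_imageD) (simp add: inj_on_def Rep_jidx_inject)
qed

definition jx :: "'m \<Rightarrow> ('n::finite \<Rightarrow> nat) \<Rightarrow> ('m, 'n, 's::finite) jidx" where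
  "jx \<alpha> I = Abs_jidx (\<alpha>, I)"


section \<open>Fibred manifolds and their jet bundles\<close>

record ('e, 'q, 'n, 'm) fibration =
  total :: "('e, (real^'n) \<times> (real^'m)) mfd"
  base :: "('q, real^'n) mfd"
  proj :: "'e \<Rightarrow> 'q"

definition fibred_manifold :: "('e, 'q, 'n::finite, 'm::finite) fibration \<Rightarrow> bool" where
  "fibred_manifold P \<longleftrightarrow>
     smooth_manifold (total P) \<and> smooth_manifold (base P) \<and>
     smooth_map (total P) (points (total P)) (base P) (proj P) \<and>
     proj P ` points (total P) = points (base P) \<and>
     (\<forall>e\<in>points (total P). surj (tmap (total P) (base P) (proj P) e))"

text \<open>A fibred chart: a chart \<open>(x, u)\<close> of the total space together with the chart \<open>x\<close> of the base.\<close>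

type_synonym ('e, 'q, 'n, 'm) fchart = "('e, (real^'n) \<times> (real^'m)) chart \<times> ('q, real^'n) chart"

definition fibred_charts ::
    "('e, 'q, 'n::finite, 'm::finite) fibration \<Rightarrow> ('e, 'q, 'n, 'm) fchart set" where
  "fibred_charts P = {(c, d). c \<in> charts (total P) \<and> d \<in> charts (base P) \<and>
     proj P ` fst c \<subseteq> fst d \<and> (\<forall>e\<in>fst c. fst (snd c e) = snd d (proj P e))}"

text \<open>Local sections defined around \<open>q\<close>. Their values outside the neighbourhood are irrelevant.\<close>

definition sections_at :: "('e, 'q, 'n::finite, 'm::finite) fibration \<Rightarrow> 'q \<Rightarrow> ('q \<Rightarrow> 'e) set" where
  "sections_at P q = {\<sigma>. \<exists>V. openin (mtop (base P)) V \<and> q \<in> V \<and>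
     smooth_map (base P) V (total P) \<sigma> \<and> (\<forall>y\<in>V. proj P (\<sigma> y) = y)}"

text \<open>The derivative of multi-index \<open>I\<close> of the component \<open>u\<^sup>\<alpha> \<circ> \<sigma>\<close>, in a fibred chart.\<close>

definition section_deriv ::
    "('e, 'q, 'n::finite, 'm::finite) fchart \<Rightarrow> 'm \<Rightarrow> ('n \<Rightarrow> nat) \<Rightarrow> ('q \<Rightarrow> 'e) \<Rightarrow> 'q \<Rightarrow> real" where
  "section_deriv f \<alpha> I \<sigma> q =
     mdiff I (\<lambda>y. snd (snd (fst f) (\<sigma> (chart_inv (snd f) y))) $ \<alpha>) (snd (snd f) q)"

definition jet_equiv ::
    "('e, 'q, 'n::finite, 'm::finite) fibration \<Rightarrow> nat \<Rightarrow> 'q \<Rightarrow> ('q \<Rightarrow> 'e) \<Rightarrow> ('q \<Rightarrow> 'e) \<Rightarrow> bool" where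
  "jet_equiv P s q \<sigma> \<tau> \<longleftrightarrow> \<sigma> q = \<tau> q \<and>
     (\<forall>f\<in>fibred_charts P. \<sigma> q \<in> fst (fst f) \<longrightarrow>
        (\<forall>\<alpha>. \<forall>I\<in>mindices s. section_deriv f \<alpha> I \<sigma> q = section_deriv f \<alpha> I \<tau> q))"

text \<open>A jet at \<open>q\<close> is the pair of \<open>q\<close> and an equivalence class of local sections around \<open>q\<close>.\<close>

type_synonym ('q, 'e) jet = "'q \<times> ('q \<Rightarrow> 'e) set"

definition jet_of ::
    "('e, 'q, 'n::finite, 'm::finite) fibration \<Rightarrow> nat \<Rightarrow> 'q \<Rightarrow> ('q \<Rightarrow> 'e) \<Rightarrow> ('q, 'e) jet" where
  "jet_of P s q \<sigma> = (q, {\<tau> \<in> sections_at P q. jet_equiv P s q \<sigma> \<tau>})"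

definition jet_space ::
    "('e, 'q, 'n::finite, 'm::finite) fibration \<Rightarrow> nat \<Rightarrow> ('q, 'e) jet set" where
  "jet_space P s = {jet_of P s q \<sigma> | q \<sigma>. q \<in> points (base P) \<and> \<sigma> \<in> sections_at P q}"

definition jet_rep :: "('q, 'e) jet \<Rightarrow> 'q \<Rightarrow> 'e" where
  "jet_rep p = (SOME \<sigma>. \<sigma> \<in> snd p)"

definition jet_proj ::
    "('e, 'q, 'n::finite, 'm::finite) fibration \<Rightarrow> nat \<Rightarrow> ('q, 'e) jet \<Rightarrow> ('q, 'e) jet" where
  "jet_proj P s p = jet_of P s (fst p) (jet_rep p)"

text \<open>The space of the jet coordinates \<open>(x\<^sup>i, u\<^sup>\<alpha>\<^sub>I)\<close> with \<open>|I| < CARD('s)\<close>.\<close>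

type_synonym ('n, 'm, 's) jmodel = "(real^'n) \<times> (real^('m, 'n, 's) jidx)"

text \<open>The adapted chart induced by a fibred chart; its domain is the preimage of the domain of
  the fibred chart.\<close>

definition jet_chart :: "('e, 'q, 'n::finite, 'm::finite) fibration \<Rightarrow> ('e, 'q, 'n, 'm) fchart \<Rightarrow>
    (('q, 'e) jet, ('n, 'm, 's::finite) jmodel) chart" where
  "jet_chart P f =
     ({p \<in> jet_space P (CARD('s) - 1). jet_rep p (fst p) \<in> fst (fst f)},
      \<lambda>p. (snd (snd f) (fst p),
           \<chi> A. case Rep_jidx A of (\<alpha>, I) \<Rightarrow> section_deriv f \<alpha> I (jet_rep p) (fst p)))"

text \<open>The manifold of jets of order \<open>CARD('s) - 1\<close>, where \<open>'s\<close> is read off from the model space.\<close>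

definition jet_manifold :: "('e, 'q, 'n::finite, 'm::finite) fibration \<Rightarrow>
    (('q, 'e) jet, ('n, 'm, 's::finite) jmodel) mfd" where
  "jet_manifold P =
     \<lparr>points = jet_space P (CARD('s) - 1), atlas = jet_chart P ` fibred_charts P\<rparr>"

text \<open>The coordinate vector field \<open>\<partial>/\<partial>u\<^sup>\<alpha>\<^sub>I\<close> of an adapted chart.\<close>

definition partial_u :: "('e, 'q, 'n::finite, 'm::finite) fibration \<Rightarrow> ('e, 'q, 'n, 'm) fchart \<Rightarrow>
    'm \<Rightarrow> ('n \<Rightarrow> nat) \<Rightarrow> ('q, 'e) jet \<Rightarrow> ('n, 'm, 's::finite) jmodel" where
  "partial_u P f \<alpha> I p = tvec (jet_manifold P) (jet_chart P f) p (0, axis (jx \<alpha> I) 1)"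


section \<open>Contact forms, Cartan distribution and Spencer operator\<close>

text \<open>From here on \<open>r = CARD('k)\<close>, forms and vectors live on the jets of order \<open>r\<close>, and multi-indices
  of contact forms range over \<open>mindices (CARD('k) - 1)\<close>.\<close>

definition theta :: "('e, 'q, 'n::finite, 'm::finite) fibration \<Rightarrow> ('e, 'q, 'n, 'm) fchart \<Rightarrow>
    'm \<Rightarrow> ('n \<Rightarrow> nat) \<Rightarrow> ('q, 'e) jet \<Rightarrow> ('n, 'm, 'k::finite option) jmodel \<Rightarrow> real" where
  "theta P f \<alpha> I p v =
     (let c = jet_chart P f; w = tcoord (jet_manifold P) c p v in
        snd w $ jx \<alpha> I - (\<Sum>i\<in>UNIV. snd (snd c p) $ jx \<alpha> (madd I i) * fst w $ i))"

definition cartan :: "('e, 'q, 'n::finite, 'm::finite) fibration \<Rightarrow>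
    ('q, 'e) jet \<Rightarrow> ('n, 'm, 'k::finite option) jmodel set" where
  "cartan P p = {v. \<forall>f\<in>fibred_charts P.
     p \<in> fst (jet_chart P f :: (_, ('n, 'm, 'k option) jmodel) chart) \<longrightarrow>
       (\<forall>\<alpha>. \<forall>I\<in>mindices (CARD('k) - 1). theta P f \<alpha> I p v = 0)}"

definition eta_comp :: "('e, 'q, 'n::finite, 'm::finite) fibration \<Rightarrow> ('e, 'q, 'n, 'm) fchart \<Rightarrow>
    'm \<Rightarrow> ('n \<Rightarrow> nat) \<Rightarrow> ('q, 'e) jet \<Rightarrow> ('n, 'm, 'k::finite option) jmodel \<Rightarrow> real" where
  "eta_comp P f \<alpha> J p v =
     (\<Sum>L | J \<le> L \<and> L \<in> mindices (CARD('k) - 1).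
        (- 1) ^ mdeg (L - J) * (mpow (snd (snd f) (fst p)) (L - J) / mfact (L - J)) *
          theta P f \<alpha> L p v)"

definition eta :: "('e, 'q, 'n::finite, 'm::finite) fibration \<Rightarrow> ('e, 'q, 'n, 'm) fchart \<Rightarrow>
    ('q, 'e) jet \<Rightarrow> ('n, 'm, 'k::finite option) jmodel \<Rightarrow> real^('m, 'n, 'k) jidx" where
  "eta P f p v =
     (\<Sum>\<alpha>\<in>UNIV. \<Sum>J\<in>mindices (CARD('k) - 1). eta_comp P f \<alpha> J p v *\<^sub>R axis (jx \<alpha> J) 1)"

definition reeb :: "('e, 'q, 'n::finite, 'm::finite) fibration \<Rightarrow> ('e, 'q, 'n, 'm) fchart \<Rightarrow>
    'm \<Rightarrow> ('n \<Rightarrow> nat) \<Rightarrow> ('q, 'e) jet \<Rightarrow> ('n, 'm, 'k::finite option) jmodel" where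
  "reeb P f \<alpha> J p =
     (\<Sum>I | I \<le> J. (mpow (snd (snd f) (fst p)) (J - I) / mfact (J - I)) *\<^sub>R partial_u P f \<alpha> I p)"

text \<open>The linear extension of \<open>e\<^sup>J\<^sub>\<alpha> \<mapsto> R\<^sup>J\<^sub>\<alpha>\<close>.\<close>

definition reeb_lift :: "('e, 'q, 'n::finite, 'm::finite) fibration \<Rightarrow> ('e, 'q, 'n, 'm) fchart \<Rightarrow>
    ('q, 'e) jet \<Rightarrow> real^('m, 'n, 'k) jidx \<Rightarrow> ('n, 'm, 'k::finite option) jmodel" where
  "reeb_lift P f p z =
     (\<Sum>\<alpha>\<in>UNIV. \<Sum>J\<in>mindices (CARD('k) - 1). (z $ jx \<alpha> J) *\<^sub>R reeb P f \<alpha> J p)"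

text \<open>The tangent map of the projection from jets of order \<open>r\<close> to jets of order \<open>r - 1\<close>.\<close>

definition T_proj :: "('e, 'q, 'n::finite, 'm::finite) fibration \<Rightarrow> ('q, 'e) jet \<Rightarrow>
    ('n, 'm, 'k::finite option) jmodel \<Rightarrow> ('n, 'm, 'k) jmodel" where
  "T_proj P p = tmap (jet_manifold P) (jet_manifold P) (jet_proj P (CARD('k) - 1)) p"

text \<open>The one-form on jets of order \<open>r\<close> with values in the vertical bundle of the jets of order
  \<open>r - 1\<close> (pulled back to order \<open>r\<close>) that has the given expression in every adapted chart.\<close>

definition spencer :: "('e, 'q, 'n::finite, 'm::finite) fibration \<Rightarrow> ('q, 'e) jet \<Rightarrow>
    ('n, 'm, 'k::finite option) jmodel \<Rightarrow> ('n, 'm, 'k) jmodel" where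
  "spencer P p = (THE S.
     (\<forall>v. tmap (jet_manifold P :: (_, ('n, 'm, 'k) jmodel) mfd) (base P) fst
            (jet_proj P (CARD('k) - 1) p) (S v) = 0) \<and>
     (\<forall>f\<in>fibred_charts P. p \<in> fst (jet_chart P f :: (_, ('n, 'm, 'k option) jmodel) chart) \<longrightarrow>
        (\<forall>v. S v = (\<Sum>\<alpha>\<in>UNIV. \<Sum>I\<in>mindices (CARD('k) - 1).
           theta P f \<alpha> I p v *\<^sub>R partial_u P f \<alpha> I (jet_proj P (CARD('k) - 1) p)))))"

definition vclass :: "('e, 'q, 'n::finite, 'm::finite) fibration \<Rightarrow> ('q, 'e) jet \<Rightarrow>
    ('n, 'm, 'k::finite option) jmodel \<Rightarrow> ('n, 'm, 'k option) jmodel set" where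
  "vclass P p v = {w. T_proj P p (w - v) = 0}"

end

theory Submission
  imports Defs
begin

text \<open>
The local statements are a computation in jet coordinates \<open>(x\<^sup>i, u\<^sup>\<alpha>\<^sub>I)\<close>. Put
\<open>c\<^sub>K(x) = (-1)\<^bsup>|K|\<^esup> x\<^bsup>K\<^esup>/K!\<close>, so that \<open>\<eta>\<^sup>\<alpha>\<^sub>J\<close> is the sum of the \<open>c\<^bsub>L-J\<^esub> \<theta>\<^sup>\<alpha>\<^sub>L\<close>. Lowering an index
of \<open>c\<^sub>K\<close> is, up to sign, a partial derivative, and passing from \<open>L\<close> to \<open>L + e\<^sub>i\<close> is the shift that
occurs in \<open>d\<theta>\<^sup>\<alpha>\<^sub>L\<close>. Therefore the terms of \<open>d\<eta>\<^sup>\<alpha>\<^sub>J\<close> telescope and only those of top order survive: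
\<open>d\<eta>\<^sup>\<alpha>\<^sub>J\<close> is the sum of \<open>c\<^bsub>L-J\<^esub> dx\<^sup>i \<and> du\<^sup>\<alpha>\<^bsub>L+e\<^sub>i\<^esub>\<close> over \<open>|L| = r - 1\<close> (\<open>ceta_ext_deriv\<close>). Its kernel is spanned by the
\<open>\<partial>/\<partial>u\<^sup>\<alpha>\<^sub>I\<close> with \<open>|I| < r\<close> (\<open>dceta_kernel\<close>), a complement of the Cartan distribution, and this is the
contact condition. The matrix of the \<open>c\<^bsub>L-J\<^esub>\<close> and that of the \<open>x\<^bsup>J-I\<^esup>/(J-I)!\<close> are inverse to each other by the binomial
theorem (\<open>dmon_convolution\<close>). This gives at once that the kernel of \<open>\<eta>\<close> is the common kernel of the \<open>\<theta>\<^sup>\<alpha>\<^sub>L\<close>,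
that the stated vector fields are dual to \<open>\<eta>\<close>, and that the Reeb lift of \<open>\<eta>\<close> is the sum of the
\<open>\<theta>\<^sup>\<alpha>\<^sub>I \<otimes> \<partial>/\<partial>u\<^sup>\<alpha>\<^sub>I\<close>. The Reeb fields are unique because two solutions differ by an element of both kernels.

The statements that involve several charts need the jets to be a manifold. Every point of the total space lies in
a fibred chart by the inverse function theorem (\<open>ex_fibred_chart\<close>). Agreement of maps to
order \<open>s\<close> is stable under composition (\<open>agree_compose\<close>), so the coordinates of a jet in one chart
determine the jet. Polynomials realise all coordinate values (\<open>psec\<close>), and the new coordinates of a
polynomial section are derivatives of a map that is jointly smooth in the point and in the coefficients, so the
transition maps are smooth (\<open>jet_smooth_transition\<close>).

Both the Cartan distribution and the Spencer operator come from the vertical vector with components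
\<open>\<theta>\<^sup>\<alpha>\<^sub>I(v)\<close> on the jets of order \<open>r - 1\<close>. Differentiating the change of coordinates along the jet of a polynomial
section shows that transition maps respect total derivatives (\<open>FD_T_tderiv\<close>). Below the top
order, what is left of a vector after subtracting total derivatives is therefore transformed by the transition map of
order \<open>r - 1\<close> (\<open>cvert_transition\<close>); so this vertical vector does not depend on the chart, and neither do the
vectors \<open>v\<close> for which it vanishes. The differential of the projection to order \<open>r - 1\<close> sends the Reeb lift of
\<open>\<eta>\<close> to this vector, hence the class of the lift is the same in all charts.
\<close>

section \<open>Smooth maps between Euclidean spaces\<close>

abbreviation FD :: "('a::real_normed_vector \<Rightarrow> 'b::real_normed_vector) \<Rightarrow> 'a \<Rightarrow> 'a \<Rightarrow> 'b" where
  "FD f x \<equiv> frechet_derivative f (at x)"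

lemma FD_eq: "(f has_derivative f') (at x) \<Longrightarrow> FD f x = f'"
  using frechet_derivative_at by metis

lemma FD_works: "f differentiable (at x) \<Longrightarrow> (f has_derivative FD f x) (at x)"
  using frechet_derivative_works by blast

lemma differentiable_cong_open:
  assumes "f differentiable (at x)" "open S" "x \<in> S" "\<And>y. y \<in> S \<Longrightarrow> f y = g y"
  shows "g differentiable (at x)"
  using assms has_derivative_transform_within_open unfolding differentiable_def by blast

lemma FD_cong_open:
  assumes "open S" "x \<in> S" "\<And>y. y \<in> S \<Longrightarrow> f y = g y"
  shows "FD f x = FD g x"
proof -
  have "(f has_derivative f') (at x) \<longleftrightarrow> (g has_derivative f') (at x)" for f'
    using has_derivative_transform_within_open[OF _ assms(1,2)] assms(3) by metis
  then show ?thesis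
    unfolding frechet_derivative_def by simp
qed

lemma Ck_on_cong:
  assumes "open S" "\<And>x. x \<in> S \<Longrightarrow> f x = g x" "Ck_on k S f"
  shows "Ck_on k S g"
  using assms(2,3)
proof (induction k arbitrary: f g)
  case 0
  then show ?case by (metis Ck_on.simps(1) continuous_on_cong)
next
  case (Suc k)
  have "g differentiable (at x)" if "x \<in> S" for x
    using Suc.prems that differentiable_cong_open[OF _ assms(1)] by (metis Ck_on.simps(2))
  moreover have "Ck_on k S (\<lambda>x. FD g x v)" for v
  proof (rule Suc.IH[of "\<lambda>x. FD f x v"])
    show "FD f x v = FD g x v" if "x \<in> S" for x
      using FD_cong_open[OF assms(1) that] Suc.prems(1) by metis
  qed (use Suc.prems in auto)
  ultimately show ?case by simp
qed

lemma Ck_on_subset: "Ck_on k S f \<Longrightarrow> T \<subseteq> S \<Longrightarrow> Ck_on k T f"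
  by (induction k arbitrary: f) (auto intro: continuous_on_subset)

lemma Ck_on_mono_Suc: "Ck_on (Suc k) S f \<Longrightarrow> Ck_on k S f"
proof (induction k arbitrary: f)
  case 0
  then have "\<forall>x\<in>S. continuous (at x) f"
    using differentiable_imp_continuous_within by auto
  then show ?case by (simp add: continuous_at_imp_continuous_on)
next
  case (Suc k)
  then show ?case by (metis Ck_on.simps(2))
qed

text \<open>Both continuity and the differentials at a point depend on the map near the point only; hence
  smoothness may be tested in any open cover, which is how charts enter later on.\<close>

lemma Ck_on_locally:
  assumes "\<And>x. x \<in> S \<Longrightarrow> \<exists>T. open T \<and> x \<in> T \<and> Ck_on k T f"
  shows "Ck_on k S f"
  using assms
proof (induction k arbitrary: f)
  case 0
  have "continuous (at x) f" if "x \<in> S" for x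
    using 0[OF that] continuous_on_eq_continuous_at by auto
  then show ?case by (simp add: continuous_at_imp_continuous_on)
next
  case (Suc k)
  show ?case
    unfolding Ck_on.simps
  proof (intro conjI ballI allI)
    show "f differentiable at x" if "x \<in> S" for x
      using Suc.prems[OF that] by auto
    show "Ck_on k S (\<lambda>x. FD f x v)" for v
      using Suc.prems by (intro Suc.IH) (metis Ck_on.simps(2))
  qed
qed

lemma Ck_on_const [simp]: "Ck_on k S (\<lambda>x. c)"
  by (induction k arbitrary: c) auto

lemma Ck_on_linear: "linear h \<Longrightarrow> Ck_on k S h"
proof (cases k)
  case 0
  assume "linear h" then show ?thesis by (simp add: 0 linear_continuous_on linear_linear)
next
  case (Suc l)
  assume "linear h"
  then have d: "(h has_derivative h) (at x)" for x
    by (simp add: bounded_linear_imp_has_derivative linear_linear)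
  have "FD h x = h" for x by (rule FD_eq[OF d])
  then show ?thesis using d by (auto simp: Suc differentiable_def)
qed

lemma Ck_on_add:
  assumes "Ck_on k S f" "Ck_on k S g" "open S"
  shows "Ck_on k S (\<lambda>x. f x + g x)"
  using assms(1,2)
proof (induction k arbitrary: f g)
  case 0
  then show ?case by (auto intro: continuous_intros)
next
  case (Suc k)
  have d: "FD (\<lambda>x. f x + g x) x v = FD f x v + FD g x v" if "x \<in> S" for x v
  proof -
    have "((\<lambda>x. f x + g x) has_derivative (\<lambda>v. FD f x v + FD g x v)) (at x)"
      using Suc.prems that by (intro has_derivative_add FD_works) auto
    from FD_eq[OF this] show ?thesis by simp
  qed
  have "Ck_on k S (\<lambda>x. FD (\<lambda>x. f x + g x) x v)" for v
    by (rule Ck_on_cong[OF assms(3), of "\<lambda>x. FD f x v + FD g x v"])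
      (use Suc d in auto)
  then show ?case using Suc.prems by (auto intro: differentiable_add)
qed

text \<open>By the product rule, the derivative is a sum of two products whose factors are of class \<open>C\<^sup>k\<close>; so
  the induction on the order closes for all bilinear products at once.\<close>

lemma Ck_on_bilinear:
  assumes "bounded_bilinear B" "Ck_on k S f" "Ck_on k S g" "open S"
  shows "Ck_on k S (\<lambda>x. B (f x) (g x))"
  using assms(2,3)
proof (induction k arbitrary: f g)
  case 0
  then show ?case using bounded_bilinear.continuous_on[OF assms(1)] by auto
next
  case (Suc k)
  have D: "((\<lambda>x. B (f x) (g x)) has_derivative (\<lambda>v. B (f x) (FD g x v) + B (FD f x v) (g x))) (at x)"
    if "x \<in> S" for x
    using Suc.prems that by (intro bounded_bilinear.FDERIV[OF assms(1)] FD_works) auto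
  have d: "FD (\<lambda>x. B (f x) (g x)) x v = B (f x) (FD g x v) + B (FD f x v) (g x)" if "x \<in> S" for x v
    using FD_eq[OF D[OF that]] by simp
  have "Ck_on k S (\<lambda>x. FD (\<lambda>x. B (f x) (g x)) x v)" for v
  proof (rule Ck_on_cong[OF assms(4)])
    show "Ck_on k S (\<lambda>x. B (f x) (FD g x v) + B (FD f x v) (g x))"
      using Suc.prems Ck_on_mono_Suc[OF Suc.prems(1)] Ck_on_mono_Suc[OF Suc.prems(2)]
      by (intro Ck_on_add Suc.IH assms(4)) auto
  qed (use d in auto)
  then show ?case using D by (auto simp: differentiable_def)
qed

lemma Ck_on_sum:
  assumes "\<And>i. i \<in> I \<Longrightarrow> Ck_on k S (f i)" "open S"
  shows "Ck_on k S (\<lambda>x. \<Sum>i\<in>I. f i x)"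
  using assms(1)
  by (induction I rule: infinite_finite_induct) (auto intro: Ck_on_add assms(2))

lemma FD_linear: "f differentiable (at x) \<Longrightarrow> linear (FD f x)"
  by (rule linear_frechet_derivative)

lemma linear_basis_expansion:
  fixes h :: "'a::euclidean_space \<Rightarrow> 'b::real_vector"
  assumes "linear h"
  shows "h w = (\<Sum>b\<in>Basis. (w \<bullet> b) *\<^sub>R h b)"
proof -
  have "h w = h (\<Sum>b\<in>Basis. (w \<bullet> b) *\<^sub>R b)" by (simp add: euclidean_representation)
  then show ?thesis by (simp add: linear_sum[OF assms] linear_cmul[OF assms])
qed

text \<open>The chain rule becomes a sum of products after the inner derivative is expanded in the standard
  basis; each factor is then covered by the induction hypothesis.\<close>

lemma Ck_on_compose:
  assumes "Ck_on k S f" "Ck_on k T g" "f ` S \<subseteq> T" "open S"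
  shows "Ck_on k S (\<lambda>x. g (f x))"
  using assms(1-3)
proof (induction k arbitrary: g)
  case 0
  then show ?case by (auto intro: continuous_on_compose2)
next
  case (Suc k)
  have D: "((\<lambda>x. g (f x)) has_derivative (\<lambda>v. FD g (f x) (FD f x v))) (at x)" if "x \<in> S" for x
    by (rule has_derivative_compose[of f]) (use Suc.prems that in \<open>auto intro!: FD_works\<close>)
  have d: "FD (\<lambda>x. g (f x)) x v = (\<Sum>b\<in>Basis. (FD f x v \<bullet> b) *\<^sub>R FD g (f x) b)" if "x \<in> S" for x v
  proof -
    have "FD (\<lambda>x. g (f x)) x v = FD g (f x) (FD f x v)"
      using FD_eq[OF D[OF that]] by simp
    also have "\<dots> = (\<Sum>b\<in>Basis. (FD f x v \<bullet> b) *\<^sub>R FD g (f x) b)"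
      by (rule linear_basis_expansion[OF FD_linear]) (use that Suc.prems in auto)
    finally show ?thesis .
  qed
  have "Ck_on k S (\<lambda>x. FD (\<lambda>x. g (f x)) x v)" for v
  proof (rule Ck_on_cong[OF assms(4)])
    show "Ck_on k S (\<lambda>x. \<Sum>b\<in>Basis. (FD f x v \<bullet> b) *\<^sub>R FD g (f x) b)"
    proof (rule Ck_on_sum[OF _ assms(4)], rule Ck_on_bilinear[OF bounded_bilinear_scaleR _ _ assms(4)])
      show "Ck_on k S (\<lambda>x. FD f x v \<bullet> b)" for b
        by (rule Ck_on_bilinear[OF bounded_bilinear_inner _ Ck_on_const assms(4)]) (use Suc.prems in auto)
      show "Ck_on k S (\<lambda>x. FD g (f x) b)" for b
        by (rule Suc.IH[of "\<lambda>y. FD g y b"]) (use Suc.prems Ck_on_mono_Suc[OF Suc.prems(1)] in auto)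
    qed
  qed (use d in auto)
  then show ?case by (simp add: differentiableI[OF D])
qed

lemma Ck_on_inverse:
  fixes f :: "'a::euclidean_space \<Rightarrow> real"
  assumes "Ck_on k S f" "open S" "\<And>x. x \<in> S \<Longrightarrow> f x \<noteq> 0"
  shows "Ck_on k S (\<lambda>x. inverse (f x))"
  using assms(1)
proof (induction k)
  case 0
  then show ?case using assms(3) by (auto intro: continuous_intros)
next
  case (Suc k)
  have D: "((\<lambda>x. inverse (f x)) has_derivative (\<lambda>v. - (inverse (f x) * FD f x v * inverse (f x)))) (at x)"
    if "x \<in> S" for x
    by (rule Deriv.has_derivative_inverse) (use Suc.prems that assms(3) in \<open>simp_all add: FD_works\<close>)
  have "Ck_on k S (\<lambda>x. FD (\<lambda>x. inverse (f x)) x v)" for v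
  proof (rule Ck_on_cong[OF assms(2)])
    have i: "Ck_on k S (\<lambda>x. inverse (f x))"
      using Suc.IH Ck_on_mono_Suc[OF Suc.prems] by blast
    have "Ck_on k S (\<lambda>x. FD f x v)" using Suc.prems by simp
    then have "Ck_on k S (\<lambda>x. (- 1) * ((inverse (f x) * FD f x v) * inverse (f x)))"
      by (intro Ck_on_bilinear[OF bounded_bilinear_mult] assms(2) Ck_on_const i)
    then show "Ck_on k S (\<lambda>x. - (inverse (f x) * FD f x v * inverse (f x)))" by simp
  qed (use FD_eq[OF D] in simp)
  then show ?case by (simp add: differentiableI[OF D])
qed

lemma Ck_on_FD: "Ck_on (Suc k) S f \<Longrightarrow> Ck_on k S (\<lambda>x. FD f x v)"
  by simp

lemma smooth_onD: "smooth_on S f \<Longrightarrow> Ck_on k S f"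
  by (simp add: smooth_on_def)

(* for a variable order, unfolding the recursion would bring in differentials again and again *)
declare Ck_on.simps [simp del]

lemma smooth_on_differentiable: "smooth_on S f \<Longrightarrow> x \<in> S \<Longrightarrow> f differentiable (at x)"
  using smooth_onD[of S f "Suc 0"] by (simp add: Ck_on.simps)

lemma smooth_on_has_derivative: "smooth_on S f \<Longrightarrow> x \<in> S \<Longrightarrow> (f has_derivative FD f x) (at x)"
  by (simp add: FD_works smooth_on_differentiable)

lemma smooth_on_FD_linear: "smooth_on S f \<Longrightarrow> x \<in> S \<Longrightarrow> linear (FD f x)"
  by (simp add: FD_linear smooth_on_differentiable)

lemma smooth_on_FD: "smooth_on S f \<Longrightarrow> smooth_on S (\<lambda>x. FD f x v)"
  unfolding smooth_on_def by (rule allI, rule Ck_on_FD, erule spec)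

lemma smooth_on_continuous: "smooth_on S f \<Longrightarrow> continuous_on S f"
  using smooth_onD[of S f 0] by (simp add: Ck_on.simps)

lemma smooth_on_cong:
  assumes "smooth_on S f" "open S" "\<And>x. x \<in> S \<Longrightarrow> f x = g x"
  shows "smooth_on S g"
  unfolding smooth_on_def
proof
  show "Ck_on k S g" for k
    by (rule Ck_on_cong[OF assms(2,3) smooth_onD[OF assms(1)]])
qed

lemma smooth_on_subset: "smooth_on S f \<Longrightarrow> T \<subseteq> S \<Longrightarrow> smooth_on T f"
  by (simp add: smooth_on_def Ck_on_subset[of _ S])

lemma smooth_on_locally:
  assumes "\<And>x. x \<in> S \<Longrightarrow> \<exists>T. open T \<and> x \<in> T \<and> smooth_on T f"
  shows "smooth_on S f"
  unfolding smooth_on_def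
proof
  show "Ck_on k S f" for k
  proof (rule Ck_on_locally)
    fix x assume "x \<in> S"
    then obtain T where "open T" "x \<in> T" "smooth_on T f" using assms by auto
    then show "\<exists>T. open T \<and> x \<in> T \<and> Ck_on k T f" using smooth_onD[of T f k] by auto
  qed
qed

lemma smooth_on_const [simp]: "smooth_on S (\<lambda>x. c)"
  by (simp add: smooth_on_def)

lemma smooth_on_linear: "linear h \<Longrightarrow> smooth_on S h"
  by (simp add: smooth_on_def Ck_on_linear)

lemma smooth_on_compose:
  "smooth_on T g \<Longrightarrow> smooth_on S f \<Longrightarrow> open S \<Longrightarrow> f ` S \<subseteq> T \<Longrightarrow> smooth_on S (\<lambda>x. g (f x))"
  unfolding smooth_on_def by (intro allI Ck_on_compose[of _ S f T g]) auto

lemma smooth_on_linear_compose: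
  "linear h \<Longrightarrow> smooth_on S f \<Longrightarrow> open S \<Longrightarrow> smooth_on S (\<lambda>x. h (f x))"
  by (rule smooth_on_compose[OF smooth_on_linear[of h UNIV]]) auto

lemma smooth_on_add:
  "smooth_on S f \<Longrightarrow> smooth_on S g \<Longrightarrow> open S \<Longrightarrow> smooth_on S (\<lambda>x. f x + g x)"
  by (simp add: smooth_on_def Ck_on_add)

lemma smooth_on_sum:
  "(\<And>i. i \<in> I \<Longrightarrow> smooth_on S (f i)) \<Longrightarrow> open S \<Longrightarrow> smooth_on S (\<lambda>x. \<Sum>i\<in>I. f i x)"
  by (simp add: smooth_on_def Ck_on_sum)

lemma smooth_on_bilinear:
  "bounded_bilinear B \<Longrightarrow> smooth_on S f \<Longrightarrow> smooth_on S g \<Longrightarrow> open S \<Longrightarrow>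
    smooth_on S (\<lambda>x. B (f x) (g x))"
  by (simp add: smooth_on_def Ck_on_bilinear)

lemmas smooth_on_scaleR = smooth_on_bilinear[OF bounded_bilinear_scaleR]
lemmas smooth_on_inner = smooth_on_bilinear[OF bounded_bilinear_inner]

lemma smooth_on_mult:
  fixes f g :: "'a::euclidean_space \<Rightarrow> real"
  shows "smooth_on S f \<Longrightarrow> smooth_on S g \<Longrightarrow> open S \<Longrightarrow> smooth_on S (\<lambda>x. f x * g x)"
  by (rule smooth_on_bilinear[OF bounded_bilinear_mult])

lemma smooth_on_diff:
  assumes "smooth_on S f" "smooth_on S g" "open S"
  shows "smooth_on S (\<lambda>x. f x - g x)"
  using smooth_on_add[OF assms(1) smooth_on_linear_compose[OF _ assms(2,3), of "uminus"]] assms(3)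
  by (simp add: linear_iff)

lemma smooth_on_prod:
  fixes f :: "'i \<Rightarrow> 'a::euclidean_space \<Rightarrow> real"
  shows "(\<And>i. i \<in> I \<Longrightarrow> smooth_on S (f i)) \<Longrightarrow> open S \<Longrightarrow> smooth_on S (\<lambda>x. \<Prod>i\<in>I. f i x)"
  by (induction I rule: infinite_finite_induct) (auto intro: smooth_on_mult)

lemma smooth_on_power:
  fixes f :: "'a::euclidean_space \<Rightarrow> real"
  shows "smooth_on S f \<Longrightarrow> open S \<Longrightarrow> smooth_on S (\<lambda>x. f x ^ j)"
  by (induction j) (auto intro: smooth_on_mult)

lemma smooth_on_id [simp]: "smooth_on S (\<lambda>x. x)"
  using smooth_on_linear[OF linear_id] by (simp add: id_def)

lemma linear_fst': "linear (fst :: 'a::real_normed_vector \<times> 'b::real_normed_vector \<Rightarrow> 'a)"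
  and linear_snd': "linear (snd :: 'a::real_normed_vector \<times> 'b::real_normed_vector \<Rightarrow> 'b)"
  by (simp_all add: linear_iff)

lemma linear_vec_nth': "linear (\<lambda>x::real^'n. x $ i)"
  by (simp add: linear_iff)

lemma smooth_on_fst: "smooth_on S f \<Longrightarrow> open S \<Longrightarrow> smooth_on S (\<lambda>x. fst (f x))"
  and smooth_on_snd: "smooth_on S f \<Longrightarrow> open S \<Longrightarrow> smooth_on S (\<lambda>x. snd (f x))"
  by (auto intro: smooth_on_linear_compose[OF linear_fst'] smooth_on_linear_compose[OF linear_snd'])

lemma smooth_on_nth: "smooth_on S f \<Longrightarrow> open S \<Longrightarrow> smooth_on S (\<lambda>x. f x $ i :: real)"
  by (auto intro: smooth_on_linear_compose[OF linear_vec_nth'])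

lemma smooth_on_Pair:
  assumes "smooth_on S f" "smooth_on S g" "open S"
  shows "smooth_on S (\<lambda>x. (f x, g x))"
proof -
  have "smooth_on S (\<lambda>x. (f x, 0) + (0, g x))"
    using assms
    by (intro smooth_on_add smooth_on_linear_compose[of "\<lambda>y. (y, 0)" _ f]
          smooth_on_linear_compose[of "\<lambda>y. (0, y)" _ g]) (auto simp: linear_iff)
  then show ?thesis by simp
qed

lemma vec_lambda_sum_axis: "(\<chi> i. z i) = (\<Sum>i\<in>UNIV. z i *\<^sub>R axis i (1::real))"
  by (vector axis_def) (simp add: vec_eq_iff if_distrib cong: if_cong)

lemma smooth_on_vec:
  fixes f :: "'i::finite \<Rightarrow> 'a::euclidean_space \<Rightarrow> real"
  assumes "\<And>i. smooth_on S (f i)" "open S"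
  shows "smooth_on S (\<lambda>x. \<chi> i. f i x)"
  unfolding vec_lambda_sum_axis using assms
  by (intro smooth_on_sum smooth_on_scaleR smooth_on_const) auto

text \<open>The differential is linear in its argument, so expanding the argument in the standard basis reduces
  the joint dependence on the point and on the vector to products of smooth functions.\<close>

lemma smooth_on_FD_apply:
  assumes "smooth_on T g" "smooth_on S f" "smooth_on S w" "open S" "f ` S \<subseteq> T"
  shows "smooth_on S (\<lambda>x. FD g (f x) (w x))"
proof (rule smooth_on_cong[OF _ assms(4)])
  show "smooth_on S (\<lambda>x. \<Sum>b\<in>Basis. (w x \<bullet> b) *\<^sub>R FD g (f x) b)"
    using assms
    by (intro smooth_on_sum smooth_on_scaleR smooth_on_inner smooth_on_const
          smooth_on_compose[OF smooth_on_FD]) auto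
  show "(\<Sum>b\<in>Basis. (w x \<bullet> b) *\<^sub>R FD g (f x) b) = FD g (f x) (w x)" if "x \<in> S" for x
    using that assms by (intro linear_basis_expansion[symmetric] smooth_on_FD_linear) auto
qed

lemma FD_compose:
  assumes "g differentiable (at (f x))" "f differentiable (at x)"
  shows "FD (\<lambda>x. g (f x)) x v = FD g (f x) (FD f x v)"
proof -
  have "((\<lambda>x. g (f x)) has_derivative (\<lambda>v. FD g (f x) (FD f x v))) (at x)"
    by (rule has_derivative_compose[OF FD_works[OF assms(2)] FD_works[OF assms(1)]])
  from FD_eq[OF this] show ?thesis by simp
qed

lemma FD_linear_compose:
  fixes f :: "'a::euclidean_space \<Rightarrow> 'b::euclidean_space" and h :: "'b \<Rightarrow> 'c::euclidean_space"
  assumes "f differentiable (at x)" "linear h"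
  shows "FD (\<lambda>x. h (f x)) x v = h (FD f x v)"
proof -
  have "bounded_linear h"
    using assms(2) linear_conv_bounded_linear by blast
  from bounded_linear.has_derivative[OF this FD_works[OF assms(1)]]
  have "((\<lambda>x. h (f x)) has_derivative (\<lambda>v. h (FD f x v))) (at x)" .
  from FD_eq[OF this] show ?thesis by simp
qed

text \<open>Along a segment, the second difference of a function equals the mixed second derivative
  at an intermediate point; it is symmetric in the two increments, hence so is the second
  derivative by continuity.\<close>

lemma second_difference_mvt:
  fixes f :: "'a::euclidean_space \<Rightarrow> real"
  assumes sm: "smooth_on (ball x e) f" and e: "e > 0" and t: "0 < t" "t * (norm v + norm w) < e"
  shows "\<exists>y. norm (y - x) \<le> t * (norm v + norm w) \<and>
    f (x + t *\<^sub>R v + t *\<^sub>R w) - f (x + t *\<^sub>R v) - f (x + t *\<^sub>R w) + f x = t * t * FD (\<lambda>y. FD f y v) y w"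
proof -
  have in_ball: "x + a *\<^sub>R v + b *\<^sub>R w \<in> ball x e" if "0 \<le> a" "a \<le> t" "0 \<le> b" "b \<le> t" for a b
  proof -
    have "norm (a *\<^sub>R v + b *\<^sub>R w) \<le> a * norm v + b * norm w"
      using norm_triangle_ineq[of "a *\<^sub>R v" "b *\<^sub>R w"] that by simp
    also have "\<dots> \<le> t * norm v + t * norm w"
      using that by (intro add_mono mult_right_mono) auto
    finally show ?thesis
      using t norm_minus_cancel[of "a *\<^sub>R v + b *\<^sub>R w"]
      by (simp add: dist_norm algebra_simps)
  qed
  define g where "g s = f (x + s *\<^sub>R v + t *\<^sub>R w) - f (x + s *\<^sub>R v)" for s
  have dg: "(g has_derivative (\<lambda>h. FD f (x + s *\<^sub>R v + t *\<^sub>R w) (h *\<^sub>R v) - FD f (x + s *\<^sub>R v) (h *\<^sub>R v))) (at s)"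
    if "0 \<le> s" "s \<le> t" for s
    unfolding g_def
  proof (intro has_derivative_diff)
    show "((\<lambda>s. f (x + s *\<^sub>R v + t *\<^sub>R w)) has_derivative (\<lambda>h. FD f (x + s *\<^sub>R v + t *\<^sub>R w) (h *\<^sub>R v))) (at s)"
      by (rule has_derivative_compose[of "\<lambda>s. x + s *\<^sub>R v + t *\<^sub>R w" "\<lambda>h. h *\<^sub>R v"])
        (use in_ball[of s t] that t in \<open>auto intro!: derivative_eq_intros smooth_on_has_derivative[OF sm]\<close>)
    show "((\<lambda>s. f (x + s *\<^sub>R v)) has_derivative (\<lambda>h. FD f (x + s *\<^sub>R v) (h *\<^sub>R v))) (at s)"
      by (rule has_derivative_compose[of "\<lambda>s. x + s *\<^sub>R v" "\<lambda>h. h *\<^sub>R v"])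
        (use in_ball[of s 0] that t in \<open>auto intro!: derivative_eq_intros smooth_on_has_derivative[OF sm]\<close>)
  qed
  obtain s where s: "0 < s" "s < t"
    "g t - g 0 = FD f (x + s *\<^sub>R v + t *\<^sub>R w) (t *\<^sub>R v) - FD f (x + s *\<^sub>R v) (t *\<^sub>R v)"
    using mvt_simple[of 0 t g "\<lambda>s h. FD f (x + s *\<^sub>R v + t *\<^sub>R w) (h *\<^sub>R v) - FD f (x + s *\<^sub>R v) (h *\<^sub>R v)"] t dg
    by (auto simp: has_derivative_at_withinI)
  define k where "k r = FD f (x + s *\<^sub>R v + r *\<^sub>R w) v" for r
  have dk: "(k has_derivative (\<lambda>h. FD (\<lambda>y. FD f y v) (x + s *\<^sub>R v + r *\<^sub>R w) (h *\<^sub>R w))) (at r)"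
    if "0 \<le> r" "r \<le> t" for r
    unfolding k_def
    by (rule has_derivative_compose[of "\<lambda>r. x + s *\<^sub>R v + r *\<^sub>R w" "\<lambda>h. h *\<^sub>R w" _ _ "\<lambda>y. FD f y v"])
       (use in_ball[of s r] that s in \<open>auto intro!: derivative_eq_intros smooth_on_has_derivative[OF smooth_on_FD[OF sm]]\<close>)
  obtain r where r: "0 < r" "r < t"
    "k t - k 0 = FD (\<lambda>y. FD f y v) (x + s *\<^sub>R v + r *\<^sub>R w) (t *\<^sub>R w)"
    using mvt_simple[of 0 t k "\<lambda>r h. FD (\<lambda>y. FD f y v) (x + s *\<^sub>R v + r *\<^sub>R w) (h *\<^sub>R w)"] t dk
    by (auto simp: has_derivative_at_withinI)
  let ?y = "x + s *\<^sub>R v + r *\<^sub>R w"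
  have lin1: "linear (FD f (x + s *\<^sub>R v + t *\<^sub>R w))" "linear (FD f (x + s *\<^sub>R v))"
    using in_ball[of s t] in_ball[of s 0] s t smooth_on_FD_linear[OF sm] by auto
  have lin2: "linear (FD (\<lambda>y. FD f y v) ?y)"
    using in_ball[of s r] s r smooth_on_FD_linear[OF smooth_on_FD[OF sm]] by auto
  have "g t - g 0 = t * (k t - k 0)"
    using s(3) lin1 by (simp add: k_def linear_cmul algebra_simps)
  also have "\<dots> = t * t * FD (\<lambda>y. FD f y v) ?y w"
    using r(3) lin2 by (simp add: linear_cmul)
  finally have "g t - g 0 = t * t * FD (\<lambda>y. FD f y v) ?y w" .
  moreover have "norm (?y - x) \<le> t * (norm v + norm w)"
  proof -
    have "norm (?y - x) \<le> s * norm v + r * norm w"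
      using norm_triangle_ineq[of "s *\<^sub>R v" "r *\<^sub>R w"] s r by (simp add: add.assoc)
    also have "\<dots> \<le> t * norm v + t * norm w"
      using s r by (intro add_mono mult_right_mono) auto
    finally show ?thesis by (simp add: algebra_simps)
  qed
  ultimately show ?thesis by (intro exI[of _ ?y]) (simp add: g_def)
qed

text \<open>If the two mixed derivatives were different, continuity would keep them apart near \<open>x\<close>, although
  they take equal values at points arbitrarily close to \<open>x\<close> by the previous lemma.\<close>

lemma second_derivative_symmetric_real:
  fixes f :: "'a::euclidean_space \<Rightarrow> real"
  assumes sm: "smooth_on S f" and S: "open S" "x \<in> S"
  shows "FD (\<lambda>y. FD f y v) x w = FD (\<lambda>y. FD f y w) x v"
proof (rule ccontr)
  let ?A = "\<lambda>y. FD (\<lambda>y. FD f y v) y w" and ?B = "\<lambda>y. FD (\<lambda>y. FD f y w) y v"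
  assume ne: "?A x \<noteq> ?B x"
  define d where "d = \<bar>?A x - ?B x\<bar> / 2"
  have "d > 0" using ne by (simp add: d_def)
  obtain e where e: "e > 0" "ball x e \<subseteq> S" using S open_contains_ball by blast
  have smb: "smooth_on (ball x e) f" using sm e smooth_on_subset by blast
  have cA: "continuous_on (ball x e) ?A" and cB: "continuous_on (ball x e) ?B"
    by (intro smooth_on_continuous smooth_on_FD smb)+
  obtain dA where dA: "dA > 0" "\<And>y. y \<in> ball x e \<Longrightarrow> dist y x < dA \<Longrightarrow> dist (?A y) (?A x) < d"
    using cA e \<open>d > 0\<close> unfolding continuous_on_iff by (metis centre_in_ball)
  obtain dB where dB: "dB > 0" "\<And>y. y \<in> ball x e \<Longrightarrow> dist y x < dB \<Longrightarrow> dist (?B y) (?B x) < d"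
    using cB e \<open>d > 0\<close> unfolding continuous_on_iff by (metis centre_in_ball)
  define c where "c = min e (min dA dB)"
  have c: "c > 0" "c \<le> e" "c \<le> dA" "c \<le> dB" using e dA dB by (auto simp: c_def)
  define N where "N = norm v + norm w + 1"
  have N: "N > 0" "norm v + norm w < N" by (auto simp: N_def add_nonneg_pos)
  define t where "t = c / N"
  have t: "t > 0" "t * (norm v + norm w) < c"
    using c N mult_strict_left_mono[OF N(2) \<open>c > 0\<close>] by (simp_all add: t_def divide_less_eq)
  obtain y where y: "norm (y - x) \<le> t * (norm v + norm w)"
    "f (x + t *\<^sub>R v + t *\<^sub>R w) - f (x + t *\<^sub>R v) - f (x + t *\<^sub>R w) + f x = t * t * ?A y"
    using second_difference_mvt[OF smb e(1) t(1), of v w] t c by auto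
  obtain z where z: "norm (z - x) \<le> t * (norm v + norm w)"
    "f (x + t *\<^sub>R w + t *\<^sub>R v) - f (x + t *\<^sub>R w) - f (x + t *\<^sub>R v) + f x = t * t * ?B z"
    using second_difference_mvt[OF smb e(1) t(1), of w v] t c by (auto simp: add.commute)
  have "t * t * ?A y = t * t * ?B z"
    using y(2) z(2) by (simp add: algebra_simps)
  then have "?A y = ?B z" using t by simp
  moreover have "dist (?A y) (?A x) < d"
    using y(1) t c by (intro dA) (auto simp: dist_norm norm_minus_commute)
  moreover have "dist (?B z) (?B x) < d"
    using z(1) t c by (intro dB) (auto simp: dist_norm norm_minus_commute)
  ultimately show False by (simp add: d_def dist_real_def abs_if split: if_splits)
qed

lemma second_derivative_symmetric:
  assumes sm: "smooth_on S f" and S: "open S" "x \<in> S"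
  shows "FD (\<lambda>y. FD f y v) x w = FD (\<lambda>y. FD f y w) x v"
proof (rule euclidean_eqI)
  fix b :: 'b assume "b \<in> Basis"
  have lin: "linear (\<lambda>y. y \<bullet> b)" by (simp add: linear_iff inner_add_left)
  have inner: "FD (\<lambda>y. FD f y v) x w \<bullet> b = FD (\<lambda>y. FD (\<lambda>y. f y \<bullet> b) y v) x w" for v w
  proof -
    have "FD (\<lambda>y. FD f y v) x w \<bullet> b = FD (\<lambda>y. FD f y v \<bullet> b) x w"
      using FD_linear_compose[OF smooth_on_differentiable[OF smooth_on_FD[OF sm] S(2)] lin] by simp
    also have "\<dots> = FD (\<lambda>y. FD (\<lambda>y. f y \<bullet> b) y v) x w"
    proof -
      have "FD f y v \<bullet> b = FD (\<lambda>y. f y \<bullet> b) y v" if "y \<in> S" for y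
        using FD_linear_compose[OF smooth_on_differentiable[OF sm that] lin] by simp
      from FD_cong_open[OF S this] show ?thesis by simp
    qed
    finally show ?thesis .
  qed
  show "FD (\<lambda>y. FD f y v) x w \<bullet> b = FD (\<lambda>y. FD f y w) x v \<bullet> b"
    unfolding inner
    by (rule second_derivative_symmetric_real[OF smooth_on_linear_compose[OF lin sm S(1)] S])
qed

section \<open>Iterated partial derivatives\<close>

lemma pdiff_cong_open:
  assumes "open S" "x \<in> S" "\<And>y. y \<in> S \<Longrightarrow> f y = g y"
  shows "pdiff i f x = pdiff i g x"
  unfolding pdiff_def using FD_cong_open[of S x f g] assms by simp

lemma foldr_pdiff_cong_open:
  assumes "open S" "x \<in> S" "\<And>y. y \<in> S \<Longrightarrow> f y = g y"
  shows "foldr pdiff is f x = foldr pdiff is g x"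
  using assms(2)
proof (induction "is" arbitrary: x)
  case Nil
  then show ?case using assms(3) by simp
next
  case (Cons i "is")
  have "pdiff i (foldr pdiff is f) x = pdiff i (foldr pdiff is g) x"
    by (rule pdiff_cong_open[OF assms(1) Cons.prems Cons.IH])
  then show ?case by simp
qed

lemma smooth_on_pdiff: "smooth_on S f \<Longrightarrow> smooth_on S (pdiff i f)"
  using smooth_on_FD[of S f "axis i 1"] unfolding pdiff_def[abs_def] .

lemma smooth_on_foldr_pdiff: "smooth_on S f \<Longrightarrow> smooth_on S (foldr pdiff is f)"
  by (induction "is") (auto intro: smooth_on_pdiff)

lemma foldr_pdiff_commute:
  assumes "smooth_on S f" "open S" "x \<in> S"
  shows "foldr pdiff is (pdiff i f) x = pdiff i (foldr pdiff is f) x"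
  using assms(3)
proof (induction "is" arbitrary: x)
  case (Cons j "is")
  have "pdiff j (foldr pdiff is (pdiff i f)) x = pdiff j (pdiff i (foldr pdiff is f)) x"
    by (rule pdiff_cong_open[OF assms(2) Cons.prems Cons.IH])
  also have "\<dots> = pdiff i (pdiff j (foldr pdiff is f)) x"
    using second_derivative_symmetric[OF smooth_on_foldr_pdiff[OF assms(1)] assms(2) Cons.prems]
    unfolding pdiff_def[abs_def] .
  finally show ?case by simp
qed simp

text \<open>An index of the first list is moved to the front of the second one by commuting partial
  derivatives; the rest is induction.\<close>

lemma foldr_pdiff_perm:
  assumes "smooth_on S f" "open S" "x \<in> S" "mset is = mset js"
  shows "foldr pdiff is f x = foldr pdiff js f x"
  using assms(3,4)
proof (induction "is" arbitrary: js x)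
  case (Cons i "is")
  then have "i \<in> set js" by (metis list.set_intros(1) set_mset_mset)
  then obtain as bs where js: "js = as @ i # bs" by (meson split_list)
  then have m: "mset is = mset (as @ bs)" using Cons.prems(2) by simp
  have "pdiff i (foldr pdiff is f) x = pdiff i (foldr pdiff (as @ bs) f) x"
    by (rule pdiff_cong_open[OF assms(2) Cons.prems(1)]) (use Cons.IH m in blast)
  also have "\<dots> = foldr pdiff as (pdiff i (foldr pdiff bs f)) x"
    using foldr_pdiff_commute[OF smooth_on_foldr_pdiff[OF assms(1)] assms(2) Cons.prems(1), of as i bs]
    by simp
  finally show ?case by (simp add: js)
qed simp

lemma ex_list_count:
  fixes I :: "'n::finite \<Rightarrow> nat"
  shows "\<exists>is. \<forall>i. count_list is i = I i"
proof -
  obtain "is" where "mset is = (\<Sum>i\<in>UNIV. replicate_mset (I i) i)"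
    using ex_mset by blast
  then have "count (mset is) i = I i" for i
    by (simp add: count_sum if_distrib cong: if_cong)
  then show ?thesis by (auto simp: count_mset)
qed

text \<open>This makes the choice in the definition of \<open>mdiff\<close> immaterial for smooth functions.\<close>

lemma mdiff_eq_foldr:
  assumes "smooth_on S f" "open S" "x \<in> S" "\<And>i. count_list is i = I i"
  shows "mdiff I f x = foldr pdiff is f x"
proof -
  define js where "js = (SOME is. \<forall>i. count_list is i = I i)"
  have "\<forall>i. count_list js i = I i"
    unfolding js_def by (rule someI_ex[OF ex_list_count])
  then have "mset js = mset is"
    using assms(4) by (intro multiset_eqI) (simp add: count_mset)
  then show ?thesis
    unfolding mdiff_def js_def[symmetric] by (intro foldr_pdiff_perm[OF assms(1-3)])
qed

lemma obtain_mdiff_list: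
  fixes I :: "'n::finite \<Rightarrow> nat"
  obtains "is" where "\<And>i. count_list is i = I i" "length is = mdeg I" "\<And>f. mdiff I f = foldr pdiff is f"
proof -
  define js where "js = (SOME is. \<forall>i. count_list is i = I i)"
  have c: "\<forall>i. count_list js i = I i"
    unfolding js_def by (rule someI_ex[OF ex_list_count])
  have "mdeg I = sum (count_list js) UNIV" using c by (simp add: mdeg_def)
  also have "\<dots> = length js" by (rule sum_count_set) auto
  finally have "length js = mdeg I" by simp
  moreover have "mdiff I f = foldr pdiff js f" for f by (simp add: mdiff_def js_def)
  ultimately show ?thesis using that c by blast
qed

lemma mdiff_cong_open:
  assumes "open S" "x \<in> S" "\<And>y. y \<in> S \<Longrightarrow> f y = g y"
  shows "mdiff I f x = mdiff I g x"
  unfolding mdiff_def by (rule foldr_pdiff_cong_open[OF assms])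

lemma smooth_on_mdiff: "smooth_on S f \<Longrightarrow> smooth_on S (mdiff I f)"
  unfolding mdiff_def by (rule smooth_on_foldr_pdiff)

lemma mdiff_0 [simp]: "mdiff (\<lambda>_. 0) f = f"
proof -
  obtain "is" :: "'a list" where "length is = mdeg (\<lambda>_::'a. 0)" "\<And>f. mdiff (\<lambda>_. 0) f = foldr pdiff is f"
    using obtain_mdiff_list by metis
  then show ?thesis by (simp add: mdeg_def)
qed

lemma mdiff_madd:
  assumes "smooth_on S f" "open S" "x \<in> S"
  shows "mdiff (madd I i) f x = pdiff i (mdiff I f) x"
    and "mdiff (madd I i) f x = mdiff I (pdiff i f) x"
proof -
  obtain "is" where cs: "\<And>i. count_list is i = I i" "\<And>f. mdiff I f = foldr pdiff is f"
    using obtain_mdiff_list by metis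
  have "mdiff (madd I i) f x = foldr pdiff (i # is) f x"
    by (rule mdiff_eq_foldr[OF assms]) (simp add: cs(1) madd_def)
  then show "mdiff (madd I i) f x = pdiff i (mdiff I f) x" by (simp add: cs(2))
  then show "mdiff (madd I i) f x = mdiff I (pdiff i f) x"
    by (simp add: cs(2) foldr_pdiff_commute[OF assms])
qed

lemma mdeg_madd [simp]: "mdeg (madd I i) = Suc (mdeg I)"
proof -
  have "mdeg (madd I i) = (\<Sum>j\<in>UNIV. I j + (if j = i then 1 else 0))"
    unfolding mdeg_def madd_def by (rule sum.cong) auto
  then show ?thesis by (simp add: sum.distrib mdeg_def)
qed

lemma mdeg_mono: "I \<le> J \<Longrightarrow> mdeg I \<le> mdeg J"
  unfolding mdeg_def by (intro sum_mono) (simp add: le_fun_def)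

lemma mdeg_diff: "I \<le> J \<Longrightarrow> mdeg (J - I) = mdeg J - mdeg I"
  unfolding mdeg_def by (simp add: le_fun_def sum_subtractf_nat)

lemma mdeg_eq_0: "mdeg I = 0 \<longleftrightarrow> I = (\<lambda>_. 0)"
  by (auto simp: mdeg_def fun_eq_iff)

lemma madd_inj: "madd I i = madd I j \<Longrightarrow> i = j"
  by (metis fun_upd_apply madd_def n_not_Suc_n)

lemma madd_commute: "madd (madd I i) j = madd (madd I j) i"
  by (auto simp: madd_def fun_eq_iff)

lemma mdeg_Suc_obtain:
  assumes "mdeg K = Suc s"
  obtains I i where "K = madd I i" "mdeg I = s"
proof -
  obtain i where "K i \<noteq> 0" using assms mdeg_eq_0[of K] by auto
  then have "K = madd (K(i := K i - 1)) i" by (auto simp: madd_def)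
  then show ?thesis using that assms mdeg_madd by (metis nat.inject)
qed

lemma finite_mindices [simp]: "finite (mindices s :: ('n::finite \<Rightarrow> nat) set)"
proof -
  have "(mindices s :: ('n \<Rightarrow> nat) set) = {I. mdeg I < Suc s}" by (auto simp: mindices_def)
  then show ?thesis by (simp only: finite_mdeg_less)
qed


section \<open>The divided monomials\<close>

text \<open>The functions \<open>x\<^sup>I/I!\<close>. With the factorial included, partial differentiation only lowers the index.\<close>

definition dmon :: "('n::finite \<Rightarrow> nat) \<Rightarrow> real^'n \<Rightarrow> real" where
  "dmon I x = mpow x I / mfact I"

lemma dmon_prod: "dmon I x = (\<Prod>i\<in>UNIV. (x $ i) ^ I i / fact (I i))"
  by (simp add: dmon_def mpow_def mfact_def prod_dividef)

lemma dmon_zero_index [simp]: "dmon (\<lambda>_. 0) x = 1"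
  by (simp add: dmon_prod)

lemma dmon_at_0: "dmon I 0 = (if I = (\<lambda>_. 0) then 1 else 0)"
proof (cases "I = (\<lambda>_. 0)")
  case False
  then obtain i where "I i \<noteq> 0" by auto
  then have "\<exists>i. (0 :: real) ^ I i = 0" by (intro exI[of _ i]) simp
  then show ?thesis using False by (auto simp: dmon_prod)
qed simp

lemma smooth_on_dmon: "open S \<Longrightarrow> smooth_on S (dmon I)"
proof -
  assume S: "open S"
  have "smooth_on S (\<lambda>x. (\<Prod>i\<in>UNIV. (x $ i) ^ I i) * inverse (mfact I))"
    by (rule smooth_on_mult[OF smooth_on_prod[OF smooth_on_power[OF smooth_on_nth[OF smooth_on_id]]]
          smooth_on_const]) (rule S)+
  then show ?thesis unfolding dmon_def mpow_def divide_inverse .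
qed

text \<open>This reduces partial derivatives of a product over the variables to derivatives of one factor.\<close>

lemma FD_along_line:
  assumes "f differentiable (at x)"
  shows "((\<lambda>t. f (x + t *\<^sub>R v)) has_vector_derivative FD f x v) (at 0)"
proof -
  have l: "((\<lambda>t. x + t *\<^sub>R v) has_derivative (\<lambda>h. h *\<^sub>R v)) (at 0)"
    by (auto intro!: derivative_eq_intros)
  have "((\<lambda>t. f (x + t *\<^sub>R v)) has_derivative (\<lambda>h. FD f x (h *\<^sub>R v))) (at 0)"
    using has_derivative_compose[OF l, of f "FD f x"] FD_works[OF assms] by simp
  then show ?thesis
    unfolding has_vector_derivative_def by (simp add: linear_cmul[OF FD_linear[OF assms]])
qed

lemma pdiff_dmon:
  "pdiff i (dmon I) x = (if I i = 0 then 0 else dmon (I(i := I i - 1)) x)"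
proof -
  let ?R = "\<Prod>j\<in>UNIV - {i}. (x $ j) ^ I j / fact (I j)"
  have split: "dmon J y = (y $ i) ^ J i / fact (J i) * (\<Prod>j\<in>UNIV - {i}. (y $ j) ^ J j / fact (J j))" for J y
    unfolding dmon_prod by (rule prod.remove) auto
  have line: "dmon I (x + t *\<^sub>R axis i 1) = (x $ i + t) ^ I i / fact (I i) * ?R" for t
    unfolding split by (auto simp: axis_def intro!: prod.cong)
  have "dmon I differentiable (at x)"
    using smooth_on_differentiable[OF smooth_on_dmon[OF open_UNIV]] by auto
  from FD_along_line[OF this, of "axis i 1"]
  have 1: "((\<lambda>t. (x $ i + t) ^ I i / fact (I i) * ?R) has_real_derivative pdiff i (dmon I) x) (at 0)"
    unfolding line pdiff_def has_real_derivative_iff_has_vector_derivative .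
  have 2: "((\<lambda>t. (x $ i + t) ^ I i / fact (I i) * ?R) has_real_derivative
    (real (I i) * (x $ i) ^ (I i - 1) / fact (I i) * ?R)) (at 0)"
    by (auto intro!: derivative_eq_intros)
  have "pdiff i (dmon I) x = real (I i) * (x $ i) ^ (I i - 1) / fact (I i) * ?R"
    by (rule DERIV_unique[OF 1 2])
  also have "\<dots> = (if I i = 0 then 0 else dmon (I(i := I i - 1)) x)"
  proof (cases "I i")
    case (Suc k)
    have "real (Suc k) * a / fact (Suc k) = a / fact k" for a :: real
      by (simp del: of_nat_Suc)
    then show ?thesis unfolding split using Suc by (simp del: of_nat_Suc fact_Suc)
  qed simp
  finally show ?thesis .
qed

lemma foldr_pdiff_sum:
  assumes "\<And>k. k \<in> A \<Longrightarrow> smooth_on UNIV (f k)"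
  shows "foldr pdiff is (\<lambda>x. \<Sum>k\<in>A. c k * f k x) = (\<lambda>x. \<Sum>k\<in>A. c k * foldr pdiff is (f k) x)"
proof (induction "is")
  case (Cons i "is")
  have "pdiff i (\<lambda>x. \<Sum>k\<in>A. c k * foldr pdiff is (f k) x) x
      = (\<Sum>k\<in>A. c k * pdiff i (foldr pdiff is (f k)) x)" for x
  proof -
    have "((\<lambda>x. \<Sum>k\<in>A. c k * foldr pdiff is (f k) x) has_derivative
        (\<lambda>v. \<Sum>k\<in>A. c k * FD (foldr pdiff is (f k)) x v)) (at x)"
      by (rule has_derivative_sum, rule has_derivative_mult_right,
          rule smooth_on_has_derivative[OF smooth_on_foldr_pdiff[OF assms]]) auto
    from FD_eq[OF this] show ?thesis by (simp add: pdiff_def)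
  qed
  then show ?case using Cons by auto
qed simp

lemma foldr_pdiff_shift:
  assumes "smooth_on UNIV f"
  shows "foldr pdiff is (\<lambda>x. f (x - a)) = (\<lambda>x. foldr pdiff is f (x - a))"
proof (induction "is")
  case (Cons i "is")
  have "pdiff i (\<lambda>x. foldr pdiff is f (x - a)) x = pdiff i (foldr pdiff is f) (x - a)" for x
  proof -
    have s: "((\<lambda>x. x - a) has_derivative (\<lambda>v. v)) (at x)"
      by (auto intro!: derivative_eq_intros)
    have "((\<lambda>x. foldr pdiff is f (x - a)) has_derivative FD (foldr pdiff is f) (x - a)) (at x)"
      by (rule has_derivative_compose[OF s smooth_on_has_derivative[OF smooth_on_foldr_pdiff[OF assms]]]) simp
    from FD_eq[OF this] show ?thesis by (simp add: pdiff_def)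
  qed
  then show ?case using Cons by auto
qed simp

lemma mdiff_dmon: "mdiff J (dmon I) x = (if J \<le> I then dmon (I - J) x else 0)"
proof -
  obtain "is" where cs: "\<And>i. count_list is i = J i" "\<And>f. mdiff J f = foldr pdiff is f"
    using obtain_mdiff_list by metis
  have "foldr pdiff is (dmon I) = (\<lambda>x. if count_list is \<le> I then dmon (I - count_list is) x else 0)" for "is"
  proof (induction "is")
    case Nil
    have "(count_list [] :: 'a \<Rightarrow> nat) = (\<lambda>_. 0)" by auto
    then show ?case by (simp add: le_fun_def fun_diff_def)
  next
    case (Cons i "is")
    let ?J = "count_list is"
    define N where "N = count_list (i # is)"
    have N: "N = ?J(i := Suc (?J i))" by (auto simp: N_def)
    have "foldr pdiff (i # is) (dmon I) = (\<lambda>x. if N \<le> I then dmon (I - N) x else 0)"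
    proof (cases "?J \<le> I \<and> ?J i < I i")
      case True
      then have "N \<le> I" by (auto simp: le_fun_def N)
      moreover have "(I - ?J)(i := (I - ?J) i - 1) = I - N"
        by (auto simp: fun_eq_iff N)
      moreover have "pdiff i (dmon (I - ?J)) x = dmon ((I - ?J)(i := (I - ?J) i - 1)) x" for x
        using True by (simp add: pdiff_dmon)
      ultimately show ?thesis
        using True unfolding foldr_Cons o_def Cons.IH by auto
    next
      case False
      then have F: "\<not> N \<le> I"
        by (auto simp: le_fun_def N split: if_splits) (metis Suc_leD Suc_le_lessD)
      have "pdiff i (\<lambda>x. if ?J \<le> I then dmon (I - ?J) x else 0) x = 0" for x
      proof (cases "?J \<le> I")
        case True
        then have "(I - ?J) i = 0" using False by simp
        then show ?thesis using True by (simp add: pdiff_dmon)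
      qed (simp add: pdiff_def)
      then show ?thesis using F unfolding foldr_Cons o_def Cons.IH by auto
    qed
    then show ?case unfolding N_def .
  qed
  moreover have "count_list is = J" using cs(1) by auto
  ultimately show ?thesis by (simp add: cs(2))
qed

text \<open>Every finite family of numbers occurs as the derivatives at \<open>a\<close> of a polynomial; this is what makes
  every point of the coordinate space the coordinates of a jet.\<close>

lemma mdiff_taylor_poly:
  fixes a :: "real^'n::finite"
  assumes "finite A"
  shows "mdiff J (\<lambda>x. \<Sum>I\<in>A. c I * dmon I (x - a)) x = (\<Sum>I\<in>A. if J \<le> I then c I * dmon (I - J) (x - a) else 0)"
    and "mdiff J (\<lambda>x. \<Sum>I\<in>A. c I * dmon I (x - a)) a = (if J \<in> A then c J else 0)"
proof -
  have sm: "smooth_on UNIV (\<lambda>x. dmon I (x - a))" for I :: "'n \<Rightarrow> nat"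
    by (rule smooth_on_compose[OF smooth_on_dmon[OF open_UNIV] smooth_on_diff[OF smooth_on_id smooth_on_const]]) auto
  show 1: "mdiff J (\<lambda>x. \<Sum>I\<in>A. c I * dmon I (x - a)) x
      = (\<Sum>I\<in>A. if J \<le> I then c I * dmon (I - J) (x - a) else 0)" for x
  proof -
    have "mdiff J (\<lambda>x. \<Sum>I\<in>A. c I * dmon I (x - a)) = (\<lambda>x. \<Sum>I\<in>A. c I * mdiff J (\<lambda>x. dmon I (x - a)) x)"
      unfolding mdiff_def by (rule foldr_pdiff_sum[OF sm])
    moreover have "mdiff J (\<lambda>x. dmon I (x - a)) = (\<lambda>x. mdiff J (dmon I) (x - a))" for I
      unfolding mdiff_def by (rule foldr_pdiff_shift[OF smooth_on_dmon[OF open_UNIV]])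
    ultimately have "mdiff J (\<lambda>x. \<Sum>I\<in>A. c I * dmon I (x - a)) x = (\<Sum>I\<in>A. c I * mdiff J (dmon I) (x - a))"
      by simp
    then show ?thesis by (simp add: mdiff_dmon if_distrib cong: if_cong)
  qed
  have "I - J = (\<lambda>_. 0) \<longleftrightarrow> I = J" if "J \<le> I" for I
    using that by (auto simp: fun_eq_iff le_fun_def) (metis diff_is_0_eq le_antisym)
  then have "(\<Sum>I\<in>A. if J \<le> I then c I * dmon (I - J) (a - a) else 0) = (\<Sum>I\<in>A. if I = J then c J else 0)"
    by (intro sum.cong) (auto simp: dmon_at_0)
  then show "mdiff J (\<lambda>x. \<Sum>I\<in>A. c I * dmon I (x - a)) a = (if J \<in> A then c J else 0)"
    unfolding 1 using assms by simp
qed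

text \<open>The sum factors over the variables, and the factor of the \<open>i\<close>-th variable is the binomial expansion
  of \<open>(x\<^sub>i - x\<^sub>i)\<^sup>d/d!\<close> with \<open>d = L\<^sub>i - I\<^sub>i\<close>.\<close>

lemma dmon_convolution:
  fixes I L :: "'n::finite \<Rightarrow> nat"
  assumes "I \<le> L"
  shows "(\<Sum>J | I \<le> J \<and> J \<le> L. (- 1) ^ mdeg (L - J) * dmon (L - J) x * dmon (J - I) x) = (if I = L then 1 else 0)"
proof -
  define t where "t i j = (- (x $ i)) ^ (L i - j) / fact (L i - j) * ((x $ i) ^ (j - I i) / fact (j - I i))" for i j
  have st: "{J. I \<le> J \<and> J \<le> L} = Pi\<^sub>E UNIV (\<lambda>i. {I i..L i})"
    by (auto simp: le_fun_def PiE_def)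
  have trm: "(- 1) ^ mdeg (L - J) * dmon (L - J) x * dmon (J - I) x = (\<Prod>i\<in>UNIV. t i (J i))" for J
  proof -
    have "(- 1) ^ mdeg (L - J) * dmon (L - J) x
        = (\<Prod>i\<in>UNIV. (- 1) ^ (L i - J i) * ((x $ i) ^ (L i - J i) / fact (L i - J i)))"
      by (simp only: dmon_prod mdeg_def power_sum prod.distrib fun_diff_def minus_apply)
    also have "\<dots> = (\<Prod>i\<in>UNIV. (- (x $ i)) ^ (L i - J i) / fact (L i - J i))"
    proof -
      have "(- 1) ^ k * (b ^ k / c) = (- b) ^ k / c" for k and b c :: real
        by (simp add: power_minus[of b])
      then show ?thesis by (simp only:)
    qed
    finally have 1: "(- 1) ^ mdeg (L - J) * dmon (L - J) x = (\<Prod>i\<in>UNIV. (- (x $ i)) ^ (L i - J i) / fact (L i - J i))" .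
    show ?thesis unfolding 1 dmon_prod[of "J - I"] t_def prod.distrib by simp
  qed
  have one: "(\<Sum>j\<in>{I i..L i}. t i j) = (if I i = L i then 1 else 0)" for i
  proof -
    define d where "d = L i - I i"
    have Ld: "L i = I i + d" using assms by (simp add: d_def le_fun_def)
    have "(\<Sum>j\<in>{I i..L i}. t i j) = (\<Sum>k\<le>d. t i (I i + k))"
      unfolding Ld atMost_atLeast0
      using sum.shift_bounds_cl_nat_ivl[of "t i" 0 "I i" d] by (simp add: add.commute)
    also have "\<dots> = (\<Sum>k\<le>d. of_nat (d choose k) * (x $ i) ^ k * (- (x $ i)) ^ (d - k)) / fact d"
      unfolding sum_divide_distrib
      by (intro sum.cong) (auto simp: t_def Ld binomial_fact field_simps)
    also have "\<dots> = ((x $ i) + (- (x $ i))) ^ d / fact d"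
      by (simp only: binomial_ring)
    also have "\<dots> = (if I i = L i then 1 else 0)"
      by (auto simp: Ld)
    finally show ?thesis .
  qed
  have "(\<Sum>J | I \<le> J \<and> J \<le> L. (- 1) ^ mdeg (L - J) * dmon (L - J) x * dmon (J - I) x)
      = (\<Sum>J\<in>Pi\<^sub>E UNIV (\<lambda>i. {I i..L i}). \<Prod>i\<in>UNIV. t i (J i))"
    unfolding st trm ..
  also have "\<dots> = (\<Prod>i\<in>UNIV. \<Sum>j\<in>{I i..L i}. t i j)"
    by (rule prod_sum_PiE[symmetric]) auto
  also have "\<dots> = (if I = L then 1 else 0)"
    unfolding one by (auto simp: fun_eq_iff)
  finally show ?thesis .
qed


section \<open>Agreement of maps to a given order\<close>

text \<open>Equality of all derivatives up to order \<open>k\<close>, in a recursive form that parallels the definition of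
  \<open>Ck_on\<close>. The closure properties below then have the same proofs as those of smooth functions, and no formula
  for the higher derivatives of a composition is needed.\<close>

primrec agree :: "nat \<Rightarrow> 'a::euclidean_space \<Rightarrow> ('a \<Rightarrow> 'b::euclidean_space) \<Rightarrow> ('a \<Rightarrow> 'b) \<Rightarrow> bool" where
  "agree 0 x f g \<longleftrightarrow> f x = g x"
| "agree (Suc k) x f g \<longleftrightarrow> f x = g x \<and> (\<forall>v. agree k x (\<lambda>y. FD f y v) (\<lambda>y. FD g y v))"

lemma agree_value: "agree k x f g \<Longrightarrow> f x = g x"
  by (cases k) auto

lemma agree_refl [simp]: "agree k x f f"
  by (induction k arbitrary: f) auto

lemma agree_Suc_D: "agree (Suc k) x f g \<Longrightarrow> agree k x f g"
proof (induction k arbitrary: f g)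
  case (Suc k)
  then have "\<And>v. agree (Suc k) x (\<lambda>y. FD f y v) (\<lambda>y. FD g y v)" by (metis agree.simps(2))
  then show ?case using Suc.IH agree_value[OF Suc.prems] by simp
qed simp

lemma agree_cong:
  assumes "open S" "x \<in> S" "\<And>y. y \<in> S \<Longrightarrow> f y = f' y" "\<And>y. y \<in> S \<Longrightarrow> g y = g' y" "agree k x f g"
  shows "agree k x f' g'"
  using assms(3-)
proof (induction k arbitrary: f f' g g')
  case 0
  then show ?case using assms(2) by simp
next
  case (Suc k)
  have "agree k x (\<lambda>y. FD f' y v) (\<lambda>y. FD g' y v)" for v
  proof (rule Suc.IH)
    show "FD f y v = FD f' y v" "FD g y v = FD g' y v" if "y \<in> S" for y
      using FD_cong_open[OF assms(1) that, of f f'] FD_cong_open[OF assms(1) that, of g g'] Suc.prems(1,2)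
      by auto
    show "agree k x (\<lambda>y. FD f y v) (\<lambda>y. FD g y v)" using Suc.prems(3) by simp
  qed
  then show ?case using agree_value[OF Suc.prems(3)] Suc.prems(1,2)[OF assms(2)] by simp
qed

lemma agree_add:
  assumes S: "open S" "x \<in> S"
    and sm: "smooth_on S f" "smooth_on S f'" "smooth_on S g" "smooth_on S g'"
    and ag: "agree k x f f'" "agree k x g g'"
  shows "agree k x (\<lambda>y. f y + g y) (\<lambda>y. f' y + g' y)"
  using sm ag
proof (induction k arbitrary: f f' g g')
  case (Suc k)
  have d: "FD (\<lambda>y. f y + g y) y v = FD f y v + FD g y v"
    if "smooth_on S f" "smooth_on S g" "y \<in> S" for f g :: "'a \<Rightarrow> 'b" and y v
    using FD_eq[OF has_derivative_add[OF smooth_on_has_derivative[OF that(1,3)] smooth_on_has_derivative[OF that(2,3)]]]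
    by simp
  have "agree k x (\<lambda>y. FD (\<lambda>y. f y + g y) y v) (\<lambda>y. FD (\<lambda>y. f' y + g' y) y v)" for v
  proof (rule agree_cong[OF S])
    show "agree k x (\<lambda>y. FD f y v + FD g y v) (\<lambda>y. FD f' y v + FD g' y v)"
      by (rule Suc.IH) (use Suc.prems smooth_on_FD in auto)
  qed (simp_all add: d Suc.prems)
  then show ?case using agree_value[OF Suc.prems(5)] agree_value[OF Suc.prems(6)] by simp
qed simp

lemma agree_sum:
  assumes S: "open S" "x \<in> S" and "finite A"
    and "\<And>i. i \<in> A \<Longrightarrow> smooth_on S (f i)" "\<And>i. i \<in> A \<Longrightarrow> smooth_on S (g i)"
    and "\<And>i. i \<in> A \<Longrightarrow> agree k x (f i) (g i)"
  shows "agree k x (\<lambda>y. \<Sum>i\<in>A. f i y) (\<lambda>y. \<Sum>i\<in>A. g i y)"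
  using assms(3-)
proof (induction A rule: finite_induct)
  case (insert i A)
  have "agree k x (\<lambda>y. f i y + (\<Sum>i\<in>A. f i y)) (\<lambda>y. g i y + (\<Sum>i\<in>A. g i y))"
    by (rule agree_add[OF S]) (use insert S in \<open>auto intro: smooth_on_sum\<close>)
  then show ?case using insert by simp
qed simp

lemma agree_bilinear:
  assumes B: "bounded_bilinear B" and S: "open S" "x \<in> S"
    and sm: "smooth_on S f" "smooth_on S f'" "smooth_on S g" "smooth_on S g'"
    and ag: "agree k x f f'" "agree k x g g'"
  shows "agree k x (\<lambda>y. B (f y) (g y)) (\<lambda>y. B (f' y) (g' y))"
  using sm ag
proof (induction k arbitrary: f f' g g')
  case (Suc k)
  have d: "FD (\<lambda>y. B (f y) (g y)) y v = B (f y) (FD g y v) + B (FD f y v) (g y)"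
    if "smooth_on S f" "smooth_on S g" "y \<in> S" for f g y v
    using FD_eq[OF bounded_bilinear.FDERIV[OF B smooth_on_has_derivative[OF that(1,3)] smooth_on_has_derivative[OF that(2,3)]]]
    by simp
  have "agree k x (\<lambda>y. FD (\<lambda>y. B (f y) (g y)) y v) (\<lambda>y. FD (\<lambda>y. B (f' y) (g' y)) y v)" for v
  proof (rule agree_cong[OF S])
    note sm = Suc.prems(1-4) Suc.prems(1-4)[THEN smooth_on_FD]
    note ag = agree_Suc_D[OF Suc.prems(5)] agree_Suc_D[OF Suc.prems(6)]
    have agv: "agree k x (\<lambda>y. FD f y v) (\<lambda>y. FD f' y v)" "agree k x (\<lambda>y. FD g y v) (\<lambda>y. FD g' y v)"
      using Suc.prems(5,6) by auto
    show "agree k x (\<lambda>y. B (f y) (FD g y v) + B (FD f y v) (g y))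
                    (\<lambda>y. B (f' y) (FD g' y v) + B (FD f' y v) (g' y))"
      by (rule agree_add[OF S])
        (rule smooth_on_bilinear[OF B] Suc.IH sm S(1) ag agv)+
  qed (simp_all add: d Suc.prems)
  then show ?case using agree_value[OF Suc.prems(5)] agree_value[OF Suc.prems(6)] by simp
qed simp

lemma agree_compose:
  assumes S: "open S" "x \<in> S" and f: "smooth_on S f" "smooth_on S f'" "f ` S \<subseteq> T" "f' ` S \<subseteq> T"
    and g: "smooth_on T g" "smooth_on T g'"
    and ag: "agree k x f f'" "agree k (f x) g g'"
  shows "agree k x (\<lambda>y. g (f y)) (\<lambda>y. g' (f' y))"
  using g ag
proof (induction k arbitrary: g g')
  case (Suc k)
  have d: "FD (\<lambda>y. g (f y)) y v = (\<Sum>b\<in>Basis. (FD f y v \<bullet> b) *\<^sub>R FD g (f y) b)"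
    if "smooth_on T g" "smooth_on S f" "f ` S \<subseteq> T" "y \<in> S" for f y v and g :: "'b \<Rightarrow> 'c"
  proof -
    have "f y \<in> T" using that by auto
    have "FD (\<lambda>y. g (f y)) y v = FD g (f y) (FD f y v)"
      by (rule FD_compose[OF smooth_on_differentiable[OF that(1) \<open>f y \<in> T\<close>] smooth_on_differentiable[OF that(2,4)]])
    also have "\<dots> = (\<Sum>b\<in>Basis. (FD f y v \<bullet> b) *\<^sub>R FD g (f y) b)"
      by (rule linear_basis_expansion[OF smooth_on_FD_linear[OF that(1) \<open>f y \<in> T\<close>]])
    finally show ?thesis .
  qed
  note fx = agree_value[OF Suc.prems(3)]
  have "agree k x (\<lambda>y. FD (\<lambda>y. g (f y)) y v) (\<lambda>y. FD (\<lambda>y. g' (f' y)) y v)" for v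
  proof (rule agree_cong[OF S])
    show "agree k x (\<lambda>y. \<Sum>b\<in>Basis. (FD f y v \<bullet> b) *\<^sub>R FD g (f y) b)
                    (\<lambda>y. \<Sum>b\<in>Basis. (FD f' y v \<bullet> b) *\<^sub>R FD g' (f' y) b)"
    proof (rule agree_sum[OF S])
      fix b :: 'b assume "b \<in> Basis"
      have 1: "smooth_on S (\<lambda>y. FD f y v \<bullet> b)" "smooth_on S (\<lambda>y. FD f' y v \<bullet> b)"
        by (rule smooth_on_inner[OF smooth_on_FD smooth_on_const]; rule f S)+
      have 2: "smooth_on S (\<lambda>y. FD g (f y) b)" "smooth_on S (\<lambda>y. FD g' (f' y) b)"
        by (rule smooth_on_compose[OF smooth_on_FD]; rule f S Suc.prems)+
      have 3: "agree k x (\<lambda>y. FD f y v \<bullet> b) (\<lambda>y. FD f' y v \<bullet> b)"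
        by (rule agree_bilinear[OF bounded_bilinear_inner S])
          (use Suc.prems f smooth_on_FD in auto)
      have 4: "agree k x (\<lambda>y. FD g (f y) b) (\<lambda>y. FD g' (f' y) b)"
        by (rule Suc.IH[of "\<lambda>z. FD g z b" "\<lambda>z. FD g' z b"])
           (use Suc.prems agree_Suc_D[OF Suc.prems(3)] in \<open>auto intro: smooth_on_FD\<close>)
      show "smooth_on S (\<lambda>y. (FD f y v \<bullet> b) *\<^sub>R FD g (f y) b)"
        "smooth_on S (\<lambda>y. (FD f' y v \<bullet> b) *\<^sub>R FD g' (f' y) b)"
        by (rule smooth_on_scaleR; rule 1 2 S)+
      show "agree k x (\<lambda>y. (FD f y v \<bullet> b) *\<^sub>R FD g (f y) b) (\<lambda>y. (FD f' y v \<bullet> b) *\<^sub>R FD g' (f' y) b)"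
        by (rule agree_bilinear[OF bounded_bilinear_scaleR S 1 2 3 4])
    qed simp
  qed (simp_all add: d[OF Suc.prems(1) f(1,3)] d[OF Suc.prems(2) f(2,4)])
  then show ?case using fx agree_value[OF Suc.prems(4)] by simp
qed simp

lemma agree_linear:
  assumes "open S" "x \<in> S" "smooth_on S f" "smooth_on S f'" "agree k x f f'" "linear h"
  shows "agree k x (\<lambda>y. h (f y)) (\<lambda>y. h (f' y))"
  by (rule agree_compose[where T = UNIV]) (use assms smooth_on_linear in auto)

lemma agree_pdiff: "agree (Suc k) x f g \<Longrightarrow> agree k x (pdiff i f) (pdiff i g)"
  by (simp add: pdiff_def[abs_def])

text \<open>In \<open>agree\<close> the innermost derivative is the first one to be peeled off; hence the induction from the
  right end of the list.\<close>

lemma agree_foldr_pdiff: "agree k x f g \<Longrightarrow> length is \<le> k \<Longrightarrow> foldr pdiff is f x = foldr pdiff is g x"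
proof (induction "is" arbitrary: f g k rule: rev_induct)
  case Nil
  then show ?case by (simp add: agree_value)
next
  case (snoc i "is")
  then obtain l where l: "k = Suc l" by (cases k) auto
  then show ?case using snoc.IH[OF agree_pdiff] snoc.prems by simp
qed

lemma agree_imp_mdiff_eq: "agree k x f g \<Longrightarrow> mdeg I \<le> k \<Longrightarrow> mdiff I f x = mdiff I g x"
  using obtain_mdiff_list[of I] agree_foldr_pdiff by metis

text \<open>Conversely, equal partial derivatives suffice, since every directional derivative is a
  combination of partial derivatives.\<close>

lemma mdiff_eq_imp_agree:
  fixes f g :: "real^'n::finite \<Rightarrow> real"
  assumes S: "open S" "x \<in> S"
    and "smooth_on S f" "smooth_on S g" "\<And>I. mdeg I \<le> k \<Longrightarrow> mdiff I f x = mdiff I g x"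
  shows "agree k x f g"
  using assms(3-)
proof (induction k arbitrary: f g)
  case 0
  from "0.prems"(3)[of "\<lambda>_. 0"] show ?case by (simp add: mdeg_def)
next
  case (Suc k)
  have p: "agree k x (pdiff i f) (pdiff i g)" for i
  proof (rule Suc.IH)
    show "mdiff I (pdiff i f) x = mdiff I (pdiff i g) x" if "mdeg I \<le> k" for I
      using Suc.prems(3)[of "madd I i"] that
      by (simp add: mdiff_madd(2)[OF Suc.prems(1) S] mdiff_madd(2)[OF Suc.prems(2) S])
  qed (use Suc.prems smooth_on_pdiff in auto)
  have d: "FD f y v = (\<Sum>i\<in>UNIV. (v $ i) *\<^sub>R pdiff i f y)" if "smooth_on S f" "y \<in> S"
    for f :: "real^'n \<Rightarrow> real" and y v
  proof -
    have "v = (\<Sum>i\<in>UNIV. v $ i *\<^sub>R axis i 1)"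
      using vec_lambda_sum_axis[of "\<lambda>i. v $ i"] by simp
    then have "FD f y v = FD f y (\<Sum>i\<in>UNIV. v $ i *\<^sub>R axis i 1)" by simp
    then show ?thesis
      using smooth_on_FD_linear[OF that] by (simp add: linear_sum linear_cmul pdiff_def)
  qed
  have "agree k x (\<lambda>y. FD f y v) (\<lambda>y. FD g y v)" for v
  proof (rule agree_cong[OF S])
    show "agree k x (\<lambda>y. \<Sum>i\<in>UNIV. (v $ i) *\<^sub>R pdiff i f y) (\<lambda>y. \<Sum>i\<in>UNIV. (v $ i) *\<^sub>R pdiff i g y)"
    proof (rule agree_sum[OF S])
      fix i :: 'n
      note sm = smooth_on_pdiff[OF Suc.prems(1)] smooth_on_pdiff[OF Suc.prems(2)]
      show "smooth_on S (\<lambda>y. (v $ i) *\<^sub>R pdiff i f y)" "smooth_on S (\<lambda>y. (v $ i) *\<^sub>R pdiff i g y)"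
        by (rule smooth_on_scaleR[OF smooth_on_const _ S(1)], rule sm)+
      show "agree k x (\<lambda>y. (v $ i) *\<^sub>R pdiff i f y) (\<lambda>y. (v $ i) *\<^sub>R pdiff i g y)"
        by (rule agree_bilinear[OF bounded_bilinear_scaleR S]) (simp_all add: sm p)
    qed simp
  qed (simp_all add: d Suc.prems)
  moreover have "f x = g x" using Suc.prems(3)[of "\<lambda>_. 0"] by (simp add: mdeg_def)
  ultimately show ?case by simp
qed

section \<open>The smooth inverse function theorem\<close>

lemma Ck_on_mult:
  fixes f g :: "'a::euclidean_space \<Rightarrow> real"
  shows "Ck_on k S f \<Longrightarrow> Ck_on k S g \<Longrightarrow> open S \<Longrightarrow> Ck_on k S (\<lambda>x. f x * g x)"
  by (rule Ck_on_bilinear[OF bounded_bilinear_mult])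

lemma Ck_on_prod:
  fixes f :: "'i \<Rightarrow> 'a::euclidean_space \<Rightarrow> real"
  shows "(\<And>i. i \<in> I \<Longrightarrow> Ck_on k S (f i)) \<Longrightarrow> open S \<Longrightarrow> Ck_on k S (\<lambda>x. \<Prod>i\<in>I. f i x)"
  by (induction I rule: infinite_finite_induct) (auto intro: Ck_on_mult)

lemma Ck_on_det:
  fixes A :: "'a::euclidean_space \<Rightarrow> real^'k^'k"
  assumes "\<And>i j. Ck_on l S (\<lambda>x. A x $ i $ j)" "open S"
  shows "Ck_on l S (\<lambda>x. det (A x))"
  unfolding det_def
  by (rule Ck_on_sum, rule Ck_on_mult, rule Ck_on_const, rule Ck_on_prod, rule assms) (rule assms(2))+

text \<open>By Cramer's rule, the solution of a linear system depends on the system as smoothly as the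
  system itself does on its parameters.\<close>

lemma Ck_on_solve:
  fixes A :: "'a::euclidean_space \<Rightarrow> real^'k^'k"
  assumes "\<And>i j. Ck_on l S (\<lambda>x. A x $ i $ j)" "open S"
    and "\<And>x. x \<in> S \<Longrightarrow> det (A x) \<noteq> 0" "\<And>x. x \<in> S \<Longrightarrow> A x *v h x = b"
  shows "Ck_on l S h"
proof -
  let ?B = "\<lambda>k x. \<chi> i j. if j = k then b $ i else A x $ i $ j"
  have B: "Ck_on l S (\<lambda>x. det (?B k x))" for k
  proof (rule Ck_on_det[OF _ assms(2)])
    show "Ck_on l S (\<lambda>x. ?B k x $ i $ j)" for i j
      using assms(1)[of i j] by (cases "j = k") simp_all
  qed
  have I: "Ck_on l S (\<lambda>x. inverse (det (A x)))"
    by (rule Ck_on_inverse[OF Ck_on_det[OF assms(1,2)] assms(2,3)])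
  have "Ck_on l S (\<lambda>x. \<Sum>k\<in>UNIV. (det (?B k x) * inverse (det (A x))) *\<^sub>R axis k 1)"
    by (rule Ck_on_sum[OF Ck_on_bilinear[OF bounded_bilinear_scaleR Ck_on_mult[OF B I assms(2)] Ck_on_const assms(2)] assms(2)])
  then show ?thesis
  proof (rule Ck_on_cong[OF assms(2), rotated])
    fix x assume x: "x \<in> S"
    have "h x = (\<chi> k. det (?B k x) / det (A x))"
      using cramer[OF assms(3)[OF x], of "h x" b] assms(4)[OF x] by simp
    then show "(\<Sum>k\<in>UNIV. (det (?B k x) * inverse (det (A x))) *\<^sub>R axis k 1) = h x"
      by (simp add: vec_lambda_sum_axis divide_inverse)
  qed
qed

text \<open>Differentiating \<open>\<Phi> (g y) = y\<close> gives a linear system for the derivative of \<open>g\<close> whose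
  coefficients are as smooth as \<open>g\<close>; so every step gains one derivative. The maps \<open>T\<close> and \<open>T'\<close>
  only serve to pass to matrices.\<close>

lemma smooth_on_inverse_map:
  fixes \<Phi> g :: "'a::euclidean_space \<Rightarrow> 'a" and T :: "'a \<Rightarrow> real^'k"
  assumes T: "linear T" "linear T'" "\<And>x. T' (T x) = x" "\<And>y. T (T' y) = y"
    and sm: "smooth_on U \<Phi>" and "open U" "open V"
    and g: "\<And>y. y \<in> V \<Longrightarrow> g y \<in> U" "\<And>y. y \<in> V \<Longrightarrow> \<Phi> (g y) = y"
      "\<And>y. y \<in> V \<Longrightarrow> g differentiable (at y)"
    and inj: "\<And>y. y \<in> V \<Longrightarrow> inj (FD \<Phi> (g y))"
  shows "smooth_on V g"
  unfolding smooth_on_def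
proof
  fix k show "Ck_on k V g"
  proof (induction k)
    case 0
    have "continuous (at y) g" if "y \<in> V" for y
      using g(3)[OF that] differentiable_imp_continuous_within by auto
    then show ?case by (simp add: continuous_at_imp_continuous_on Ck_on.simps)
  next
    case (Suc k)
    have "Ck_on k V (\<lambda>y. FD g y v)" for v
    proof -
      let ?F = "\<lambda>y w. T (FD \<Phi> (g y) (T' w))"
      define A where "A y = matrix (?F y)" for y
      have lin: "linear (FD \<Phi> (g y))" if "y \<in> V" for y
        using smooth_on_FD_linear[OF sm g(1)[OF that]] .
      then have linF: "linear (?F y)" if "y \<in> V" for y
        using linear_compose[OF linear_compose[OF T(2) lin[OF that]] T(1)] by (simp add: o_def)
      have Av: "A y *v w = ?F y w" if "y \<in> V" for y w
        unfolding A_def using linF[OF that] by (intro matrix_works) (simp add: linear_matrix_vector_mul_eq)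
      have "Ck_on k V (\<lambda>y. A y $ i $ j)" for i j
      proof -
        have l: "linear (\<lambda>z. T z $ i)"
          using T(1) by (simp add: linear_iff)
        have "Ck_on k V (\<lambda>y. FD \<Phi> (g y) (T' (axis j 1)))"
          by (rule Ck_on_compose[OF Suc smooth_onD[OF smooth_on_FD[OF sm]] _ \<open>open V\<close>]) (use g in auto)
        then have "Ck_on k V (\<lambda>y. T (FD \<Phi> (g y) (T' (axis j 1))) $ i)"
          by (rule Ck_on_compose[OF _ Ck_on_linear[OF l, of _ UNIV] _ \<open>open V\<close>]) auto
        then show ?thesis by (simp add: A_def matrix_def)
      qed
      moreover have "det (A y) \<noteq> 0" if "y \<in> V" for y
      proof -
        have "inj (?F y)"
        proof (rule injI)
          fix w w' assume "?F y w = ?F y w'"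
          then have "FD \<Phi> (g y) (T' w) = FD \<Phi> (g y) (T' w')" using T(3) by metis
          then have "T' w = T' w'" using inj[OF that] by (simp add: inj_eq)
          then show "w = w'" using T(4) by metis
        qed
        then have "inj ((*v) (A y))" using Av[OF that] by (simp add: inj_def)
        then show ?thesis
          using det_nz_iff_inj[of "(*v) (A y)"] matrix_vector_mul_linear[of "A y"] by simp
      qed
      moreover have "A y *v T (FD g y v) = T v" if "y \<in> V" for y
      proof -
        have "FD (\<lambda>y. \<Phi> (g y)) y v = FD \<Phi> (g y) (FD g y v)"
          by (rule FD_compose[OF smooth_on_differentiable[OF sm g(1)[OF that]] g(3)[OF that]])
        moreover have "FD (\<lambda>y. \<Phi> (g y)) y v = v"
          using FD_cong_open[OF \<open>open V\<close> that, of "\<lambda>y. \<Phi> (g y)" "\<lambda>y. y"] g(2) by simp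
        ultimately show ?thesis using Av[OF that] T(3) by simp
      qed
      ultimately have "Ck_on k V (\<lambda>y. T (FD g y v))"
        by (rule Ck_on_solve[OF _ \<open>open V\<close>])
      then have "Ck_on k V (\<lambda>y. T' (T (FD g y v)))"
        by (rule Ck_on_compose[OF _ Ck_on_linear[OF T(2), of _ UNIV] _ \<open>open V\<close>]) auto
      then show ?thesis by (simp add: T(3))
    qed
    then show ?case using g(3) by (simp add: Ck_on.simps)
  qed
qed

lemma smooth_inverse_function_theorem:
  fixes \<Phi> :: "(real^'n::finite) \<times> (real^'m::finite) \<Rightarrow> (real^'n) \<times> (real^'m)"
  assumes sm: "smooth_on U \<Phi>" and U: "open U" "x0 \<in> U" and inj: "inj (FD \<Phi> x0)"
  obtains U' V g where "open U'" "U' \<subseteq> U" "x0 \<in> U'" "open V" "\<Phi> ` U' = V" "g ` V = U'"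
    "\<forall>x\<in>U'. g (\<Phi> x) = x" "\<forall>y\<in>V. \<Phi> (g y) = y" "smooth_on V g"
proof -
  let ?f' = "\<lambda>x. Blinfun (FD \<Phi> x)"
  have ap: "blinfun_apply (?f' x) = FD \<Phi> x" if "x \<in> U" for x
    using bounded_linear_Blinfun_apply[of "FD \<Phi> x"] smooth_on_FD_linear[OF sm that]
    by (simp add: linear_conv_bounded_linear)
  have cont: "continuous_on U ?f'"
  proof (rule continuous_on_blinfun_componentwise)
    fix b :: "(real^'n) \<times> (real^'m)" assume "b \<in> Basis"
    have "continuous_on U (\<lambda>x. FD \<Phi> x b)"
      by (rule smooth_on_continuous[OF smooth_on_FD[OF sm]])
    then show "continuous_on U (\<lambda>x. blinfun_apply (?f' x) b)"
      by (rule continuous_on_eq) (simp add: ap)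
  qed
  have lin0: "linear (FD \<Phi> x0)" by (rule smooth_on_FD_linear[OF sm U(2)])
  obtain h where h: "linear h" "h \<circ> FD \<Phi> x0 = id"
    using linear_injective_left_inverse[OF lin0 inj] by auto
  have hb: "blinfun_apply (Blinfun h) = h"
    using bounded_linear_Blinfun_apply h(1) linear_conv_bounded_linear by blast
  have inv: "Blinfun h o\<^sub>L ?f' x0 = id_blinfun"
  proof (rule blinfun_eqI)
    fix v
    have "h (FD \<Phi> x0 v) = v" using fun_cong[OF h(2), of v] by simp
    then show "blinfun_apply (Blinfun h o\<^sub>L ?f' x0) v = blinfun_apply id_blinfun v"
      by (simp add: hb ap[OF U(2)])
  qed
  have der: "(\<Phi> has_derivative blinfun_apply (?f' x)) (at x)" if "x \<in> U" for x
    using smooth_on_has_derivative[OF sm that] ap[OF that] by simp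
  obtain U' V g g' where *: "open U'" "U' \<subseteq> U" "x0 \<in> U'" "open V" "\<Phi> x0 \<in> V" "homeomorphism U' V \<Phi> g"
    and g': "\<And>y. y \<in> V \<Longrightarrow> (g has_derivative g' y) (at y)"
    and bij: "\<And>y. y \<in> V \<Longrightarrow> bij (blinfun_apply (?f' (g y)))"
    using inverse_function_theorem[OF U(1) der cont U(2) inv] by metis
  have hom: "\<Phi> ` U' = V" "g ` V = U'" "\<And>x. x \<in> U' \<Longrightarrow> g (\<Phi> x) = x" "\<And>y. y \<in> V \<Longrightarrow> \<Phi> (g y) = y"
    using *(6) by (auto simp: homeomorphism_def)
  define T where "T z = (\<chi> s. case s of Inl i \<Rightarrow> fst z $ i | Inr j \<Rightarrow> snd z $ j)"
    for z :: "(real^'n) \<times> (real^'m)"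
  define T' where "T' w = ((\<chi> i. w $ Inl i), (\<chi> j. w $ Inr j))" for w :: "real^('n + 'm)"
  have "smooth_on V g"
  proof (rule smooth_on_inverse_map[of T T'])
    show "linear T" "linear T'"
      by (simp_all add: linear_iff T_def T'_def vec_eq_iff prod_eq_iff split: sum.split)
    show "T' (T x) = x" "T (T' y) = y" for x y
      by (auto simp: T_def T'_def vec_eq_iff prod_eq_iff split: sum.split)
    show "g y \<in> U" if "y \<in> V" for y using that hom(2) *(2) by auto
    show "inj (FD \<Phi> (g y))" if "y \<in> V" for y
      using bij[OF that] ap[of "g y"] that hom(2) *(2) by (auto simp: bij_def)
    show "g differentiable (at y)" if "y \<in> V" for y
      using g'[OF that] by (rule differentiableI)
  qed (use sm U * hom in auto)
  with *(1-4) hom show ?thesis by (intro that[of U' V g]) auto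
qed

section \<open>Charts\<close>

definition ctrans :: "('a, 'b) chart \<Rightarrow> ('a, 'c) chart \<Rightarrow> 'b \<Rightarrow> 'c" where
  "ctrans c d y = snd d (chart_inv c y)"

lemma chart_inv_chart:
  assumes "is_chart X c" "p \<in> fst c"
  shows "chart_inv c (snd c p) = p"
  using assms by (auto simp: is_chart_def chart_inv_def)

lemma chart_inv_in:
  assumes "y \<in> snd c ` fst c"
  shows "chart_inv c y \<in> fst c"
  unfolding chart_inv_def by (rule inv_into_into[OF assms])

lemma chart_chart_inv:
  assumes "y \<in> snd c ` fst c"
  shows "snd c (chart_inv c y) = y"
  unfolding chart_inv_def by (rule f_inv_into_f[OF assms])

lemma chart_image_Int:
  assumes "is_chart X c"
  shows "snd c ` (fst c \<inter> W) = {y \<in> snd c ` fst c. chart_inv c y \<in> W}"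
  using chart_inv_chart[OF assms] chart_chart_inv[of _ c] by (auto simp: image_iff)

lemma open_preimage:
  assumes "continuous_on S f" "open S" "open T"
  shows "open {y \<in> S. f y \<in> T}"
  using continuous_open_preimage[OF assms] by (simp add: vimage_def Collect_conj_eq)

text \<open>A manifold apart from the Hausdorff property and second countability: what remains is all that calculus in charts needs.\<close>

locale smooth_atlas =
  fixes M :: "('a, 'b::euclidean_space) mfd"
  assumes atlas_cover: "(\<Union>c\<in>atlas M. fst c) = points M"
    and atlas_is_chart: "c \<in> atlas M \<Longrightarrow> is_chart (points M) c"
    and atlas_transition: "c \<in> atlas M \<Longrightarrow> d \<in> atlas M \<Longrightarrow> smooth_transition c d"
begin

lemma atlas_charts: "c \<in> atlas M \<Longrightarrow> c \<in> charts M"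
  by (simp add: charts_def atlas_is_chart atlas_transition)

lemma charts_is_chart: "c \<in> charts M \<Longrightarrow> is_chart (points M) c"
  by (simp add: charts_def)

lemma charts_subset: "c \<in> charts M \<Longrightarrow> p \<in> fst c \<Longrightarrow> p \<in> points M"
  using charts_is_chart[of c] by (auto simp: is_chart_def)

lemma open_chart_image: "c \<in> charts M \<Longrightarrow> open (snd c ` fst c)"
  using charts_is_chart[of c] by (auto simp: is_chart_def)

lemmas cinv = chart_inv_chart[OF charts_is_chart]
lemmas image_Int = chart_image_Int[OF charts_is_chart]

lemma ctrans_chart: "c \<in> charts M \<Longrightarrow> p \<in> fst c \<Longrightarrow> ctrans c d (snd c p) = snd d p"
  by (simp add: ctrans_def cinv)

lemma obtain_atlas_chart:
  assumes "p \<in> points M" obtains a where "a \<in> atlas M" "p \<in> fst a"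
  using assms atlas_cover by blast

lemma chart_at:
  assumes "p \<in> points M"
  shows "chart_at M p \<in> atlas M" "p \<in> fst (chart_at M p)"
proof -
  have "\<exists>c. c \<in> atlas M \<and> p \<in> fst c" using assms atlas_cover by blast
  from someI_ex[OF this] show "chart_at M p \<in> atlas M" "p \<in> fst (chart_at M p)"
    by (simp_all add: chart_at_def)
qed

text \<open>Two charts need not be related by a chart of the atlas globally, but around every point of
  the overlap their transition factors through one.\<close>

lemma charts_transition:
  assumes c: "c \<in> charts M" and d: "d \<in> charts M"
  shows "open (snd c ` (fst c \<inter> fst d))" "smooth_on (snd c ` (fst c \<inter> fst d)) (ctrans c d)"
proof -
  have *: "\<exists>T. open T \<and> y \<in> T \<and> T \<subseteq> snd c ` (fst c \<inter> fst d) \<and> smooth_on T (ctrans c d)"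
    if y: "y \<in> snd c ` (fst c \<inter> fst d)" for y
  proof -
    obtain p where p: "p \<in> fst c" "p \<in> fst d" "y = snd c p" using y by auto
    obtain a where a: "a \<in> atlas M" "p \<in> fst a"
      using obtain_atlas_chart[OF charts_subset[OF c p(1)]] .
    have ca: "open (snd c ` (fst c \<inter> fst a))" "smooth_on (snd c ` (fst c \<inter> fst a)) (ctrans c a)"
      and ad: "open (snd a ` (fst a \<inter> fst d))" "smooth_on (snd a ` (fst a \<inter> fst d)) (ctrans a d)"
      using c d a by (auto simp: charts_def smooth_transition_def ctrans_def[abs_def] o_def)
    define T where "T = {y \<in> snd c ` (fst c \<inter> fst a). ctrans c a y \<in> snd a ` (fst a \<inter> fst d)}"
    have oT: "open T"
      unfolding T_def by (rule open_preimage[OF smooth_on_continuous[OF ca(2)] ca(1) ad(1)])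
    have T: "\<exists>q. q \<in> fst c \<and> q \<in> fst a \<and> q \<in> fst d \<and> z = snd c q" if "z \<in> T" for z
    proof -
      have "z \<in> snd c ` (fst c \<inter> fst a)" "ctrans c a z \<in> snd a ` (fst a \<inter> fst d)"
        using that by (simp_all add: T_def)
      then obtain q r where q: "z = snd c q" "q \<in> fst c" "q \<in> fst a" "ctrans c a z = snd a r" "r \<in> fst a" "r \<in> fst d"
        by blast
      then have "snd a q = snd a r" by (simp add: ctrans_chart[OF c])
      then have "q = r" using cinv[OF atlas_charts[OF a(1)]] q(3,5) by metis
      then show ?thesis using q by auto
    qed
    have "smooth_on T (\<lambda>z. ctrans a d (ctrans c a z))"
      by (rule smooth_on_compose[OF ad(2) smooth_on_subset[OF ca(2)] oT]) (auto simp: T_def)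
    moreover have "ctrans a d (ctrans c a z) = ctrans c d z" if "z \<in> T" for z
      using T[OF that] by (auto simp: ctrans_chart[OF c] ctrans_chart[OF atlas_charts[OF a(1)]])
    ultimately have "smooth_on T (ctrans c d)"
      using smooth_on_cong[OF _ oT] by blast
    moreover have "T \<subseteq> snd c ` (fst c \<inter> fst d)" using T by blast
    moreover have "y \<in> T"
      using p a by (auto simp: T_def ctrans_chart[OF c])
    ultimately show ?thesis using oT by blast
  qed
  show "open (snd c ` (fst c \<inter> fst d))"
    by (subst open_subopen) (use * in blast)
  show "smooth_on (snd c ` (fst c \<inter> fst d)) (ctrans c d)"
    by (rule smooth_on_locally) (use * in blast)
qed

lemma ctrans_differentiable:
  assumes "c \<in> charts M" "d \<in> charts M" "p \<in> fst c" "p \<in> fst d"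
  shows "ctrans c d differentiable (at (snd c p))"
  by (rule smooth_on_differentiable[OF charts_transition(2)[OF assms(1,2)]]) (use assms in auto)

lemma FD_ctrans_ctrans:
  assumes c: "c \<in> charts M" and d: "d \<in> charts M" and e: "e \<in> charts M"
    and p: "p \<in> fst c" "p \<in> fst d" "p \<in> fst e"
  shows "FD (ctrans d e) (snd d p) (FD (ctrans c d) (snd c p) v) = FD (ctrans c e) (snd c p) v"
proof -
  have "FD (ctrans d e) (ctrans c d (snd c p)) (FD (ctrans c d) (snd c p) v)
      = FD (\<lambda>y. ctrans d e (ctrans c d y)) (snd c p) v"
    by (rule FD_compose[symmetric])
      (use ctrans_differentiable[OF d e p(2,3)] ctrans_differentiable[OF c d p(1,2)]
       in \<open>simp_all add: ctrans_chart[OF c p(1)]\<close>)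
  also have "FD (\<lambda>y. ctrans d e (ctrans c d y)) (snd c p) = FD (ctrans c e) (snd c p)"
    by (rule FD_cong_open[OF charts_transition(1)[OF c d]])
      (use p in \<open>auto simp: ctrans_chart[OF c] ctrans_chart[OF d]\<close>)
  finally show ?thesis by (simp add: ctrans_chart[OF c p(1)])
qed

lemma FD_ctrans_self:
  assumes c: "c \<in> charts M" "p \<in> fst c"
  shows "FD (ctrans c c) (snd c p) v = v"
proof -
  have "FD (ctrans c c) (snd c p) = FD (\<lambda>y. y) (snd c p)"
    by (rule FD_cong_open[OF open_chart_image[OF c(1)]]) (use c in \<open>auto simp: ctrans_chart[OF c(1)]\<close>)
  then show ?thesis by simp
qed

subsection \<open>The manifold topology\<close>

lemma openin_mtop: "openin (mtop M) W \<longleftrightarrow> W \<subseteq> points M \<and> (\<forall>c\<in>atlas M. open (snd c ` (fst c \<inter> W)))"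
proof -
  let ?P = "\<lambda>W. W \<subseteq> points M \<and> (\<forall>c\<in>atlas M. open (snd c ` (fst c \<inter> W)))"
  have "istopology ?P"
    unfolding istopology_def
  proof (intro conjI allI impI)
    fix S T assume S: "?P S" and T: "?P T"
    have "snd c ` (fst c \<inter> (S \<inter> T)) = snd c ` (fst c \<inter> S) \<inter> snd c ` (fst c \<inter> T)" if "c \<in> atlas M" for c
      by (auto simp: image_Int[OF atlas_charts[OF that]])
    then show "S \<inter> T \<subseteq> points M" "\<forall>c\<in>atlas M. open (snd c ` (fst c \<inter> (S \<inter> T)))"
      using S T by auto
  next
    fix K assume K: "\<forall>S\<in>K. ?P S"
    have *: "snd c ` (fst c \<inter> \<Union>K) = (\<Union>S\<in>K. snd c ` (fst c \<inter> S))" for c :: "('a, 'b) chart" by auto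
    show "\<forall>c\<in>atlas M. open (snd c ` (fst c \<inter> \<Union>K))"
    proof
      fix c assume "c \<in> atlas M"
      then have "open (snd c ` (fst c \<inter> S))" if "S \<in> K" for S using K that by blast
      then show "open (snd c ` (fst c \<inter> \<Union>K))" unfolding * by blast
    qed
    show "\<Union>K \<subseteq> points M" using K by auto
  qed
  then have "openin (topology ?P) = ?P" by (rule topology_inverse')
  then show ?thesis by (simp add: mtop_def)
qed

lemma openin_chartI:
  assumes c: "c \<in> charts M" and "open O'" and "W = {p \<in> fst c. snd c p \<in> O'}"
  shows "openin (mtop M) W"
  unfolding openin_mtop
proof (intro conjI ballI)
  show "W \<subseteq> points M" using charts_subset[OF c] assms(3) by auto
  fix a assume "a \<in> atlas M"
  then have a: "a \<in> charts M" by (rule atlas_charts)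
  have "snd a ` (fst a \<inter> W) = {y \<in> snd a ` (fst a \<inter> fst c). ctrans a c y \<in> O'}"
    by (auto simp: assms(3) ctrans_chart[OF a])
  then show "open (snd a ` (fst a \<inter> W))"
    using open_preimage[OF smooth_on_continuous[OF charts_transition(2)[OF a c]] charts_transition(1)[OF a c] assms(2)]
    by simp
qed

lemma openin_chart: "c \<in> charts M \<Longrightarrow> openin (mtop M) (fst c)"
  by (rule openin_chartI[of c UNIV]) auto

lemma openin_chart_image:
  assumes W: "openin (mtop M) W" and c: "c \<in> charts M"
  shows "open (snd c ` (fst c \<inter> W))"
proof (subst open_subopen, intro ballI)
  fix y assume "y \<in> snd c ` (fst c \<inter> W)"
  then obtain p where p: "p \<in> fst c" "p \<in> W" "y = snd c p" by auto
  obtain a where a: "a \<in> atlas M" "p \<in> fst a"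
    using obtain_atlas_chart[OF charts_subset[OF c p(1)]] .
  note a' = atlas_charts[OF a(1)]
  let ?T = "{y \<in> snd c ` (fst c \<inter> fst a). ctrans c a y \<in> snd a ` (fst a \<inter> W)}"
  have "open ?T"
    by (rule open_preimage[OF smooth_on_continuous[OF charts_transition(2)[OF c a']] charts_transition(1)[OF c a']])
      (use W a(1) in \<open>simp add: openin_mtop\<close>)
  moreover have "y \<in> ?T" using p a by (auto simp: ctrans_chart[OF c])
  moreover have "?T \<subseteq> snd c ` (fst c \<inter> W)"
  proof
    fix z assume "z \<in> ?T"
    then have "z \<in> snd c ` (fst c \<inter> fst a)" "ctrans c a z \<in> snd a ` (fst a \<inter> W)" by simp_all
    then obtain q r where q: "z = snd c q" "q \<in> fst c" "q \<in> fst a" "ctrans c a z = snd a r" "r \<in> fst a" "r \<in> W"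
      by blast
    then have "snd a q = snd a r" by (simp add: ctrans_chart[OF c])
    then have "q = r" using cinv[OF a'] q(3,5) by metis
    then show "z \<in> snd c ` (fst c \<inter> W)" using q by auto
  qed
  ultimately show "\<exists>T. open T \<and> y \<in> T \<and> T \<subseteq> snd c ` (fst c \<inter> W)" by blast
qed

subsection \<open>Tangent vectors in charts\<close>

lemma tcoord_FD:
  assumes "p \<in> points M"
  shows "tcoord M c p = FD (ctrans (chart_at M p) c) (snd (chart_at M p) p)"
  by (simp add: tcoord_def ctrans_def[abs_def] o_def)

lemma tvec_FD: "tvec M c p = FD (ctrans c (chart_at M p)) (snd c p)"
  by (simp add: tvec_def ctrans_def[abs_def] o_def)

context
  fixes c p assumes c: "c \<in> charts M" and p: "p \<in> fst c"
begin

lemma p_points: "p \<in> points M" by (rule charts_subset[OF c p])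

lemma linear_tcoord: "linear (tcoord M c p)"
  unfolding tcoord_FD[OF p_points]
  by (intro FD_linear ctrans_differentiable atlas_charts chart_at p_points c p)

lemma linear_tvec: "linear (tvec M c p)"
  unfolding tvec_FD
  by (intro FD_linear ctrans_differentiable atlas_charts chart_at p_points c p)

lemma tvec_tcoord: "tvec M c p (tcoord M c p v) = v"
  unfolding tvec_FD tcoord_FD[OF p_points]
  using FD_ctrans_ctrans[OF atlas_charts[OF chart_at(1)[OF p_points]] c atlas_charts[OF chart_at(1)[OF p_points]]
      chart_at(2)[OF p_points] p chart_at(2)[OF p_points]]
    FD_ctrans_self[OF atlas_charts[OF chart_at(1)[OF p_points]] chart_at(2)[OF p_points]] by simp

lemma tcoord_tvec_trans:
  assumes "d \<in> charts M" "p \<in> fst d"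
  shows "tcoord M d p (tvec M c p v) = FD (ctrans c d) (snd c p) v"
  unfolding tvec_FD tcoord_FD[OF p_points]
  by (rule FD_ctrans_ctrans[OF c atlas_charts[OF chart_at(1)[OF p_points]] assms(1) p
        chart_at(2)[OF p_points] assms(2)])

lemma tcoord_tvec: "tcoord M c p (tvec M c p v) = v"
  using tcoord_tvec_trans[OF c p] FD_ctrans_self[OF c p] by simp

lemma tcoord_trans:
  assumes "d \<in> charts M" "p \<in> fst d"
  shows "tcoord M d p v = FD (ctrans c d) (snd c p) (tcoord M c p v)"
  using tcoord_tvec_trans[OF assms, of "tcoord M c p v"] tvec_tcoord by simp

lemma tvec_trans:
  assumes "d \<in> charts M" "p \<in> fst d"
  shows "tvec M c p v = tvec M d p (FD (ctrans c d) (snd c p) v)"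
  unfolding tvec_FD
  using FD_ctrans_ctrans[OF c assms(1) atlas_charts[OF chart_at(1)[OF p_points]] p assms(2)
      chart_at(2)[OF p_points]] by simp

end

lemma smooth_vector_field_chart:
  assumes c: "c \<in> charts M" and U: "openin (mtop M) U" "U \<subseteq> fst c"
    and w: "smooth_on (snd c ` U) w"
    and X: "\<And>p. p \<in> U \<Longrightarrow> X p = tvec M c p (w (snd c p))"
  shows "smooth_vector_field M U X"
  unfolding smooth_vector_field_def
proof
  fix a assume "a \<in> atlas M"
  then have a: "a \<in> charts M" by (rule atlas_charts)
  note oa = openin_chart_image[OF U(1) a]
  have sub: "snd a ` (fst a \<inter> U) \<subseteq> snd a ` (fst a \<inter> fst c)" using U(2) by auto
  note sm = smooth_on_subset[OF charts_transition(2)[OF a c] sub]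
  have im: "ctrans a c ` (snd a ` (fst a \<inter> U)) \<subseteq> snd c ` (fst c \<inter> fst a)"
    "ctrans a c ` (snd a ` (fst a \<inter> U)) \<subseteq> snd c ` U"
    using U(2) by (auto simp: ctrans_chart[OF a])
  have "smooth_on (snd a ` (fst a \<inter> U)) (\<lambda>y. FD (ctrans c a) (ctrans a c y) (w (ctrans a c y)))"
    by (rule smooth_on_FD_apply[OF charts_transition(2)[OF c a] sm smooth_on_compose[OF w sm oa im(2)] oa im(1)])
  then show "smooth_on (snd a ` (fst a \<inter> U)) (\<lambda>y. tcoord M a (chart_inv a y) (X (chart_inv a y)))"
  proof (rule smooth_on_cong[OF _ oa])
    fix y assume "y \<in> snd a ` (fst a \<inter> U)"
    then obtain p where p: "p \<in> fst a" "p \<in> U" "y = snd a p" by auto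
    then have "p \<in> fst c" using U(2) by auto
    then show "FD (ctrans c a) (ctrans a c y) (w (ctrans a c y)) = tcoord M a (chart_inv a y) (X (chart_inv a y))"
      using tcoord_tvec_trans[OF c _ a p(1)]
      by (simp add: p(3) ctrans_chart[OF a p(1)] cinv[OF a p(1)] X[OF p(2)])
  qed
qed

subsection \<open>One-forms in charts\<close>

text \<open>From here on a form on \<open>U\<close> is given by its expression \<open>\<omega>\<close> in a single chart \<open>c\<close>. Smoothness and the
  exterior derivative are defined by other charts; both are reduced to \<open>\<omega>\<close>.\<close>

context
  fixes c U and \<eta> :: "'a \<Rightarrow> 'b \<Rightarrow> 'v::euclidean_space" and \<omega> :: "'b \<Rightarrow> 'b \<Rightarrow> 'v"
  assumes c: "c \<in> charts M" and U: "openin (mtop M) U" "U \<subseteq> fst c"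
    and lin: "\<And>y. y \<in> snd c ` U \<Longrightarrow> linear (\<omega> y)"
    and sm: "\<And>u. smooth_on (snd c ` U) (\<lambda>y. \<omega> y u)"
    and eta: "\<And>p v. p \<in> U \<Longrightarrow> \<eta> p v = \<omega> (snd c p) (tcoord M c p v)"
begin

lemma open_cU: "open (snd c ` U)"
  using openin_chart_image[OF U(1) c] U(2) by (simp add: Int_absorb1)

lemma form_in_trans:
  assumes a: "a \<in> charts M" and y: "y \<in> snd a ` (fst a \<inter> U)"
  shows "form_in M a \<eta> y u = \<omega> (ctrans a c y) (FD (ctrans a c) y u)"
proof -
  obtain p where p: "p \<in> fst a" "p \<in> U" "y = snd a p" using y by auto
  then show ?thesis
    using U(2) tcoord_tvec_trans[OF a p(1) c] eta[OF p(2)]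
    by (auto simp: form_in_def ctrans_chart[OF a p(1)] cinv[OF a p(1)])
qed

lemma smooth_form_apply:
  assumes "open S" "smooth_on S f" "smooth_on S h" "f ` S \<subseteq> snd c ` U"
  shows "smooth_on S (\<lambda>y. \<omega> (f y) (h y))"
proof (rule smooth_on_cong[OF _ assms(1)])
  show "smooth_on S (\<lambda>y. \<Sum>b\<in>Basis. (h y \<bullet> b) *\<^sub>R \<omega> (f y) b)"
    by (rule smooth_on_sum, rule smooth_on_scaleR, rule smooth_on_inner,
        rule assms, rule smooth_on_const, rule assms, rule smooth_on_compose[OF sm]) (rule assms)+
  show "(\<Sum>b\<in>Basis. (h y \<bullet> b) *\<^sub>R \<omega> (f y) b) = \<omega> (f y) (h y)" if "y \<in> S" for y
    by (rule linear_basis_expansion[OF lin, symmetric]) (use that assms in auto)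
qed

lemma smooth_one_form_chart: "smooth_one_form M U \<eta>"
  unfolding smooth_one_form_def
proof (intro conjI ballI allI)
  fix p assume p: "p \<in> U"
  then have pc: "p \<in> fst c" using U by auto
  have "linear (\<lambda>v. \<omega> (snd c p) (tcoord M c p v))"
    using linear_compose[OF linear_tcoord[OF c pc] lin[of "snd c p"]] p by (simp add: o_def)
  moreover have "\<eta> p = (\<lambda>v. \<omega> (snd c p) (tcoord M c p v))" using eta[OF p] by auto
  ultimately show "linear (\<eta> p)" by simp
next
  fix a u assume "a \<in> atlas M"
  then have a: "a \<in> charts M" by (rule atlas_charts)
  note oa = openin_chart_image[OF U(1) a]
  have sub: "snd a ` (fst a \<inter> U) \<subseteq> snd a ` (fst a \<inter> fst c)" using U(2) by auto
  note smt = smooth_on_subset[OF charts_transition(2)[OF a c] sub]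
  have im: "ctrans a c ` (snd a ` (fst a \<inter> U)) \<subseteq> snd c ` U"
    using U(2) by (auto simp: ctrans_chart[OF a])
  have "smooth_on (snd a ` (fst a \<inter> U)) (\<lambda>y. \<omega> (ctrans a c y) (FD (ctrans a c) y u))"
    by (rule smooth_form_apply[OF oa smt smooth_on_FD[OF smt] im])
  then show "smooth_on (snd a ` (fst a \<inter> U)) (\<lambda>y. form_in M a \<eta> y u)"
    by (rule smooth_on_cong[OF _ oa]) (simp add: form_in_trans[OF a])
qed

lemma FD_form_apply:
  assumes "open S" "smooth_on S f" "smooth_on S h" "f ` S \<subseteq> snd c ` U" "y \<in> S"
  shows "FD (\<lambda>y. \<omega> (f y) (h y)) y v = FD (\<lambda>z. \<omega> z (h y)) (f y) (FD f y v) + \<omega> (f y) (FD h y v)"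
proof -
  have fy: "f y \<in> snd c ` U" using assms by auto
  have exp: "\<omega> z u = (\<Sum>b\<in>Basis. (u \<bullet> b) *\<^sub>R \<omega> z b)" if "z \<in> snd c ` U" for z u
    by (rule linear_basis_expansion[OF lin[OF that]])
  have d1: "((\<lambda>z. \<Sum>b\<in>Basis. (u \<bullet> b) *\<^sub>R \<omega> z b) has_derivative
      (\<lambda>w. \<Sum>b\<in>Basis. (u \<bullet> b) *\<^sub>R FD (\<lambda>z. \<omega> z b) (f y) w)) (at (f y))" for u
    by (rule has_derivative_sum, rule has_derivative_scaleR_right,
        rule smooth_on_has_derivative[OF sm fy])
  have e1: "FD (\<lambda>z. \<omega> z u) (f y) w = (\<Sum>b\<in>Basis. (u \<bullet> b) *\<^sub>R FD (\<lambda>z. \<omega> z b) (f y) w)" for u w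
  proof -
    have "FD (\<lambda>z. \<omega> z u) (f y) = FD (\<lambda>z. \<Sum>b\<in>Basis. (u \<bullet> b) *\<^sub>R \<omega> z b) (f y)"
      by (rule FD_cong_open[OF open_cU fy exp])
    then show ?thesis using FD_eq[OF d1] by simp
  qed
  have dh: "((\<lambda>y. h y \<bullet> b) has_derivative (\<lambda>v. FD h y v \<bullet> b)) (at y)" for b
    by (rule has_derivative_inner_left[OF smooth_on_has_derivative[OF assms(3,5)]])
  have dw: "((\<lambda>y. \<omega> (f y) b) has_derivative (\<lambda>v. FD (\<lambda>z. \<omega> z b) (f y) (FD f y v))) (at y)" for b
    by (rule has_derivative_compose[OF smooth_on_has_derivative[OF assms(2,5)] smooth_on_has_derivative[OF sm fy]])
  have D: "((\<lambda>y. \<Sum>b\<in>Basis. (h y \<bullet> b) *\<^sub>R \<omega> (f y) b) has_derivative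
     (\<lambda>v. \<Sum>b\<in>Basis. (h y \<bullet> b) *\<^sub>R FD (\<lambda>z. \<omega> z b) (f y) (FD f y v) + (FD h y v \<bullet> b) *\<^sub>R \<omega> (f y) b)) (at y)"
    by (rule has_derivative_sum, rule has_derivative_scaleR[OF dh dw])
  have "FD (\<lambda>y. \<Sum>b\<in>Basis. (h y \<bullet> b) *\<^sub>R \<omega> (f y) b) y v =
    (\<Sum>b\<in>Basis. (h y \<bullet> b) *\<^sub>R FD (\<lambda>z. \<omega> z b) (f y) (FD f y v)) + (\<Sum>b\<in>Basis. (FD h y v \<bullet> b) *\<^sub>R \<omega> (f y) b)"
    unfolding FD_eq[OF D] sum.distrib ..
  moreover have "FD (\<lambda>y. \<omega> (f y) (h y)) y = FD (\<lambda>y. \<Sum>b\<in>Basis. (h y \<bullet> b) *\<^sub>R \<omega> (f y) b) y"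
    by (rule FD_cong_open[OF assms(1,5) exp]) (use assms in auto)
  ultimately show ?thesis
    unfolding e1[of "h y" "FD f y v"] exp[OF fy, of "FD h y v"] by simp
qed

text \<open>The exterior derivative does not depend on the chart: the terms with second derivatives of the
  transition map cancel by symmetry.\<close>

lemma ext_deriv_chart:
  assumes p: "p \<in> U"
  shows "ext_deriv M \<eta> p v w =
    FD (\<lambda>y. \<omega> y (tcoord M c p w)) (snd c p) (tcoord M c p v) -
    FD (\<lambda>y. \<omega> y (tcoord M c p v)) (snd c p) (tcoord M c p w)"
proof -
  have pc: "p \<in> fst c" using p U by auto
  define a where "a = chart_at M p"
  have a: "a \<in> charts M" "p \<in> fst a"
    unfolding a_def using chart_at[OF charts_subset[OF c pc]] atlas_charts by auto
  let ?S = "snd a ` (fst a \<inter> U)" and ?t = "ctrans a c"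
  have S: "open ?S" "snd a p \<in> ?S" using openin_chart_image[OF U(1) a(1)] a p by auto
  have sub: "?S \<subseteq> snd a ` (fst a \<inter> fst c)" using U(2) by auto
  note smt = smooth_on_subset[OF charts_transition(2)[OF a(1) c] sub]
  have im: "?t ` ?S \<subseteq> snd c ` U" using U(2) by (auto simp: ctrans_chart[OF a(1)])
  have tc: "tcoord M c p v = FD ?t (snd a p) v" for v
    unfolding a_def by (rule fun_cong[OF tcoord_FD[OF charts_subset[OF c pc]]])
  have tp: "?t (snd a p) = snd c p" by (rule ctrans_chart[OF a])
  have "FD (\<lambda>y. form_in M a \<eta> y w) (snd a p) v =
      FD (\<lambda>y. \<omega> y (tcoord M c p w)) (snd c p) (tcoord M c p v)
      + \<omega> (snd c p) (FD (\<lambda>y. FD ?t y w) (snd a p) v)" for v w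
  proof -
    have "FD (\<lambda>y. form_in M a \<eta> y w) (snd a p) = FD (\<lambda>y. \<omega> (?t y) (FD ?t y w)) (snd a p)"
      by (rule FD_cong_open[OF S form_in_trans[OF a(1)]])
    then show ?thesis
      using FD_form_apply[OF S(1) smt smooth_on_FD[OF smt] im S(2), of w v] by (simp add: tp tc)
  qed
  moreover have "FD (\<lambda>y. FD ?t y w) (snd a p) v = FD (\<lambda>y. FD ?t y v) (snd a p) w"
    by (rule second_derivative_symmetric[OF smt S])
  ultimately show ?thesis unfolding ext_deriv_def Let_def a_def[symmetric] by simp
qed

end

end

subsection \<open>Maps between manifolds in charts\<close>

text \<open>Charts of the maximal atlas need not belong to the given atlas; around every point the expression in
  such charts is the one in charts of the atlas, composed with transition maps.\<close>

lemma smooth_map_charts: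
  assumes M: "smooth_atlas M" and N: "smooth_atlas N" and f: "smooth_map M U N f"
    and c: "c \<in> charts M" and d: "d \<in> charts N"
  shows "open (snd c ` (fst c \<inter> U \<inter> f -` fst d))"
    and "smooth_on (snd c ` (fst c \<inter> U \<inter> f -` fst d)) (\<lambda>y. snd d (f (chart_inv c y)))"
proof -
  interpret M: smooth_atlas M by (rule M)
  interpret N: smooth_atlas N by (rule N)
  let ?W = "snd c ` (fst c \<inter> U \<inter> f -` fst d)"
  have *: "\<exists>T. open T \<and> y \<in> T \<and> T \<subseteq> ?W \<and> smooth_on T (\<lambda>y. snd d (f (chart_inv c y)))" if "y \<in> ?W" for y
  proof -
    obtain p where p: "p \<in> fst c" "p \<in> U" "f p \<in> fst d" "y = snd c p" using \<open>y \<in> ?W\<close> by auto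
    obtain a where a: "a \<in> atlas M" "p \<in> fst a"
      using M.obtain_atlas_chart[OF M.charts_subset[OF c p(1)]] .
    obtain b where b: "b \<in> atlas N" "f p \<in> fst b"
      using N.obtain_atlas_chart[OF N.charts_subset[OF d p(3)]] .
    note a' = M.atlas_charts[OF a(1)] and b' = N.atlas_charts[OF b(1)]
    define A where "A = snd a ` (fst a \<inter> U \<inter> f -` fst b)"
    define F where "F y = snd b (f (chart_inv a y))" for y
    have A: "open A" "smooth_on A F"
      using f a(1) b(1) by (auto simp: smooth_map_def o_def A_def F_def[abs_def])
    define B where "B = {y \<in> A. F y \<in> snd b ` (fst b \<inter> fst d)}"
    have B: "open B"
      unfolding B_def by (rule open_preimage[OF smooth_on_continuous[OF A(2)] A(1) N.charts_transition(1)[OF b' d]])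
    define T where "T = {y \<in> snd c ` (fst c \<inter> fst a). ctrans c a y \<in> B}"
    have T: "open T"
      unfolding T_def by (rule open_preimage[OF smooth_on_continuous[OF M.charts_transition(2)[OF c a']]
            M.charts_transition(1)[OF c a'] B])
    have FT: "F (snd a q) = snd b (f q)" if "q \<in> fst a" for q
      by (simp add: F_def M.cinv[OF a' that])
    have Tq: "\<exists>q. q \<in> fst c \<and> q \<in> fst a \<and> q \<in> U \<and> f q \<in> fst b \<and> f q \<in> fst d \<and> z = snd c q" if zT: "z \<in> T" for z
    proof -
      obtain q where q: "q \<in> fst c" "q \<in> fst a" "z = snd c q" using zT unfolding T_def by blast
      have "snd a q \<in> B" using zT q by (simp add: T_def M.ctrans_chart[OF c])
      then have "snd a q \<in> A" "snd b (f q) \<in> snd b ` (fst b \<inter> fst d)"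
        using FT[OF q(2)] by (simp_all add: B_def)
      from this(1) obtain r where r: "snd a q = snd a r" "r \<in> fst a" "r \<in> U" "f r \<in> fst b"
        unfolding A_def by blast
      then have qr: "q = r" using M.cinv[OF a'] q(2) by metis
      obtain s where s: "snd b (f q) = snd b s" "s \<in> fst b" "s \<in> fst d"
        using \<open>snd b (f q) \<in> snd b ` (fst b \<inter> fst d)\<close> by blast
      then have "f q = s" using N.cinv[OF b'] r(4) qr by metis
      then show ?thesis using qr q r s by auto
    qed
    have "smooth_on T (\<lambda>y. ctrans b d (F (ctrans c a y)))"
    proof (rule smooth_on_compose[OF N.charts_transition(2)[OF b' d] _ T])
      have "T \<subseteq> snd c ` (fst c \<inter> fst a)" "ctrans c a ` T \<subseteq> A" by (auto simp: T_def B_def)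
      then show "smooth_on T (\<lambda>y. F (ctrans c a y))"
        by (intro smooth_on_compose[OF A(2) smooth_on_subset[OF M.charts_transition(2)[OF c a']] T])
      show "(\<lambda>y. F (ctrans c a y)) ` T \<subseteq> snd b ` (fst b \<inter> fst d)"
        by (rule image_subsetI) (simp add: T_def B_def)
    qed
    then have "smooth_on T (\<lambda>y. snd d (f (chart_inv c y)))"
    proof (rule smooth_on_cong[OF _ T])
      fix z assume "z \<in> T"
      from Tq[OF this] obtain q where q: "q \<in> fst c" "q \<in> fst a" "q \<in> U" "f q \<in> fst b" "f q \<in> fst d" "z = snd c q"
        by blast
      then show "ctrans b d (F (ctrans c a z)) = snd d (f (chart_inv c z))"
        by (simp add: M.ctrans_chart[OF c] FT M.cinv[OF c] N.ctrans_chart[OF b'])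
    qed
    moreover have "y \<in> T"
      using p a b by (auto simp: T_def A_def B_def M.ctrans_chart[OF c] FT)
    moreover have "T \<subseteq> ?W" using Tq by blast
    ultimately show ?thesis using T by blast
  qed
  show "open ?W" by (subst open_subopen) (use * in blast)
  show "smooth_on ?W (\<lambda>y. snd d (f (chart_inv c y)))"
    by (rule smooth_on_locally) (use * in blast)
qed

lemma smooth_mapI_charts:
  assumes M: "smooth_atlas M" and N: "smooth_atlas N" and c: "c \<in> charts M" and d: "d \<in> charts N"
    and W: "open W" "W \<subseteq> snd c ` fst c" "U = {p \<in> fst c. snd c p \<in> W}"
    and F: "smooth_on W F" "\<And>p. p \<in> U \<Longrightarrow> f p \<in> fst d \<and> snd d (f p) = F (snd c p)"
  shows "smooth_map M U N f"
  unfolding smooth_map_def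
proof (intro conjI ballI)
  interpret M: smooth_atlas M by (rule M)
  interpret N: smooth_atlas N by (rule N)
  show U: "openin (mtop M) U" by (rule M.openin_chartI[OF c W(1,3)])
  show "f ` U \<subseteq> points N" using F(2) N.charts_subset[OF d] by blast
  fix a b assume "a \<in> atlas M" "b \<in> atlas N"
  then have a: "a \<in> charts M" and b: "b \<in> charts N" using M.atlas_charts N.atlas_charts by auto
  let ?A = "snd a ` (fst a \<inter> U \<inter> f -` fst b)"
  let ?B = "{z \<in> W. F z \<in> snd d ` (fst d \<inter> fst b)}"
  have B: "open ?B"
    by (rule open_preimage[OF smooth_on_continuous[OF F(1)] W(1) N.charts_transition(1)[OF d b]])
  have A: "?A = {y \<in> snd a ` (fst a \<inter> fst c). ctrans a c y \<in> ?B}" (is "_ = ?C")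
  proof (intro equalityI subsetI)
    fix y assume "y \<in> ?A"
    then obtain p where p: "p \<in> fst a" "p \<in> U" "f p \<in> fst b" "y = snd a p" by auto
    then show "y \<in> ?C" using W(3) F(2)[OF p(2)] by (auto simp: M.ctrans_chart[OF a] intro!: image_eqI[of _ _ "f p"])
  next
    fix y assume "y \<in> ?C"
    then obtain p where p: "p \<in> fst a" "p \<in> fst c" "y = snd a p" "snd c p \<in> ?B"
      by (auto simp: M.ctrans_chart[OF a])
    then have pU: "p \<in> U" using W(3) by auto
    obtain e where e: "snd d (f p) = snd d e" "e \<in> fst d" "e \<in> fst b" using p(4) F(2)[OF pU] by auto
    then have "f p = e" using F(2)[OF pU] N.cinv[OF d] by metis
    then show "y \<in> ?A" using p pU e by auto
  qed
  have op: "open ?C"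
    by (rule open_preimage[OF smooth_on_continuous[OF M.charts_transition(2)[OF a c]] M.charts_transition(1)[OF a c] B])
  then show "open ?A" using A by simp
  have "smooth_on ?C (\<lambda>y. ctrans d b (F (ctrans a c y)))"
    by (rule smooth_on_compose[OF N.charts_transition(2)[OF d b] smooth_on_compose[OF F(1)
            smooth_on_subset[OF M.charts_transition(2)[OF a c]] op] op]) auto
  then have "smooth_on ?C (snd b \<circ> f \<circ> chart_inv a)"
  proof (rule smooth_on_cong[OF _ op])
    fix y assume y: "y \<in> ?C"
    then have "y \<in> ?A" using A by simp
    then obtain p where p: "p \<in> fst a" "p \<in> U" "f p \<in> fst b" "y = snd a p" by auto
    then show "ctrans d b (F (ctrans a c y)) = (snd b \<circ> f \<circ> chart_inv a) y"
      using F(2)[OF p(2)] N.ctrans_chart[OF d, of "f p" b] by (simp add: M.ctrans_chart[OF a] M.cinv[OF a])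
  qed
  then show "smooth_on ?A (snd b \<circ> f \<circ> chart_inv a)" using A by simp
qed

text \<open>\<open>tmap\<close> is defined by the charts selected at the two points; the chain rule turns them into
  arbitrary ones.\<close>

lemma tmap_charts:
  assumes M: "smooth_atlas M" and N: "smooth_atlas N" and c: "c \<in> charts M" "p \<in> fst c" and d: "d \<in> charts N"
    and S: "open S" "snd c p \<in> S" "S \<subseteq> snd c ` fst c" and F: "smooth_on S F"
    and f: "\<And>q. q \<in> fst c \<Longrightarrow> snd c q \<in> S \<Longrightarrow> f q \<in> fst d \<and> snd d (f q) = F (snd c q)"
  shows "tmap M N f p v = tvec N d (f p) (FD F (snd c p) (tcoord M c p v))"
proof -
  interpret M: smooth_atlas M by (rule M)
  interpret N: smooth_atlas N by (rule N)
  have pM: "p \<in> points M" by (rule M.charts_subset[OF c])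
  have fd: "f p \<in> fst d" "snd d (f p) = F (snd c p)" using f[OF c(2) S(2)] by auto
  have fN: "f p \<in> points N" by (rule N.charts_subset[OF d fd(1)])
  define a where "a = chart_at M p"
  define b where "b = chart_at N (f p)"
  have a: "a \<in> charts M" "p \<in> fst a"
    unfolding a_def using M.chart_at[OF pM] M.atlas_charts by auto
  have b: "b \<in> charts N" "f p \<in> fst b"
    unfolding b_def using N.chart_at[OF fN] N.atlas_charts by auto
  let ?T = "{y \<in> snd a ` (fst a \<inter> fst c). ctrans a c y \<in> S}"
  have T: "open ?T"
    by (rule open_preimage[OF smooth_on_continuous[OF M.charts_transition(2)[OF a(1) c(1)]]
          M.charts_transition(1)[OF a(1) c(1)] S(1)])
  have pT: "snd a p \<in> ?T" using a c S by (auto simp: M.ctrans_chart[OF a])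
  have "FD (snd b \<circ> f \<circ> chart_inv a) (snd a p) = FD (\<lambda>y. ctrans d b (F (ctrans a c y))) (snd a p)"
  proof (rule FD_cong_open[OF T pT])
    fix y assume "y \<in> ?T"
    then obtain q where q: "q \<in> fst a" "q \<in> fst c" "y = snd a q" "snd c q \<in> S"
      by (auto simp: M.ctrans_chart[OF a(1)])
    then show "(snd b \<circ> f \<circ> chart_inv a) y = ctrans d b (F (ctrans a c y))"
      using f[OF q(2,4)] N.ctrans_chart[OF d, of "f q" b] by (simp add: M.ctrans_chart[OF a(1)] M.cinv[OF a(1)])
  qed
  then have "tmap M N f p v = FD (\<lambda>y. ctrans d b (F (ctrans a c y))) (snd a p) v"
    by (simp add: tmap_def a_def b_def)
  also have "\<dots> = FD (ctrans d b) (F (snd c p)) (FD F (snd c p) (FD (ctrans a c) (snd a p) v))"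
  proof -
    have t: "ctrans a c (snd a p) = snd c p" by (rule M.ctrans_chart[OF a])
    have d1: "ctrans a c differentiable (at (snd a p))"
      by (rule M.ctrans_differentiable[OF a(1) c(1) a(2) c(2)])
    have d2: "F differentiable (at (snd c p))" by (rule smooth_on_differentiable[OF F S(2)])
    have d3: "ctrans d b differentiable (at (F (snd c p)))"
      using N.ctrans_differentiable[OF d b(1) fd(1) b(2)] fd(2) by simp
    have d12: "(\<lambda>y. F (ctrans a c y)) differentiable (at (snd a p))"
      using differentiable_chain_at[OF d1, of F] d2 t by (simp add: o_def)
    show ?thesis
      using FD_compose[of "ctrans d b" "\<lambda>y. F (ctrans a c y)" "snd a p" v]
        FD_compose[of F "ctrans a c" "snd a p" v] d1 d2 d3 d12 t by simp
  qed
  also have "\<dots> = tvec N d (f p) (FD F (snd c p) (tcoord M c p v))"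
    unfolding N.tvec_FD M.tcoord_FD[OF pM] a_def b_def fd(2)[symmetric] ..
  finally show ?thesis .
qed

lemma smooth_manifold_atlas: "smooth_manifold M \<Longrightarrow> smooth_atlas M"
  by (auto simp: smooth_manifold_def smooth_atlas_def)

section \<open>Fibred charts\<close>

lemma subspace_kernel': "linear A \<Longrightarrow> subspace {v. A v = 0}"
  by (simp add: subspace_def linear_0 linear_add linear_cmul)

lemma dim_kernel_surj:
  fixes A :: "'a::euclidean_space \<Rightarrow> 'b::euclidean_space"
  assumes A: "linear A" "surj A"
  shows "dim {v. A v = 0} + DIM('b) = DIM('a)"
proof -
  obtain g where g: "linear g" "A \<circ> g = id"
    using linear_surjective_right_inverse[OF A] by auto
  have Ag: "A (g x) = x" for x using fun_cong[OF g(2), of x] by simp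
  let ?K = "{v. A v = 0}"
  have K: "subspace ?K" by (rule subspace_kernel'[OF A(1)])
  have R: "subspace (range g)" by (rule linear_subspace_image[OF g(1) subspace_UNIV])
  have "inj g" using Ag by (metis injI)
  then have d1: "dim (range g) = DIM('b)"
    using dim_image_eq[OF g(1), of UNIV] by simp
  have d2: "{x + y |x y. x \<in> ?K \<and> y \<in> range g} = UNIV"
  proof -
    have "v \<in> {x + y |x y. x \<in> ?K \<and> y \<in> range g}" for v
    proof (rule CollectI, intro exI conjI)
      show "v = (v - g (A v)) + g (A v)" by simp
      show "v - g (A v) \<in> ?K" using A(1) by (simp add: linear_diff Ag)
    qed (rule rangeI)
    then show ?thesis by (rule UNIV_eq_I[THEN sym])
  qed
  have d3: "?K \<inter> range g = {0}"
  proof (intro equalityI subsetI)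
    fix v assume "v \<in> ?K \<inter> range g"
    then obtain x where "v = g x" "A (g x) = 0" by auto
    then show "v \<in> {0}" using Ag[of x] linear_0[OF g(1)] by simp
  next
    fix v :: 'a assume "v \<in> {0}"
    then show "v \<in> ?K \<inter> range g"
      using linear_0[OF g(1)] linear_0[OF A(1)] by (auto intro: range_eqI[of _ _ 0])
  qed
  have "dim (UNIV :: 'a set) + dim {0 :: 'a} = dim ?K + DIM('b)"
    using dim_sums_Int[OF K R] unfolding d1 d2 d3 .
  then show ?thesis by simp
qed

text \<open>The kernel of \<open>A\<close> has the dimension of the second factor; a map that is an isometry on this kernel
  completes \<open>A\<close> to an injective map.\<close>

lemma complete_surjection:
  fixes A :: "(real^'n::finite) \<times> (real^'m::finite) \<Rightarrow> real^'n"
  assumes A: "linear A" "surj A"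
  obtains L :: "(real^'n) \<times> (real^'m) \<Rightarrow> real^'m" where "linear L" "inj (\<lambda>v. (A v, L v))"
proof -
  let ?K = "{v. A v = 0}"
  have "dim ?K = dim (UNIV :: (real^'m) set)"
    using dim_kernel_surj[OF A] by simp
  note dimK = this
  have "\<exists>L :: (real^'n) \<times> (real^'m) \<Rightarrow> real^'m. linear L \<and> (\<forall>x\<in>?K. norm (L x) = norm x)"
  proof (rule isometries_subspaces[OF subspace_kernel'[OF A(1)] subspace_UNIV dimK])
    fix L :: "(real^'n) \<times> (real^'m) \<Rightarrow> real^'m"
    assume "linear L" "\<And>x. x \<in> ?K \<Longrightarrow> norm (L x) = norm x"
    then show ?thesis by (intro exI[of _ L]) simp
  qed
  then obtain L :: "(real^'n) \<times> (real^'m) \<Rightarrow> real^'m"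
    where L: "linear L" "\<forall>x\<in>?K. norm (L x) = norm x" by blast
  have lin: "linear (\<lambda>v. (A v, L v))"
    using A(1) L(1) by (simp add: linear_iff)
  have "v = 0" if "(A v, L v) = 0" for v
  proof -
    have "A v = 0" "L v = 0" using that by (simp_all add: zero_prod_def)
    then show "v = 0" using bspec[OF L(2), of v] by simp
  qed
  then have "inj (\<lambda>v. (A v, L v))"
    unfolding linear_injective_0[OF lin] by blast
  then show ?thesis by (rule that[OF L(1)])
qed

locale fibred =
  fixes P :: "('e, 'q, 'n::finite, 'm::finite) fibration"
  assumes fibred: "fibred_manifold P"

sublocale fibred \<subseteq> E: smooth_atlas "total P"
  using fibred by (intro smooth_manifold_atlas) (simp add: fibred_manifold_def)

sublocale fibred \<subseteq> B: smooth_atlas "base P"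
  using fibred by (intro smooth_manifold_atlas) (simp add: fibred_manifold_def)

context fibred
begin

lemma smooth_proj: "smooth_map (total P) (points (total P)) (base P) (proj P)"
  using fibred by (simp add: fibred_manifold_def)

lemma proj_points: "e \<in> points (total P) \<Longrightarrow> proj P e \<in> points (base P)"
  using fibred by (auto simp: fibred_manifold_def)

lemma fibred_chartD:
  assumes "f \<in> fibred_charts P"
  shows "fst f \<in> charts (total P)" "snd f \<in> charts (base P)"
    and "e \<in> fst (fst f) \<Longrightarrow> proj P e \<in> fst (snd f)"
    and "e \<in> fst (fst f) \<Longrightarrow> fst (snd (fst f) e) = snd (snd f) (proj P e)"
  using assms unfolding fibred_charts_def by (auto, blast)

text \<open>The projection in charts, completed by a linear map on the kernel of its differential, is a
  local diffeomorphism, and therefore provides coordinates that extend those of the base.\<close>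

lemma ex_fibred_chart:
  assumes e: "e \<in> points (total P)"
  shows "\<exists>f\<in>fibred_charts P. e \<in> fst (fst f)"
proof -
  define a where "a = chart_at (total P) e"
  define b where "b = chart_at (base P) (proj P e)"
  have a: "a \<in> charts (total P)" "e \<in> fst a"
    unfolding a_def using E.chart_at[OF e] E.atlas_charts by auto
  have b: "b \<in> charts (base P)" "proj P e \<in> fst b"
    unfolding b_def using B.chart_at[OF proj_points[OF e]] B.atlas_charts by auto
  define W where "W = snd a ` (fst a \<inter> points (total P) \<inter> proj P -` fst b)"
  define \<phi> where "\<phi> y = snd b (proj P (chart_inv a y))" for y
  have W: "open W" "smooth_on W \<phi>"
    unfolding W_def \<phi>_def[abs_def]
    by (rule smooth_map_charts[OF E.smooth_atlas_axioms B.smooth_atlas_axioms smooth_proj a(1) b(1)])+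
  have eW: "snd a e \<in> W" unfolding W_def by (rule imageI) (use e a b in simp)
  let ?A = "FD \<phi> (snd a e)"
  have "?A = tmap (total P) (base P) (proj P) e"
    by (simp add: tmap_def a_def b_def \<phi>_def[abs_def] o_def)
  moreover have "surj (tmap (total P) (base P) (proj P) e)"
    using fibred e unfolding fibred_manifold_def by blast
  ultimately have "surj ?A" by (simp only:)
  have linA: "linear ?A" by (rule smooth_on_FD_linear[OF W(2) eW])
  obtain L :: "(real^'n) \<times> (real^'m) \<Rightarrow> real^'m" where L: "linear L" "inj (\<lambda>v. (?A v, L v))"
    by (rule complete_surjection[OF linA \<open>surj ?A\<close>])
  define \<Phi> where "\<Phi> y = (\<phi> y, L y)" for y
  have sm: "smooth_on W \<Phi>"
    unfolding \<Phi>_def[abs_def] by (rule smooth_on_Pair[OF W(2) smooth_on_linear[OF L(1)] W(1)])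
  have "(L has_derivative L) (at (snd a e))"
    using L(1) linear_conv_bounded_linear bounded_linear_imp_has_derivative by blast
  from has_derivative_Pair[OF smooth_on_has_derivative[OF W(2) eW] this]
  have "FD \<Phi> (snd a e) = (\<lambda>v. (?A v, L v))"
    unfolding \<Phi>_def[abs_def] by (rule FD_eq)
  then have inj\<Phi>: "inj (FD \<Phi> (snd a e))" using L(2) by (simp only:)
  obtain U V g where U: "open U" "U \<subseteq> W" "snd a e \<in> U" "open V" "\<Phi> ` U = V" "g ` V = U"
    and g': "\<forall>x\<in>U. g (\<Phi> x) = x" "\<forall>y\<in>V. \<Phi> (g y) = y" and g3: "smooth_on V g"
    by (rule smooth_inverse_function_theorem[OF sm W(1) eW inj\<Phi>])
  have g: "\<And>x. x \<in> U \<Longrightarrow> g (\<Phi> x) = x" "\<And>y. y \<in> V \<Longrightarrow> \<Phi> (g y) = y" "smooth_on V g"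
    by (rule bspec[OF g'(1)], assumption, rule bspec[OF g'(2)], assumption, rule g3)
  define c where "c = ({p \<in> fst a. snd a p \<in> U}, \<lambda>p. \<Phi> (snd a p))"
  have c1: "fst c = {p \<in> fst a. snd a p \<in> U}" and c2: "snd c p = \<Phi> (snd a p)" for p
    by (simp_all add: c_def)
  have Usub: "U \<subseteq> snd a ` fst a" using U(2) by (auto simp: W_def)
  have im: "snd c ` fst c = V"
  proof -
    have "x \<in> snd a ` fst c" if "x \<in> U" for x
      using subsetD[OF Usub that] that by (auto simp: c1)
    then have "snd a ` fst c = U" by (auto simp: c1)
    then have "\<Phi> ` (snd a ` fst c) = V" using U(5) by simp
    then show ?thesis by (simp add: image_image c2)
  qed
  have inj: "inj_on (snd c) (fst c)"
  proof (rule inj_onI)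
    fix p q assume "p \<in> fst c" "q \<in> fst c" "snd c p = snd c q"
    then have *: "\<Phi> (snd a p) = \<Phi> (snd a q)" "snd a p \<in> U" "snd a q \<in> U" "p \<in> fst a" "q \<in> fst a"
      by (simp_all add: c1 c2)
    have "snd a p = snd a q"
      using arg_cong[OF *(1), of g] unfolding g(1)[OF *(2)] g(1)[OF *(3)] .
    then show "p = q" using E.cinv[OF a(1) *(4)] E.cinv[OF a(1) *(5)] by metis
  qed
  have isc: "is_chart (points (total P)) c"
  proof -
    have "fst c \<subseteq> points (total P)"
      unfolding c1 by (rule subsetI) (blast intro: E.charts_subset[OF a(1)])
    then show ?thesis unfolding is_chart_def im using inj U(4) by blast
  qed
  note cinv' = chart_inv_chart[OF isc]
  have "c \<in> charts (total P)"
    unfolding charts_def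
  proof (intro CollectI conjI ballI)
    show "is_chart (points (total P)) c" by (rule isc)
    fix d assume "d \<in> atlas (total P)"
    then have d: "d \<in> charts (total P)" by (rule E.atlas_charts)
    have ga: "g (snd c p) = snd a p" if "p \<in> fst c" for p
      using g(1) that by (simp add: c1 c2)
    show "smooth_transition c d"
    proof -
      let ?S = "{y \<in> V. g y \<in> snd a ` (fst a \<inter> fst d)}"
      have oS: "open ?S"
        by (rule open_preimage[OF smooth_on_continuous[OF g(3)] U(4) E.charts_transition(1)[OF a(1) d]])
      have S: "snd c ` (fst c \<inter> fst d) = ?S"
      proof (intro equalityI subsetI)
        fix y assume "y \<in> snd c ` (fst c \<inter> fst d)"
        then obtain p where p: "p \<in> fst c" "p \<in> fst d" "y = snd c p" by auto
        have "y \<in> V" using im p by blast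
        moreover have "g y \<in> snd a ` (fst a \<inter> fst d)" unfolding p(3) ga[OF p(1)] using p(1,2) by (simp add: c1)
        ultimately show "y \<in> ?S" by blast
      next
        fix y assume "y \<in> ?S"
        then obtain p where p: "y \<in> V" "g y = snd a p" "p \<in> fst a" "p \<in> fst d" by auto
        have "g y \<in> U" using U(6) p(1) by blast
        then have "p \<in> fst c" using p(2,3) by (simp add: c1)
        moreover have "y = snd c p" using g(2)[OF p(1)] unfolding c2 p(2) by (rule sym)
        ultimately show "y \<in> snd c ` (fst c \<inter> fst d)" using p by auto
      qed
      have "smooth_on ?S (\<lambda>y. ctrans a d (g y))"
        by (rule smooth_on_compose[OF E.charts_transition(2)[OF a(1) d] smooth_on_subset[OF g(3)] oS]) auto
      then have "smooth_on ?S (snd d \<circ> chart_inv c)"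
      proof (rule smooth_on_cong[OF _ oS])
        fix y assume "y \<in> ?S"
        then obtain p where p: "p \<in> fst c" "p \<in> fst d" "y = snd c p" using S by auto
        then show "ctrans a d (g y) = (snd d \<circ> chart_inv c) y"
          using E.ctrans_chart[OF a(1), of p d] by (simp add: ga cinv' c1)
      qed
      then show ?thesis using oS S by (simp add: smooth_transition_def)
    qed
    show "smooth_transition d c"
    proof -
      let ?S = "{y \<in> snd d ` (fst d \<inter> fst a). ctrans d a y \<in> U}"
      have oS: "open ?S"
        by (rule open_preimage[OF smooth_on_continuous[OF E.charts_transition(2)[OF d a(1)]]
              E.charts_transition(1)[OF d a(1)] U(1)])
      have S: "snd d ` (fst d \<inter> fst c) = ?S"
        by (auto simp: c1 E.ctrans_chart[OF d])
      have "smooth_on ?S (\<lambda>y. \<Phi> (ctrans d a y))"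
        by (rule smooth_on_compose[OF smooth_on_subset[OF sm U(2)] smooth_on_subset[OF E.charts_transition(2)[OF d a(1)]] oS]) auto
      then have "smooth_on ?S (snd c \<circ> chart_inv d)"
        by (rule smooth_on_cong[OF _ oS]) (auto simp: c2 E.ctrans_chart[OF d] E.cinv[OF d])
      then show ?thesis using oS S by (simp add: smooth_transition_def)
    qed
  qed
  moreover have "proj P p \<in> fst b \<and> fst (snd c p) = snd b (proj P p)" if "p \<in> fst c" for p
  proof -
    have p: "p \<in> fst a" "snd a p \<in> U" using that by (auto simp: c1)
    then have "snd a p \<in> W" using U(2) by auto
    then obtain q where q: "snd a p = snd a q" "q \<in> fst a" "proj P q \<in> fst b" by (auto simp: W_def)
    then have "p = q" using p(1) E.cinv[OF a(1)] by metis
    then show ?thesis using q E.cinv[OF a(1) p(1)] by (simp add: c2 \<Phi>_def \<phi>_def)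
  qed
  ultimately have "(c, b) \<in> fibred_charts P"
    using b(1) by (auto simp: fibred_charts_def)
  moreover have "e \<in> fst c" using a U(3) by (simp add: c1)
  ultimately show ?thesis by (intro bexI[of _ "(c, b)"]) auto
qed


section \<open>Local sections in fibred charts\<close>

text \<open>The map of which the section is the graph, in the coordinates of a fibred chart.\<close>

definition local_rep :: "('e, 'q, 'n, 'm) fchart \<Rightarrow> ('q \<Rightarrow> 'e) \<Rightarrow> real^'n \<Rightarrow> real^'m" where
  "local_rep f \<sigma> x = snd (snd (fst f) (\<sigma> (chart_inv (snd f) x)))"

lemma section_deriv_local_rep:
  "section_deriv f \<alpha> I \<sigma> q = mdiff I (\<lambda>x. local_rep f \<sigma> x $ \<alpha>) (snd (snd f) q)"
  by (simp add: section_deriv_def local_rep_def)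

lemma section_proj: "\<sigma> \<in> sections_at P q \<Longrightarrow> proj P (\<sigma> q) = q"
  by (auto simp: sections_at_def)

lemma section_points:
  assumes "\<sigma> \<in> sections_at P q"
  shows "\<sigma> q \<in> points (total P)" "q \<in> points (base P)"
proof -
  show "\<sigma> q \<in> points (total P)" using assms by (auto simp: sections_at_def smooth_map_def)
  then show "q \<in> points (base P)" using proj_points section_proj[OF assms] by metis
qed

lemma section_base_in_chart:
  assumes "\<sigma> \<in> sections_at P q" "f \<in> fibred_charts P" "\<sigma> q \<in> fst (fst f)"
  shows "q \<in> fst (snd f)"
  using fibred_chartD(3)[OF assms(2,3)] section_proj[OF assms(1)] by simp

text \<open>In a fibred chart the projection is \<open>(x, u) \<mapsto> x\<close>, so a section is the graph of a smooth map; near the base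
  point it stays in the domain of the chart and remains a section.\<close>

lemma section_local:
  assumes \<sigma>: "\<sigma> \<in> sections_at P q" and f: "f \<in> fibred_charts P" and q: "\<sigma> q \<in> fst (fst f)"
  obtains W where "open W" "snd (snd f) q \<in> W" "smooth_on W (local_rep f \<sigma>)"
    "\<forall>x\<in>W. \<exists>y. y \<in> fst (snd f) \<and> x = snd (snd f) y \<and> \<sigma> y \<in> fst (fst f) \<and> \<sigma> \<in> sections_at P y \<and>
       snd (fst f) (\<sigma> y) = (x, local_rep f \<sigma> x)"
proof -
  note fD = fibred_chartD[OF f]
  have qf: "q \<in> fst (snd f)" by (rule section_base_in_chart[OF assms])
  obtain V where V: "openin (mtop (base P)) V" "q \<in> V" "smooth_map (base P) V (total P) \<sigma>"
    "\<And>y. y \<in> V \<Longrightarrow> proj P (\<sigma> y) = y"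
    using \<sigma> by (auto simp: sections_at_def)
  let ?W = "snd (snd f) ` (fst (snd f) \<inter> V \<inter> \<sigma> -` fst (fst f))"
  note sm = smooth_map_charts[OF B.smooth_atlas_axioms E.smooth_atlas_axioms V(3) fD(2) fD(1)]
  have m1: "smooth_on ?W (local_rep f \<sigma>)"
    unfolding local_rep_def[abs_def] by (rule smooth_on_snd[OF sm(2,1)])
  have m2: "\<exists>y. y \<in> fst (snd f) \<and> x = snd (snd f) y \<and> \<sigma> y \<in> fst (fst f) \<and> \<sigma> \<in> sections_at P y \<and>
         snd (fst f) (\<sigma> y) = (x, local_rep f \<sigma> x)" if xW: "x \<in> ?W" for x
  proof -
    obtain y where y: "y \<in> fst (snd f)" "y \<in> V" "\<sigma> y \<in> fst (fst f)" "x = snd (snd f) y"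
      using xW by blast
    then show ?thesis
      using fD(4)[OF y(3)] V
      by (intro exI[of _ y]) (auto simp: prod_eq_iff local_rep_def B.cinv[OF fD(2)] sections_at_def)
  qed
  have m3: "snd (snd f) q \<in> ?W" using qf q V(2) by blast
  show ?thesis by (rule that[OF sm(1) m3 m1]) (use m2 in blast)
qed

text \<open>The two graphs are related by the transition map of the total space, and their base coordinates by that
  of the base.\<close>

lemma section_change:
  assumes \<sigma>: "\<sigma> \<in> sections_at P q" and f: "f \<in> fibred_charts P" "\<sigma> q \<in> fst (fst f)"
    and f': "f' \<in> fibred_charts P" "\<sigma> q \<in> fst (fst f')"
  obtains S where "open S" "snd (snd f') q \<in> S" "S \<subseteq> snd (snd f') ` (fst (snd f') \<inter> fst (snd f))"
    "smooth_on S (\<lambda>x. local_rep f \<sigma> (ctrans (snd f') (snd f) x))"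
    "\<forall>x\<in>S. (ctrans (snd f') (snd f) x, local_rep f \<sigma> (ctrans (snd f') (snd f) x))
              \<in> snd (fst f) ` (fst (fst f) \<inter> fst (fst f')) \<and>
       local_rep f' \<sigma> x =
         snd (ctrans (fst f) (fst f') (ctrans (snd f') (snd f) x, local_rep f \<sigma> (ctrans (snd f') (snd f) x)))"
proof -
  note fD = fibred_chartD[OF f(1)] and fD' = fibred_chartD[OF f'(1)]
  obtain W where W: "open W" "snd (snd f) q \<in> W" "smooth_on W (local_rep f \<sigma>)"
    "\<forall>x\<in>W. \<exists>y. y \<in> fst (snd f) \<and> x = snd (snd f) y \<and> \<sigma> y \<in> fst (fst f) \<and> \<sigma> \<in> sections_at P y \<and>
         snd (fst f) (\<sigma> y) = (x, local_rep f \<sigma> x)"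
    by (rule section_local[OF \<sigma> f])
  obtain W' where W': "open W'" "snd (snd f') q \<in> W'" "smooth_on W' (local_rep f' \<sigma>)"
    "\<forall>x\<in>W'. \<exists>y. y \<in> fst (snd f') \<and> x = snd (snd f') y \<and> \<sigma> y \<in> fst (fst f') \<and> \<sigma> \<in> sections_at P y \<and>
         snd (fst f') (\<sigma> y) = (x, local_rep f' \<sigma> x)"
    by (rule section_local[OF \<sigma> f'])
  let ?h = "ctrans (snd f') (snd f)"
  let ?D = "snd (snd f') ` (fst (snd f') \<inter> fst (snd f))"
  define S where "S = {x \<in> ?D. ?h x \<in> W} \<inter> W'"
  note tr = B.charts_transition[OF fD'(2) fD(2)]
  have S: "open S"
    unfolding S_def using open_preimage[OF smooth_on_continuous[OF tr(2)] tr(1) W(1)] W'(1) by (rule open_Int)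
  have m1: "snd (snd f') q \<in> S"
  proof -
    have q: "q \<in> fst (snd f)" "q \<in> fst (snd f')"
      by (rule section_base_in_chart[OF \<sigma> f], rule section_base_in_chart[OF \<sigma> f'])
    have "?h (snd (snd f') q) \<in> W" using W(2) B.ctrans_chart[OF fD'(2) q(2), of "snd f"] by simp
    then show ?thesis unfolding S_def using q W'(2) by blast
  qed
  have m2: "S \<subseteq> ?D" by (auto simp: S_def)
  have m3: "smooth_on S (\<lambda>x. local_rep f \<sigma> (?h x))"
    by (rule smooth_on_compose[OF W(3) smooth_on_subset[OF tr(2) m2] S]) (simp add: S_def image_subset_iff)
  have m4: "(?h x, local_rep f \<sigma> (?h x)) \<in> snd (fst f) ` (fst (fst f) \<inter> fst (fst f')) \<and>
       local_rep f' \<sigma> x = snd (ctrans (fst f) (fst f') (?h x, local_rep f \<sigma> (?h x)))" if "x \<in> S" for x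
  proof -
    have xW: "?h x \<in> W" "x \<in> W'" "x \<in> ?D" using that unfolding S_def by blast+
    obtain y where y: "y \<in> fst (snd f')" "x = snd (snd f') y" "\<sigma> y \<in> fst (fst f')"
      "snd (fst f') (\<sigma> y) = (x, local_rep f' \<sigma> x)" using bspec[OF W'(4) xW(2)] by blast
    have yf: "y \<in> fst (snd f)"
    proof -
      obtain y' where y': "x = snd (snd f') y'" "y' \<in> fst (snd f')" "y' \<in> fst (snd f)" using xW(3) by blast
      then have "y = y'" using y(1,2) B.cinv[OF fD'(2)] by metis
      then show ?thesis using y'(3) by simp
    qed
    have hx: "?h x = snd (snd f) y" unfolding y(2) by (rule B.ctrans_chart[OF fD'(2) y(1)])
    obtain z where z: "z \<in> fst (snd f)" "?h x = snd (snd f) z" "\<sigma> z \<in> fst (fst f)"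
      "snd (fst f) (\<sigma> z) = (?h x, local_rep f \<sigma> (?h x))" using bspec[OF W(4) xW(1)] by blast
    have "z = y" using z(1,2) hx yf B.cinv[OF fD(2)] by metis
    note zy = z(3,4)[unfolded this]
    have "(?h x, local_rep f \<sigma> (?h x)) \<in> snd (fst f) ` (fst (fst f) \<inter> fst (fst f'))"
      unfolding zy(2)[symmetric] using zy(1) y(3) by blast
    moreover have "ctrans (fst f) (fst f') (?h x, local_rep f \<sigma> (?h x)) = snd (fst f') (\<sigma> y)"
      unfolding zy(2)[symmetric] by (rule E.ctrans_chart[OF fD(1) zy(1)])
    moreover have "local_rep f' \<sigma> x = snd (snd (fst f') (\<sigma> y))" unfolding y(4) by simp
    ultimately show ?thesis by simp
  qed
  show ?thesis by (rule that[OF S m1 m2 m3]) (use m4 in blast)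
qed

lemma agree_local_rep:
  assumes \<sigma>: "\<sigma> \<in> sections_at P q" and \<tau>: "\<tau> \<in> sections_at P q" and eq: "\<sigma> q = \<tau> q"
    and f: "f \<in> fibred_charts P" "\<sigma> q \<in> fst (fst f)"
    and d: "\<And>\<alpha> I. mdeg I \<le> s \<Longrightarrow> section_deriv f \<alpha> I \<sigma> q = section_deriv f \<alpha> I \<tau> q"
  shows "agree s (snd (snd f) q) (local_rep f \<sigma>) (local_rep f \<tau>)"
proof -
  obtain W where W: "open W" "snd (snd f) q \<in> W" "smooth_on W (local_rep f \<sigma>)"
    by (rule section_local[OF \<sigma> f]) blast
  obtain W' where W': "open W'" "snd (snd f) q \<in> W'" "smooth_on W' (local_rep f \<tau>)"
    by (rule section_local[OF \<tau> f(1) f(2)[unfolded eq]]) blast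
  let ?S = "W \<inter> W'"
  have S: "open ?S" "snd (snd f) q \<in> ?S" using W W' by auto
  have sm: "smooth_on ?S (local_rep f \<sigma>)" "smooth_on ?S (local_rep f \<tau>)"
    by (rule smooth_on_subset[OF W(3)], blast, rule smooth_on_subset[OF W'(3)], blast)
  have e: "local_rep f \<rho> x = (\<Sum>\<alpha>\<in>UNIV. local_rep f \<rho> x $ \<alpha> *\<^sub>R axis \<alpha> 1)" for \<rho> x
    using vec_lambda_sum_axis[of "\<lambda>\<alpha>. local_rep f \<rho> x $ \<alpha>"] by simp
  have "agree s (snd (snd f) q) (\<lambda>x. \<Sum>\<alpha>\<in>UNIV. local_rep f \<sigma> x $ \<alpha> *\<^sub>R axis \<alpha> 1)
    (\<lambda>x. \<Sum>\<alpha>\<in>UNIV. local_rep f \<tau> x $ \<alpha> *\<^sub>R axis \<alpha> 1)"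
  proof (rule agree_sum[OF S])
    fix \<alpha> :: 'm
    have n: "smooth_on ?S (\<lambda>x. local_rep f \<sigma> x $ \<alpha>)" "smooth_on ?S (\<lambda>x. local_rep f \<tau> x $ \<alpha>)"
      by (rule smooth_on_nth[OF sm(1) S(1)], rule smooth_on_nth[OF sm(2) S(1)])
    then show "smooth_on ?S (\<lambda>x. local_rep f \<sigma> x $ \<alpha> *\<^sub>R axis \<alpha> 1)" "smooth_on ?S (\<lambda>x. local_rep f \<tau> x $ \<alpha> *\<^sub>R axis \<alpha> 1)"
      by (auto intro: smooth_on_scaleR[OF _ smooth_on_const S(1)])
    have "agree s (snd (snd f) q) (\<lambda>x. local_rep f \<sigma> x $ \<alpha>) (\<lambda>x. local_rep f \<tau> x $ \<alpha>)"
      by (rule mdiff_eq_imp_agree[OF S n]) (use d in \<open>simp add: section_deriv_local_rep\<close>)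
    then show "agree s (snd (snd f) q) (\<lambda>x. local_rep f \<sigma> x $ \<alpha> *\<^sub>R axis \<alpha> 1) (\<lambda>x. local_rep f \<tau> x $ \<alpha> *\<^sub>R axis \<alpha> 1)"
      by (rule agree_bilinear[OF bounded_bilinear_scaleR S n smooth_on_const smooth_on_const _ agree_refl])
  qed simp
  then show ?thesis by (rule agree_cong[OF S, rotated 2]) (rule e[symmetric])+
qed

text \<open>In the second chart a section is represented by its first representation, composed on both sides with
  transition maps; composition preserves agreement to order \<open>s\<close>. Hence one fibred chart decides whether two
  sections have the same jet.\<close>

lemma section_deriv_chart_independent:
  assumes \<sigma>: "\<sigma> \<in> sections_at P q" and \<tau>: "\<tau> \<in> sections_at P q" and eq: "\<sigma> q = \<tau> q"
    and f: "f \<in> fibred_charts P" "\<sigma> q \<in> fst (fst f)" and f': "f' \<in> fibred_charts P" "\<sigma> q \<in> fst (fst f')"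
    and d: "\<And>\<alpha> I. mdeg I \<le> s \<Longrightarrow> section_deriv f \<alpha> I \<sigma> q = section_deriv f \<alpha> I \<tau> q"
    and I: "mdeg I \<le> s"
  shows "section_deriv f' \<alpha> I \<sigma> q = section_deriv f' \<alpha> I \<tau> q"
proof -
  note fD = fibred_chartD[OF f(1)] and fD' = fibred_chartD[OF f'(1)]
  let ?h = "ctrans (snd f') (snd f)" and ?x = "snd (snd f') q"
  let ?T = "snd (fst f) ` (fst (fst f) \<inter> fst (fst f'))"
  let ?\<Phi> = "ctrans (fst f) (fst f')"
  obtain S1 where S1: "open S1" "?x \<in> S1" "S1 \<subseteq> snd (snd f') ` (fst (snd f') \<inter> fst (snd f))"
    "smooth_on S1 (\<lambda>x. local_rep f \<sigma> (?h x))"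
    "\<forall>x\<in>S1. (?h x, local_rep f \<sigma> (?h x)) \<in> ?T \<and> local_rep f' \<sigma> x = snd (?\<Phi> (?h x, local_rep f \<sigma> (?h x)))"
    by (rule section_change[OF \<sigma> f f'])
  have f\<tau>: "\<tau> q \<in> fst (fst f)" "\<tau> q \<in> fst (fst f')" using f f' eq by auto
  obtain S2 where S2: "open S2" "?x \<in> S2" "S2 \<subseteq> snd (snd f') ` (fst (snd f') \<inter> fst (snd f))"
    "smooth_on S2 (\<lambda>x. local_rep f \<tau> (?h x))"
    "\<forall>x\<in>S2. (?h x, local_rep f \<tau> (?h x)) \<in> ?T \<and> local_rep f' \<tau> x = snd (?\<Phi> (?h x, local_rep f \<tau> (?h x)))"
    by (rule section_change[OF \<tau> f(1) f\<tau>(1) f'(1) f\<tau>(2)])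
  obtain W where W: "open W" "snd (snd f) q \<in> W" "smooth_on W (local_rep f \<sigma>)"
    by (rule section_local[OF \<sigma> f]) blast
  obtain W' where W': "open W'" "snd (snd f) q \<in> W'" "smooth_on W' (local_rep f \<tau>)"
    by (rule section_local[OF \<tau> f(1) f\<tau>(1)]) blast
  have qf: "q \<in> fst (snd f)" "q \<in> fst (snd f')"
    using section_base_in_chart[OF \<sigma> f] section_base_in_chart[OF \<sigma> f'] by auto
  have hx: "?h ?x = snd (snd f) q" using B.ctrans_chart[OF fD'(2) qf(2)] .
  note tr = B.charts_transition[OF fD'(2) fD(2)]
  define S where "S = {x \<in> S1 \<inter> S2. ?h x \<in> W \<inter> W'}"
  have smh: "smooth_on (S1 \<inter> S2) ?h" by (rule smooth_on_subset[OF tr(2)]) (use S1(3) in blast)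
  have S: "open S"
    unfolding S_def by (rule open_preimage[OF smooth_on_continuous[OF smh]]) (use S1 S2 W W' in auto)
  have xS: "?x \<in> S" using S1 S2 W W' hx by (auto simp: S_def)
  have "S \<subseteq> S1 \<inter> S2" "S \<subseteq> S1" "S \<subseteq> S2" unfolding S_def by blast+
  note sub = this
  have smh: "smooth_on S ?h" by (rule smooth_on_subset[OF smh sub(1)])
  have sm: "smooth_on S (\<lambda>x. local_rep f \<sigma> (?h x))" "smooth_on S (\<lambda>x. local_rep f \<tau> (?h x))"
    by (rule smooth_on_subset[OF S1(4) sub(2)], rule smooth_on_subset[OF S2(4) sub(3)])
  have ag: "agree s ?x (\<lambda>x. local_rep f \<sigma> (?h x)) (\<lambda>x. local_rep f \<tau> (?h x))"
  proof (rule agree_compose[OF S xS smh smh])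
    show "?h ` S \<subseteq> W \<inter> W'" "?h ` S \<subseteq> W \<inter> W'" by (simp_all add: S_def image_subset_iff)
    show "smooth_on (W \<inter> W') (local_rep f \<sigma>)" "smooth_on (W \<inter> W') (local_rep f \<tau>)"
      by (rule smooth_on_subset[OF W(3)], blast, rule smooth_on_subset[OF W'(3)], blast)
    show "agree s (?h ?x) (local_rep f \<sigma>) (local_rep f \<tau>)"
      unfolding hx by (rule agree_local_rep[OF \<sigma> \<tau> eq f d])
  qed (rule agree_refl)
  have sP: "smooth_on S (\<lambda>x. (?h x, local_rep f \<sigma> (?h x)))" "smooth_on S (\<lambda>x. (?h x, local_rep f \<tau> (?h x)))"
    using smooth_on_Pair[OF smh sm(1) S] smooth_on_Pair[OF smh sm(2) S] .
  have agP: "agree s ?x (\<lambda>x. (?h x, local_rep f \<sigma> (?h x))) (\<lambda>x. (?h x, local_rep f \<tau> (?h x)))"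
  proof -
    have l: "linear (\<lambda>y::real^'m. (0::real^'n, y))" and l': "linear (\<lambda>y::real^'n. (y, 0::real^'m))"
      by (auto simp: linear_iff)
    have "agree s ?x (\<lambda>x. (?h x, 0) + (0, local_rep f \<sigma> (?h x))) (\<lambda>x. (?h x, 0) + (0, local_rep f \<tau> (?h x)))"
      by (rule agree_add[OF S xS smooth_on_linear_compose[OF l' smh S] smooth_on_linear_compose[OF l' smh S]
            smooth_on_linear_compose[OF l sm(1) S] smooth_on_linear_compose[OF l sm(2) S] agree_refl
            agree_linear[OF S xS sm ag l]])
    then show ?thesis by simp
  qed
  note trE = E.charts_transition[OF fD(1) fD'(1)]
  have lin: "linear (\<lambda>w::(real^'n) \<times> (real^'m). snd w $ \<alpha>)" by (simp add: linear_iff)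
  have sPhi: "smooth_on ?T (\<lambda>w. snd (?\<Phi> w) $ \<alpha>)"
    by (rule smooth_on_linear_compose[OF lin trE(2,1)])
  have "agree s ?x (\<lambda>x. snd (?\<Phi> (?h x, local_rep f \<sigma> (?h x))) $ \<alpha>) (\<lambda>x. snd (?\<Phi> (?h x, local_rep f \<tau> (?h x))) $ \<alpha>)"
  proof (rule agree_compose[OF S xS sP _ _ sPhi sPhi agP agree_refl])
    show "(\<lambda>x. (?h x, local_rep f \<sigma> (?h x))) ` S \<subseteq> ?T" using S1(5) sub(2) by blast
    show "(\<lambda>x. (?h x, local_rep f \<tau> (?h x))) ` S \<subseteq> ?T" using S2(5) sub(3) by blast
  qed
  then have "agree s ?x (\<lambda>x. local_rep f' \<sigma> x $ \<alpha>) (\<lambda>x. local_rep f' \<tau> x $ \<alpha>)"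
  proof (rule agree_cong[OF S xS, rotated 2])
    show "snd (?\<Phi> (?h x, local_rep f \<sigma> (?h x))) $ \<alpha> = local_rep f' \<sigma> x $ \<alpha>"
      "snd (?\<Phi> (?h x, local_rep f \<tau> (?h x))) $ \<alpha> = local_rep f' \<tau> x $ \<alpha>" if "x \<in> S" for x
      using bspec[OF S1(5), of x] bspec[OF S2(5), of x] sub that by auto
  qed
  from agree_imp_mdiff_eq[OF this I] show ?thesis by (simp add: section_deriv_local_rep)
qed

end

section \<open>Jets\<close>

lemma Rep_jidx_jx:
  assumes "mdeg I < CARD('s::finite)"
  shows "Rep_jidx (jx \<alpha> I :: ('m, 'n::finite, 's) jidx) = (\<alpha>, I)"
  unfolding jx_def by (rule Abs_jidx_inverse) (use assms in simp)

lemma jidx_cases: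
  fixes A :: "('m, 'n::finite, 's::finite) jidx"
  obtains \<alpha> I where "A = jx \<alpha> I" "mdeg I < CARD('s)"
proof -
  obtain \<alpha> I where R: "Rep_jidx A = (\<alpha>, I)" by (cases "Rep_jidx A")
  then have "mdeg I < CARD('s)" using Rep_jidx[of A] by auto
  moreover have "A = jx \<alpha> I" using R Rep_jidx_inverse[of A] by (simp add: jx_def)
  ultimately show ?thesis using that by blast
qed

lemma jx_eq_iff:
  assumes "mdeg I < CARD('s::finite)" "mdeg J < CARD('s)"
  shows "(jx \<alpha> I :: ('m, 'n::finite, 's) jidx) = jx \<beta> J \<longleftrightarrow> \<alpha> = \<beta> \<and> I = J"
  using Rep_jidx_jx[OF assms(1), of \<alpha>] Rep_jidx_jx[OF assms(2), of \<beta>] by (metis prod.inject)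

lemma sum_jidx:
  fixes g :: "('m::finite, 'n::finite, 's::finite) jidx \<Rightarrow> 'a::comm_monoid_add"
  shows "(\<Sum>A\<in>UNIV. g A) = (\<Sum>\<alpha>\<in>UNIV. \<Sum>I | mdeg I < CARD('s). g (jx \<alpha> I))"
proof -
  let ?X = "(UNIV :: 'm set) \<times> {I :: 'n \<Rightarrow> nat. mdeg I < CARD('s)}"
  have inj: "inj_on (\<lambda>(\<alpha>, I). jx \<alpha> I :: ('m, 'n, 's) jidx) ?X"
    by (auto simp: inj_on_def jx_eq_iff)
  have im: "(\<lambda>(\<alpha>, I). jx \<alpha> I :: ('m, 'n, 's) jidx) ` ?X = UNIV"
  proof (intro equalityI subsetI UNIV_I)
    fix A :: "('m, 'n, 's) jidx"
    obtain \<alpha> I where "A = jx \<alpha> I" "mdeg I < CARD('s)" by (rule jidx_cases)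
    then show "A \<in> (\<lambda>(\<alpha>, I). jx \<alpha> I) ` ?X" by force
  qed
  have "(\<Sum>A\<in>UNIV. g A) = (\<Sum>(\<alpha>, I)\<in>?X. g (jx \<alpha> I))"
    unfolding im[symmetric] sum.reindex[OF inj] by (simp add: case_prod_unfold o_def)
  then show ?thesis by (simp add: sum.cartesian_product)
qed

context fibred
begin

lemma jet_equiv_refl: "jet_equiv P s q \<sigma> \<sigma>"
  by (simp add: jet_equiv_def)

lemma jet_equiv_sym: "jet_equiv P s q \<sigma> \<tau> \<Longrightarrow> jet_equiv P s q \<tau> \<sigma>"
  by (auto simp: jet_equiv_def)

lemma jet_equiv_trans: "jet_equiv P s q \<sigma> \<tau> \<Longrightarrow> jet_equiv P s q \<tau> \<rho> \<Longrightarrow> jet_equiv P s q \<sigma> \<rho>"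
  unfolding jet_equiv_def by metis

lemma jet_of_eqI: "jet_equiv P s q \<sigma> \<tau> \<Longrightarrow> jet_of P s q \<sigma> = jet_of P s q \<tau>"
  unfolding jet_of_def
  by (rule arg_cong[of _ _ "Pair q"], rule Collect_cong)
    (meson jet_equiv_trans jet_equiv_sym)

lemma jet_of_in_space:
  "\<sigma> \<in> sections_at P q \<Longrightarrow> jet_of P s q \<sigma> \<in> jet_space P s"
  unfolding jet_space_def using section_points(2) by blast

lemma fst_jet_of [simp]: "fst (jet_of P s q \<sigma>) = q"
  by (simp add: jet_of_def)

lemma jet_rep_jet_of:
  assumes "\<sigma> \<in> sections_at P q"
  shows "jet_rep (jet_of P s q \<sigma>) \<in> sections_at P q" "jet_equiv P s q \<sigma> (jet_rep (jet_of P s q \<sigma>))"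
proof -
  have "\<exists>\<tau>. \<tau> \<in> snd (jet_of P s q \<sigma>)"
    using assms jet_equiv_refl by (auto simp: jet_of_def)
  then have "jet_rep (jet_of P s q \<sigma>) \<in> snd (jet_of P s q \<sigma>)"
    unfolding jet_rep_def by (rule someI_ex)
  then show "jet_rep (jet_of P s q \<sigma>) \<in> sections_at P q" "jet_equiv P s q \<sigma> (jet_rep (jet_of P s q \<sigma>))"
    by (auto simp: jet_of_def)
qed

lemma jet_spaceD:
  assumes "p \<in> jet_space P s"
  shows "jet_rep p \<in> sections_at P (fst p)" "jet_of P s (fst p) (jet_rep p) = p"
proof -
  obtain q \<sigma> where p: "p = jet_of P s q \<sigma>" "\<sigma> \<in> sections_at P q"
    using assms by (auto simp: jet_space_def)
  show "jet_rep p \<in> sections_at P (fst p)"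
    using jet_rep_jet_of(1)[OF p(2), of s] by (simp add: p(1))
  show "jet_of P s (fst p) (jet_rep p) = p"
    unfolding p(1) fst_jet_of by (rule jet_of_eqI[OF jet_rep_jet_of(2)[OF p(2)], symmetric])
qed

definition jcoord :: "('e, 'q, 'n, 'm) fchart \<Rightarrow> 'q \<Rightarrow> ('q \<Rightarrow> 'e) \<Rightarrow> ('n, 'm, 's::finite) jmodel" where
  "jcoord f q \<sigma> = (snd (snd f) q, \<chi> A. case Rep_jidx A of (\<alpha>, I) \<Rightarrow> section_deriv f \<alpha> I \<sigma> q)"

lemma fst_jcoord [simp]: "fst (jcoord f q \<sigma>) = snd (snd f) q"
  by (simp add: jcoord_def)

lemma jcoord_nth:
  "mdeg I < CARD('s::finite) \<Longrightarrow> snd (jcoord f q \<sigma> :: ('n, 'm, 's) jmodel) $ jx \<alpha> I = section_deriv f \<alpha> I \<sigma> q"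
  by (simp add: jcoord_def Rep_jidx_jx)

lemma jcoord_eqI:
  fixes z :: "('n, 'm, 's::finite) jmodel"
  assumes "fst z = snd (snd f) q" "\<And>\<alpha> I. mdeg I < CARD('s) \<Longrightarrow> snd z $ jx \<alpha> I = section_deriv f \<alpha> I \<sigma> q"
  shows "jcoord f q \<sigma> = z"
proof -
  have "snd (jcoord f q \<sigma>) = snd z"
  proof (rule vec_eq_iff[THEN iffD2], rule allI)
    fix A :: "('m, 'n, 's) jidx"
    obtain \<alpha> I where "A = jx \<alpha> I" "mdeg I < CARD('s)" by (rule jidx_cases)
    then show "snd (jcoord f q \<sigma>) $ A = snd z $ A" using assms(2) by (simp add: jcoord_nth)
  qed
  then show ?thesis using assms(1) by (simp add: prod_eq_iff)
qed

lemma jet_equiv_jcoord: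
  assumes "jet_equiv P (CARD('s::finite) - 1) q \<sigma> \<tau>" "f \<in> fibred_charts P" "\<sigma> q \<in> fst (fst f)"
  shows "(jcoord f q \<sigma> :: ('n, 'm, 's) jmodel) = jcoord f q \<tau>"
proof (rule jcoord_eqI)
  show "snd (jcoord f q \<tau> :: ('n, 'm, 's) jmodel) $ jx \<alpha> I = section_deriv f \<alpha> I \<sigma> q"
    if "mdeg I < CARD('s)" for \<alpha> I
    using assms that by (auto simp: jet_equiv_def jcoord_nth[OF that] mindices_def)
qed simp

lemma section_value_jcoord:
  fixes z :: "('n, 'm, 's::finite) jmodel"
  assumes \<sigma>: "\<sigma> \<in> sections_at P q" and f: "f \<in> fibred_charts P" "\<sigma> q \<in> fst (fst f)"
    and z: "jcoord f q \<sigma> = z"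
  shows "snd (fst f) (\<sigma> q) = (fst z, \<chi> \<alpha>. snd z $ jx \<alpha> (\<lambda>_. 0))"
proof -
  have "fst (snd (fst f) (\<sigma> q)) = fst z"
    using fibred_chartD(4)[OF f] section_proj[OF \<sigma>] z by auto
  moreover have "snd (snd (fst f) (\<sigma> q)) = (\<chi> \<alpha>. snd z $ jx \<alpha> (\<lambda>_. 0))"
  proof -
    have "chart_inv (snd f) (snd (snd f) q) = q"
      by (rule B.cinv[OF fibred_chartD(2)[OF f(1)] section_base_in_chart[OF \<sigma> f]])
    then show ?thesis
      unfolding z[symmetric]
      by (simp add: jcoord_nth mdeg_def section_deriv_local_rep local_rep_def vec_eq_iff)
  qed
  ultimately show ?thesis by (simp add: prod_eq_iff)
qed

text \<open>Equal coordinates of order zero give equal values; the others give equal derivatives in this chart,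
  and therefore in all charts.\<close>

lemma jcoord_inj:
  assumes \<sigma>: "\<sigma> \<in> sections_at P q" and \<tau>: "\<tau> \<in> sections_at P q'" and f: "f \<in> fibred_charts P"
    and d: "\<sigma> q \<in> fst (fst f)" "\<tau> q' \<in> fst (fst f)"
    and eq: "(jcoord f q \<sigma> :: ('n, 'm, 's::finite) jmodel) = jcoord f q' \<tau>"
  shows "q = q'" "jet_equiv P (CARD('s) - 1) q \<sigma> \<tau>"
proof -
  have "snd (snd f) q = snd (snd f) q'" using arg_cong[OF eq, of fst] by simp
  then show qq: "q = q'"
    using section_base_in_chart[OF \<sigma> f d(1)] section_base_in_chart[OF \<tau> f d(2)]
      B.cinv[OF fibred_chartD(2)[OF f]] by metis
  note \<tau> = \<tau>[folded qq] and d = d[folded qq] and eq = eq[folded qq]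
  have "snd (fst f) (\<sigma> q) = snd (fst f) (\<tau> q)"
    using section_value_jcoord[OF \<sigma> f d(1) refl, where 's = 's]
      section_value_jcoord[OF \<tau> f d(2) refl, where 's = 's] eq by simp
  then have v: "\<sigma> q = \<tau> q" using E.cinv[OF fibred_chartD(1)[OF f]] d by metis
  have der: "section_deriv f \<alpha> I \<sigma> q = section_deriv f \<alpha> I \<tau> q" if "mdeg I \<le> CARD('s) - 1" for \<alpha> I
  proof -
    have I: "mdeg I < CARD('s)" using that zero_less_card_finite[where 'a = 's] by linarith
    show ?thesis
      using jcoord_nth[OF I, of f q \<sigma> \<alpha>] jcoord_nth[OF I, of f q \<tau> \<alpha>] eq by simp
  qed
  show "jet_equiv P (CARD('s) - 1) q \<sigma> \<tau>"
    unfolding jet_equiv_def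
  proof (intro conjI ballI impI allI)
    fix f' \<alpha> and I :: "'n \<Rightarrow> nat" assume f': "f' \<in> fibred_charts P" "\<sigma> q \<in> fst (fst f')" and I: "I \<in> mindices (CARD('s) - 1)"
    show "section_deriv f' \<alpha> I \<sigma> q = section_deriv f' \<alpha> I \<tau> q"
      by (rule section_deriv_chart_independent[OF \<sigma> \<tau> v f d(1) f' der]) (use I in \<open>auto simp: mindices_def\<close>)
  qed (rule v)
qed

lemma jet_of_in_chart:
  assumes "\<sigma> \<in> sections_at P q" "f \<in> fibred_charts P" "\<sigma> q \<in> fst (fst f)"
  shows "jet_of P (CARD('s::finite) - 1) q \<sigma> \<in> fst (jet_chart P f :: (_, ('n, 'm, 's) jmodel) chart)"
    and "snd (jet_chart P f :: (_, ('n, 'm, 's) jmodel) chart) (jet_of P (CARD('s) - 1) q \<sigma>) = jcoord f q \<sigma>"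
proof -
  note r = jet_rep_jet_of[OF assms(1), of "CARD('s) - 1"]
  have "jet_rep (jet_of P (CARD('s) - 1) q \<sigma>) q = \<sigma> q"
    using r(2) by (simp add: jet_equiv_def)
  then show "jet_of P (CARD('s) - 1) q \<sigma> \<in> fst (jet_chart P f :: (_, ('n, 'm, 's) jmodel) chart)"
    using assms jet_of_in_space by (simp add: jet_chart_def)
  show "snd (jet_chart P f :: (_, ('n, 'm, 's) jmodel) chart) (jet_of P (CARD('s) - 1) q \<sigma>) = jcoord f q \<sigma>"
    using jet_equiv_jcoord[OF r(2) assms(2,3)] by (simp add: jet_chart_def jcoord_def)
qed

lemma jet_chart_obtain:
  assumes "p \<in> fst (jet_chart P f :: (_, ('n, 'm, 's::finite) jmodel) chart)"
  obtains q \<sigma> where "\<sigma> \<in> sections_at P q" "\<sigma> q \<in> fst (fst f)" "p = jet_of P (CARD('s) - 1) q \<sigma>"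
    "snd (jet_chart P f :: (_, ('n, 'm, 's) jmodel) chart) p = jcoord f q \<sigma>"
proof -
  have p: "p \<in> jet_space P (CARD('s) - 1)" "jet_rep p (fst p) \<in> fst (fst f)"
    using assms by (auto simp: jet_chart_def)
  show ?thesis
    by (rule that[OF jet_spaceD(1)[OF p(1)] p(2) jet_spaceD(2)[OF p(1), symmetric]])
      (simp add: jet_chart_def jcoord_def)
qed

lemma jet_of_in_chart_iff:
  assumes "\<sigma> \<in> sections_at P q"
  shows "jet_of P (CARD('s::finite) - 1) q \<sigma> \<in> fst (jet_chart P f :: (_, ('n, 'm, 's) jmodel) chart)
    \<longleftrightarrow> \<sigma> q \<in> fst (fst f)"
proof -
  have "jet_rep (jet_of P (CARD('s) - 1) q \<sigma>) q = \<sigma> q"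
    using jet_rep_jet_of(2)[OF assms, of "CARD('s) - 1"] by (simp add: jet_equiv_def)
  then show ?thesis using assms jet_of_in_space by (simp add: jet_chart_def)
qed

subsection \<open>Polynomial sections\<close>

text \<open>The polynomial map with Taylor coefficients \<open>z\<close> at the point \<open>fst z\<close>.\<close>

definition tpoly :: "('n, 'm, 's::finite) jmodel \<Rightarrow> real^'n \<Rightarrow> real^'m" where
  "tpoly z x = (\<chi> \<alpha>. \<Sum>I | mdeg I < CARD('s). snd z $ jx \<alpha> I * dmon I (x - fst z))"

lemma smooth_tpoly:
  fixes g :: "'b::euclidean_space \<Rightarrow> ('n, 'm, 's::finite) jmodel"
  assumes "open S" "smooth_on S g" "smooth_on S h"
  shows "smooth_on S (\<lambda>w. tpoly (g w) (h w))"
proof -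
  have 1: "smooth_on S (\<lambda>w. snd (g w) $ A)" for A
    by (rule smooth_on_nth[OF smooth_on_snd[OF assms(2,1)] assms(1)])
  have 2: "smooth_on S (\<lambda>w. dmon I (h w - fst (g w)))" for I
    by (rule smooth_on_compose[OF smooth_on_dmon[OF open_UNIV]
          smooth_on_diff[OF assms(3) smooth_on_fst[OF assms(2,1)] assms(1)] assms(1)]) auto
  show ?thesis
    unfolding tpoly_def
    by (rule smooth_on_vec[OF smooth_on_sum[OF smooth_on_mult[OF 1 2 assms(1)] assms(1)] assms(1)])
qed

lemma mdiff_tpoly:
  fixes z :: "('n, 'm, 's::finite) jmodel"
  shows "mdiff J (\<lambda>x. tpoly z x $ \<alpha>) (fst z) = (if mdeg J < CARD('s) then snd z $ jx \<alpha> J else 0)"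
  using mdiff_taylor_poly(2)[OF finite_mdeg_less, of J "\<lambda>I. snd z $ jx \<alpha> I" "fst z" "CARD('s)"]
  by (simp add: tpoly_def)

lemma tpoly_center:
  fixes z :: "('n, 'm, 's::finite) jmodel"
  shows "tpoly z (fst z) = (\<chi> \<alpha>. snd z $ jx \<alpha> (\<lambda>_. 0))"
proof (rule vec_eq_iff[THEN iffD2], rule allI)
  show "tpoly z (fst z) $ \<alpha> = (\<chi> \<alpha>. snd z $ jx \<alpha> (\<lambda>_. 0)) $ \<alpha>" for \<alpha>
    using mdiff_tpoly[of "\<lambda>_. 0" z \<alpha>] by (simp add: mdeg_def)
qed

text \<open>The section with the graph of \<open>tpoly z\<close>. Outside a neighbourhood of the point with coordinates \<open>fst z\<close> the
  value of \<open>chart_inv\<close> is arbitrary, which is harmless for a local section.\<close>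

definition psec :: "('e, 'q, 'n, 'm) fchart \<Rightarrow> ('n, 'm, 's::finite) jmodel \<Rightarrow> 'q \<Rightarrow> 'e" where
  "psec f z q = chart_inv (fst f) (snd (snd f) q, tpoly z (snd (snd f) q))"

text \<open>Only the coordinates \<open>x\<^sup>i\<close> and \<open>u\<^sup>\<alpha>\<close> of a jet are restricted by a fibred chart.\<close>

definition jimage :: "('e, 'q, 'n, 'm) fchart \<Rightarrow> ('n, 'm, 's::finite) jmodel set" where
  "jimage f = {z. (fst z, \<chi> \<alpha>. snd z $ jx \<alpha> (\<lambda>_. 0)) \<in> snd (fst f) ` fst (fst f)}"

lemma smooth_on_value: "smooth_on S (\<lambda>z::('n, 'm, 's::finite) jmodel. (fst z, \<chi> \<alpha>. snd z $ jx \<alpha> (\<lambda>_. 0)))"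
  by (rule smooth_on_linear) (simp add: linear_iff vec_eq_iff)

lemma open_value_preimage:
  "open T \<Longrightarrow> open {z::('n, 'm, 's::finite) jmodel. (fst z, \<chi> \<alpha>. snd z $ jx \<alpha> (\<lambda>_. 0)) \<in> T}"
  using open_preimage[OF smooth_on_continuous[OF smooth_on_value[of UNIV]] open_UNIV, of T] by simp

lemma psec:
  fixes z :: "('n, 'm, 's::finite) jmodel"
  assumes f: "f \<in> fibred_charts P" and z: "z \<in> jimage f"
  defines "q \<equiv> chart_inv (snd f) (fst z)"
  shows "psec f z \<in> sections_at P q" "psec f z q \<in> fst (fst f)" "snd (snd f) q = fst z" "jcoord f q (psec f z) = z"
    and "\<exists>W. open W \<and> fst z \<in> W \<and> (\<forall>x\<in>W. local_rep f (psec f z) x = tpoly z x)"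
proof -
  note fD = fibred_chartD[OF f]
  let ?c = "fst f" and ?d = "snd f"
  have val: "(fst z, tpoly z (fst z)) \<in> snd ?c ` fst ?c"
    using z by (simp add: jimage_def tpoly_center)
  then obtain e where e: "e \<in> fst ?c" "snd ?c e = (fst z, tpoly z (fst z))" by auto
  have xd: "fst z \<in> snd ?d ` fst ?d" using fD(3,4)[OF e(1)] e(2) by auto
  show q: "snd ?d q = fst z" unfolding q_def by (rule chart_chart_inv[OF xd])
  have qd: "q \<in> fst ?d" unfolding q_def by (rule chart_inv_in[OF xd])
  define W where "W = {x \<in> snd ?d ` fst ?d. (x, tpoly z x) \<in> snd ?c ` fst ?c}"
  have smg: "smooth_on UNIV (\<lambda>x. (x, tpoly z x))"
    by (rule smooth_on_Pair[OF smooth_on_id smooth_tpoly[OF open_UNIV smooth_on_const smooth_on_id] open_UNIV])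
  have W: "open W"
    unfolding W_def
    by (rule open_preimage[OF smooth_on_continuous[OF smooth_on_subset[OF smg]]
          B.open_chart_image[OF fD(2)] E.open_chart_image[OF fD(1)]]) simp
  have zW: "fst z \<in> W" using xd val by (simp add: W_def)
  define V where "V = {y \<in> fst ?d. snd ?d y \<in> W}"
  have ps: "psec f z y \<in> fst ?c \<and> snd ?c (psec f z y) = (snd ?d y, tpoly z (snd ?d y))" if "y \<in> V" for y
  proof -
    have *: "(snd ?d y, tpoly z (snd ?d y)) \<in> snd ?c ` fst ?c" using that by (simp add: V_def W_def)
    show ?thesis unfolding psec_def using chart_inv_in[OF *] chart_chart_inv[OF *] by simp
  qed
  have sub: "W \<subseteq> snd ?d ` fst ?d" by (auto simp: W_def)
  have sm: "smooth_map (base P) V (total P) (psec f z)"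
    by (rule smooth_mapI_charts[OF B.smooth_atlas_axioms E.smooth_atlas_axioms fD(2,1) W sub V_def
          smooth_on_subset[OF smg subset_UNIV] ps])
  have op: "openin (mtop (base P)) V" by (rule B.openin_chartI[OF fD(2) W V_def])
  have pr: "proj P (psec f z y) = y" if "y \<in> V" for y
  proof -
    have "snd ?d (proj P (psec f z y)) = snd ?d y"
      using ps[OF that] fD(4)[of "psec f z y"] by simp
    then show ?thesis
    proof -
      have "y \<in> fst ?d" using that by (simp add: V_def)
      then show ?thesis
        using \<open>snd ?d (proj P (psec f z y)) = snd ?d y\<close> B.cinv[OF fD(2), of y]
          B.cinv[OF fD(2) fD(3)[OF conjunct1[OF ps[OF that]]]] by metis
    qed
  qed
  have qV: "q \<in> V" using qd q zW by (simp add: V_def)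
  show sec: "psec f z \<in> sections_at P q"
    unfolding sections_at_def using op qV sm pr by blast
  show pq: "psec f z q \<in> fst ?c" using ps[OF qV] by simp
  have lr: "local_rep f (psec f z) x = tpoly z x" if xW: "x \<in> W" for x
  proof -
    obtain y where y: "y \<in> fst ?d" "x = snd ?d y" using xW sub by blast
    then have "y \<in> V" using xW by (simp add: V_def)
    then have "snd ?c (psec f z y) = (x, tpoly z x)" using ps y(2) by simp
    then show ?thesis unfolding local_rep_def y(2) B.cinv[OF fD(2) y(1)] by simp
  qed
  then show "\<exists>W. open W \<and> fst z \<in> W \<and> (\<forall>x\<in>W. local_rep f (psec f z) x = tpoly z x)"
    using W zW by blast
  show "jcoord f q (psec f z) = z"
  proof (rule jcoord_eqI)
    show "snd z $ jx \<alpha> I = section_deriv f \<alpha> I (psec f z) q" if "mdeg I < CARD('s)" for \<alpha> I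
    proof -
      have "section_deriv f \<alpha> I (psec f z) q = mdiff I (\<lambda>x. tpoly z x $ \<alpha>) (fst z)"
        unfolding section_deriv_local_rep q
        by (rule mdiff_cong_open[OF W zW]) (simp add: lr)
      then show ?thesis using mdiff_tpoly[of I z \<alpha>] that by simp
    qed
  qed (simp add: q)
qed

lemma jet_chart_image:
  assumes f: "f \<in> fibred_charts P"
  defines "c \<equiv> jet_chart P f :: (_, ('n, 'm, 's::finite) jmodel) chart"
  shows "snd c ` fst c = jimage f"
  unfolding c_def
proof (intro equalityI subsetI)
  let ?c = "jet_chart P f :: (_, ('n, 'm, 's) jmodel) chart"
  fix z assume "z \<in> snd ?c ` fst ?c"
  then obtain p where p: "p \<in> fst ?c" "z = snd ?c p" by auto
  obtain q \<sigma> where s: "\<sigma> \<in> sections_at P q" "\<sigma> q \<in> fst (fst f)" "p = jet_of P (CARD('s) - 1) q \<sigma>" "snd ?c p = jcoord f q \<sigma>"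
    by (rule jet_chart_obtain[OF p(1)])
  have "snd (fst f) (\<sigma> q) = (fst z, \<chi> \<alpha>. snd z $ jx \<alpha> (\<lambda>_. 0))"
    by (rule section_value_jcoord[OF s(1) f s(2)]) (simp only: p(2) s(4))
  then show "z \<in> jimage f" unfolding jimage_def using imageI[OF s(2), of "snd (fst f)"] by simp
next
  let ?c = "jet_chart P f :: (_, ('n, 'm, 's) jmodel) chart"
  fix z :: "('n, 'm, 's) jmodel" assume "z \<in> jimage f"
  note ps = psec[OF f this]
  note j = jet_of_in_chart[OF ps(1) f ps(2), where 's = 's]
  show "z \<in> snd ?c ` fst ?c"
    using imageI[OF j(1), of "snd ?c"] unfolding j(2) ps(4) .
qed

text \<open>Derivatives of positive order are unrestricted, so the image is the preimage of an open set under a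
  linear map.\<close>

lemma jet_is_chart:
  assumes f: "f \<in> fibred_charts P"
  shows "is_chart (points (jet_manifold P :: (_, ('n, 'm, 's::finite) jmodel) mfd))
    (jet_chart P f :: (_, ('n, 'm, 's) jmodel) chart)"
  unfolding is_chart_def
proof (intro conjI)
  let ?c = "jet_chart P f :: (_, ('n, 'm, 's) jmodel) chart"
  show "fst ?c \<subseteq> points (jet_manifold P :: (_, ('n, 'm, 's) jmodel) mfd)"
    by (auto simp: jet_chart_def jet_manifold_def)
  show "inj_on (snd ?c) (fst ?c)"
  proof (rule inj_onI)
    fix p p' assume p: "p \<in> fst ?c" "p' \<in> fst ?c" "snd ?c p = snd ?c p'"
    obtain q \<sigma> where s: "\<sigma> \<in> sections_at P q" "\<sigma> q \<in> fst (fst f)" "p = jet_of P (CARD('s) - 1) q \<sigma>" "snd ?c p = jcoord f q \<sigma>"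
      by (rule jet_chart_obtain[OF p(1)])
    obtain q' \<sigma>' where s': "\<sigma>' \<in> sections_at P q'" "\<sigma>' q' \<in> fst (fst f)" "p' = jet_of P (CARD('s) - 1) q' \<sigma>'" "snd ?c p' = jcoord f q' \<sigma>'"
      by (rule jet_chart_obtain[OF p(2)])
    have "(jcoord f q \<sigma> :: ('n, 'm, 's) jmodel) = jcoord f q' \<sigma>'" using p s s' by simp
    from jcoord_inj[OF s(1) s'(1) f s(2) s'(2) this] show "p = p'"
      unfolding s(3) s'(3) by (simp add: jet_of_eqI)
  qed
  have "open (snd (fst f) ` fst (fst f))" by (rule E.open_chart_image[OF fibred_chartD(1)[OF f]])
  then show "open (snd ?c ` fst ?c)"
    unfolding jet_chart_image[OF f] jimage_def by (rule open_value_preimage)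
qed

lemma chart_inv_jet_chart:
  assumes f: "f \<in> fibred_charts P" and z: "(z :: ('n, 'm, 's::finite) jmodel) \<in> jimage f"
  shows "chart_inv (jet_chart P f) z = jet_of P (CARD('s) - 1) (chart_inv (snd f) (fst z)) (psec f z)"
proof -
  note ps = psec[OF f z]
  note j = jet_of_in_chart[OF ps(1) f ps(2), where 's = 's]
  show ?thesis
    using chart_inv_chart[OF jet_is_chart[OF f] j(1)] j(2) ps(4) by simp
qed

end

subsection \<open>Smoothness of the transition maps of jets\<close>

text \<open>The derivatives in \<open>x\<close> are derivatives of \<open>H\<close> itself in the directions \<open>(e\<^sub>i, 0)\<close>; so they are smooth in
  the parameters as well.\<close>

lemma foldr_pdiff_param:
  fixes H :: "(real^'n::finite) \<times> 'z::euclidean_space \<Rightarrow> real"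
  defines "D \<equiv> foldr (\<lambda>i F w. FD F w (axis i 1, 0))"
  assumes sm: "smooth_on \<Omega> H" and op: "open \<Omega>"
  shows "smooth_on \<Omega> (D is H)"
    and "(x, z) \<in> \<Omega> \<Longrightarrow> foldr pdiff is (\<lambda>x. H (x, z)) x = D is H (x, z)"
proof -
  show s: "smooth_on \<Omega> (D is H)" for "is"
    unfolding D_def by (induction "is") (auto intro: sm smooth_on_FD)
  show "foldr pdiff is (\<lambda>x. H (x, z)) x = D is H (x, z)" if "(x, z) \<in> \<Omega>"
    using that
  proof (induction "is" arbitrary: x)
    case Nil
    then show ?case by (simp add: D_def)
  next
    case (Cons i "is")
    let ?S = "{x. (x, z) \<in> \<Omega>}"
    have "open {x \<in> UNIV. (x, z) \<in> \<Omega>}"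
      by (rule open_preimage[OF _ open_UNIV op]) (intro continuous_intros)
    then have S: "open ?S" by simp
    have "pdiff i (foldr pdiff is (\<lambda>x. H (x, z))) x = pdiff i (\<lambda>x. D is H (x, z)) x"
      by (rule pdiff_cong_open[OF S]) (use Cons in auto)
    also have "\<dots> = FD (D is H) (x, z) (axis i 1, 0)"
    proof -
      have d: "((\<lambda>x. (x, z)) has_derivative (\<lambda>v. (v, 0))) (at x)"
        by (auto intro!: derivative_eq_intros)
      from FD_eq[OF has_derivative_compose[OF d smooth_on_has_derivative[OF s Cons.prems]]]
      show ?thesis by (simp add: pdiff_def)
    qed
    finally show ?case by (simp add: D_def)
  qed
qed

context fibred
begin

lemma jet_overlap_image:
  assumes f: "f \<in> fibred_charts P" and f': "f' \<in> fibred_charts P"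
  defines "c \<equiv> jet_chart P f :: (_, ('n, 'm, 's::finite) jmodel) chart" and "c' \<equiv> jet_chart P f' :: (_, ('n, 'm, 's) jmodel) chart"
  shows "snd c ` (fst c \<inter> fst c') =
    {z. (fst z, \<chi> \<alpha>. snd z $ jx \<alpha> (\<lambda>_. 0)) \<in> snd (fst f) ` (fst (fst f) \<inter> fst (fst f'))}"
proof -
  have "z \<in> snd c ` (fst c \<inter> fst c') \<longleftrightarrow> (fst z, \<chi> \<alpha>. snd z $ jx \<alpha> (\<lambda>_. 0)) \<in> snd (fst f) ` (fst (fst f) \<inter> fst (fst f'))"
    for z
  proof (cases "z \<in> jimage f")
    case False
    then have "z \<notin> snd c ` fst c" unfolding c_def jet_chart_image[OF f] .
    then have "z \<notin> snd c ` (fst c \<inter> fst c')" by blast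
    moreover have "(fst z, \<chi> \<alpha>. snd z $ jx \<alpha> (\<lambda>_. 0)) \<notin> snd (fst f) ` (fst (fst f) \<inter> fst (fst f'))"
      using False unfolding jimage_def by blast
    ultimately show ?thesis by blast
  next
    case True
    let ?q = "chart_inv (snd f) (fst z)" and ?w = "(fst z, \<chi> \<alpha>. snd z $ jx \<alpha> (\<lambda>_. 0))"
    note ps = psec[OF f True]
    have "z \<in> snd c ` (fst c \<inter> fst c') \<longleftrightarrow> z \<in> snd c ` fst c \<and> chart_inv c z \<in> fst c'"
      unfolding c_def chart_image_Int[OF jet_is_chart[OF f], of "fst c'"] by (simp only: mem_Collect_eq)
    also have "\<dots> \<longleftrightarrow> chart_inv c z \<in> fst c'"
      using True unfolding c_def jet_chart_image[OF f] by simp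
    also have "\<dots> \<longleftrightarrow> psec f z ?q \<in> fst (fst f')"
      unfolding c_def c'_def chart_inv_jet_chart[OF f True] by (rule jet_of_in_chart_iff[OF ps(1)])
    also have "\<dots> \<longleftrightarrow> ?w \<in> snd (fst f) ` (fst (fst f) \<inter> fst (fst f'))"
    proof -
      have w: "snd (fst f) (psec f z ?q) = ?w"
        by (rule section_value_jcoord[OF ps(1) f ps(2,4)])
      show ?thesis
      proof
        assume "psec f z ?q \<in> fst (fst f')"
        then show "?w \<in> snd (fst f) ` (fst (fst f) \<inter> fst (fst f'))"
          unfolding w[symmetric] using ps(2) by (intro imageI IntI)
      next
        assume "?w \<in> snd (fst f) ` (fst (fst f) \<inter> fst (fst f'))"
        then obtain e where e: "?w = snd (fst f) e" "e \<in> fst (fst f)" "e \<in> fst (fst f')" by blast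
        have "psec f z ?q = e"
          using arg_cong[OF trans[OF w e(1)], of "chart_inv (fst f)"]
          unfolding E.cinv[OF fibred_chartD(1)[OF f] ps(2)] E.cinv[OF fibred_chartD(1)[OF f] e(2)] .
        then show "psec f z ?q \<in> fst (fst f')" using e(3) by simp
      qed
    qed
    finally show ?thesis .
  qed
  then show ?thesis by (intro set_eqI) (simp only: mem_Collect_eq)
qed

lemma ctrans_jet_chart:
  assumes f: "f \<in> fibred_charts P" and f': "f' \<in> fibred_charts P"
    and \<sigma>: "\<sigma> \<in> sections_at P q" "\<sigma> q \<in> fst (fst f)" "\<sigma> q \<in> fst (fst f')"
  shows "ctrans (jet_chart P f) (jet_chart P f') (jcoord f q \<sigma> :: ('n, 'm, 's::finite) jmodel) =
    (jcoord f' q \<sigma> :: ('n, 'm, 's) jmodel)"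
proof -
  note j = jet_of_in_chart[OF \<sigma>(1) f \<sigma>(2), where 's = 's]
  have "chart_inv (jet_chart P f) (jcoord f q \<sigma> :: ('n, 'm, 's) jmodel) = jet_of P (CARD('s) - 1) q \<sigma>"
    using chart_inv_chart[OF jet_is_chart[OF f] j(1)] j(2) by simp
  then show ?thesis
    unfolding ctrans_def using jet_of_in_chart(2)[OF \<sigma>(1) f' \<sigma>(3)] by simp
qed

text \<open>In the new chart, the polynomial section with coefficients \<open>z\<close> is represented by a map that is smooth in
  its argument and in \<open>z\<close> together. The new jet coordinates are derivatives of this map in its argument.\<close>

lemma jet_smooth_transition:
  assumes f: "f \<in> fibred_charts P" and f': "f' \<in> fibred_charts P"
  shows "smooth_transition (jet_chart P f :: (_, ('n, 'm, 's::finite) jmodel) chart) (jet_chart P f')"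
proof -
  let ?c = "jet_chart P f :: (_, ('n, 'm, 's) jmodel) chart" and ?c' = "jet_chart P f' :: (_, ('n, 'm, 's) jmodel) chart"
  note fD = fibred_chartD[OF f] and fD' = fibred_chartD[OF f']
  let ?h = "ctrans (snd f') (snd f)" and ?g = "ctrans (snd f) (snd f')" and ?\<Phi> = "ctrans (fst f) (fst f')"
  let ?T = "snd (fst f) ` (fst (fst f) \<inter> fst (fst f'))"
  let ?D = "snd (snd f') ` (fst (snd f') \<inter> fst (snd f))" and ?D' = "snd (snd f) ` (fst (snd f) \<inter> fst (snd f'))"
  define O' where "O' = snd ?c ` (fst ?c \<inter> fst ?c')"
  note trE = E.charts_transition[OF fD(1) fD'(1)]
  note trB = B.charts_transition[OF fD'(2) fD(2)] and trB' = B.charts_transition[OF fD(2) fD'(2)]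
  have O'_eq: "O' = {z. (fst z, \<chi> \<alpha>. snd z $ jx \<alpha> (\<lambda>_. 0)) \<in> ?T}"
    unfolding O'_def by (rule jet_overlap_image[OF f f'])
  have O': "open O'" unfolding O'_eq by (rule open_value_preimage[OF trE(1)])
  define \<Omega> where "\<Omega> = {w :: (real^'n) \<times> ('n, 'm, 's) jmodel. w \<in> ?D \<times> UNIV \<and> (?h (fst w), tpoly (snd w) (?h (fst w))) \<in> ?T}"
  have opD: "open (?D \<times> (UNIV :: ('n, 'm, 's) jmodel set))" by (rule open_Times[OF trB(1) open_UNIV])
  have smh: "smooth_on (?D \<times> (UNIV :: ('n, 'm, 's) jmodel set)) (\<lambda>w. ?h (fst w))"
    by (rule smooth_on_compose[OF trB(2) smooth_on_fst[OF smooth_on_id opD] opD]) auto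
  have smP: "smooth_on (?D \<times> (UNIV :: ('n, 'm, 's) jmodel set)) (\<lambda>w. (?h (fst w), tpoly (snd w) (?h (fst w))))"
    by (rule smooth_on_Pair[OF smh smooth_tpoly[OF opD smooth_on_snd[OF smooth_on_id opD] smh] opD])
  have \<Omega>: "open \<Omega>"
    using open_preimage[OF smooth_on_continuous[OF smP] opD trE(1)] by (simp add: \<Omega>_def)
  define H where "H \<alpha> w = snd (?\<Phi> (?h (fst w), tpoly (snd w) (?h (fst w)))) $ \<alpha>" for \<alpha> and w :: "(real^'n) \<times> ('n, 'm, 's) jmodel"
  have smH: "smooth_on \<Omega> (H \<alpha>)" for \<alpha>
  proof -
    have "smooth_on \<Omega> (\<lambda>w. ?\<Phi> (?h (fst w), tpoly (snd w) (?h (fst w))))"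
      by (rule smooth_on_compose[OF trE(2) smooth_on_subset[OF smP] \<Omega>]) (auto simp: \<Omega>_def)
    from smooth_on_nth[OF smooth_on_snd[OF this \<Omega>] \<Omega>] show ?thesis by (simp add: H_def[abs_def])
  qed
  define D where "D = foldr (\<lambda>i F (w :: (real^'n) \<times> ('n, 'm, 's) jmodel). FD F w (axis i 1, 0) :: real)"
  define js where "js I = (SOME is. \<forall>i. count_list is i = I i)" for I :: "'n \<Rightarrow> nat"
  \<comment> \<open>the expression of the transition map, through the derivatives of the polynomial sections\<close>
  define Fc where "Fc A z = (case Rep_jidx A of (\<alpha>, I) \<Rightarrow> D (js I) (H \<alpha>) (?g (fst z), z))"
    for A :: "('m, 'n, 's) jidx" and z :: "('n, 'm, 's) jmodel"
  define F where "F z = (?g (fst z), \<chi> A. Fc A z)" for z :: "('n, 'm, 's) jmodel"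
  have base: "chart_inv (snd f) (fst z) \<in> fst (snd f)" "chart_inv (snd f) (fst z) \<in> fst (snd f')"
      "fst z = snd (snd f) (chart_inv (snd f) (fst z))" "?g (fst z) = snd (snd f') (chart_inv (snd f) (fst z))"
      "(?g (fst z), z) \<in> \<Omega>" if z: "z \<in> O'" for z
  proof -
    obtain e where e: "e \<in> fst (fst f)" "e \<in> fst (fst f')" "snd (fst f) e = (fst z, \<chi> \<alpha>. snd z $ jx \<alpha> (\<lambda>_. 0))"
      using z unfolding O'_eq by auto
    have pe: "proj P e \<in> fst (snd f)" "snd (snd f) (proj P e) = fst z" "proj P e \<in> fst (snd f')"
      using fD(3,4)[OF e(1)] fD'(3)[OF e(2)] e(3) by auto
    then have q: "chart_inv (snd f) (fst z) = proj P e" using B.cinv[OF fD(2) pe(1)] by simp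
    show 1: "chart_inv (snd f) (fst z) \<in> fst (snd f)" "chart_inv (snd f) (fst z) \<in> fst (snd f')"
      "fst z = snd (snd f) (chart_inv (snd f) (fst z))" "?g (fst z) = snd (snd f') (chart_inv (snd f) (fst z))"
      using pe B.ctrans_chart[OF fD(2) pe(1), of "snd f'"] by (simp_all add: q)
    have h: "?h (?g (fst z)) = fst z"
      using B.ctrans_chart[OF fD'(2) 1(2), of "snd f"] 1(3,4) by simp
    have "?g (fst z) \<in> ?D" unfolding 1(4) using 1(1,2) by blast
    then show "(?g (fst z), z) \<in> \<Omega>"
      using e(1,2) unfolding \<Omega>_def by (simp add: h tpoly_center e(3)[symmetric])
  qed
  have gO: "(\<lambda>z. fst z) ` O' \<subseteq> ?D'"
  proof (rule image_subsetI)
    fix z assume "z \<in> O'"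
    from base(1-3)[OF this] show "fst z \<in> ?D'" by (metis IntI imageI)
  qed
  have smg: "smooth_on O' (\<lambda>z. ?g (fst z))"
    by (rule smooth_on_compose[OF trB'(2) smooth_on_fst[OF smooth_on_id O'] O' gO])
  have smF: "smooth_on O' F"
  proof -
    have A: "smooth_on O' (Fc A)" for A
    proof -
      obtain \<alpha> I where A: "Rep_jidx A = (\<alpha>, I)" by (cases "Rep_jidx A")
      have "smooth_on O' (\<lambda>z. D (js I) (H \<alpha>) (?g (fst z), z))"
      proof (rule smooth_on_compose[OF _ smooth_on_Pair[OF smg smooth_on_id O'] O'])
        show "smooth_on \<Omega> (D (js I) (H \<alpha>))"
          unfolding D_def by (rule foldr_pdiff_param(1)[OF smH \<Omega>])
      qed (use base(5) in blast)
      then show ?thesis by (simp add: A Fc_def[abs_def])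
    qed
    show ?thesis unfolding F_def[abs_def] by (rule smooth_on_Pair[OF smg smooth_on_vec[OF A O'] O'])
  qed
  have eqF: "F z = (snd ?c' \<circ> chart_inv ?c) z" if z: "z \<in> O'" for z
  proof -
    have zj: "z \<in> jimage f" using z unfolding O'_eq jimage_def by blast
    note ps = psec[OF f zj]
    let ?q = "chart_inv (snd f) (fst z)" and ?\<sigma> = "psec f z"
    have ov: "?\<sigma> ?q \<in> fst (fst f')"
    proof -
      have "chart_inv ?c z \<in> fst ?c'"
        using z chart_image_Int[OF jet_is_chart[OF f], of "fst ?c'"] unfolding O'_def by blast
      then show ?thesis
        unfolding chart_inv_jet_chart[OF f zj] using jet_of_in_chart_iff[OF ps(1)] by blast
    qed
    have "(snd ?c' \<circ> chart_inv ?c) z = jcoord f' ?q ?\<sigma>"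
      unfolding o_def chart_inv_jet_chart[OF f zj] by (rule jet_of_in_chart(2)[OF ps(1) f' ov])
    also have "\<dots> = F z"
    proof (rule jcoord_eqI)
      show "fst (F z) = snd (snd f') ?q" by (simp add: F_def base(4)[OF z])
      fix \<alpha> and I :: "'n \<Rightarrow> nat" assume I: "mdeg I < CARD('s)"
      obtain S where S: "open S" "snd (snd f') ?q \<in> S" "S \<subseteq> ?D"
        "smooth_on S (\<lambda>x. local_rep f ?\<sigma> (?h x))"
        "\<forall>x\<in>S. (?h x, local_rep f ?\<sigma> (?h x)) \<in> ?T \<and> local_rep f' ?\<sigma> x = snd (?\<Phi> (?h x, local_rep f ?\<sigma> (?h x)))"
        by (rule section_change[OF ps(1) f ps(2) f' ov])
      obtain W where W: "open W" "fst z \<in> W" "\<forall>x\<in>W. local_rep f ?\<sigma> x = tpoly z x"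
        using ps(5) by blast
      define S' where "S' = {x \<in> S. ?h x \<in> W}"
      have S': "open S'"
        unfolding S'_def by (rule open_preimage[OF smooth_on_continuous[OF smooth_on_subset[OF trB(2) S(3)]] S(1) W(1)])
      have hq: "?h (snd (snd f') ?q) = fst z"
        using B.ctrans_chart[OF fD'(2) base(2)[OF z], of "snd f"] base(3)[OF z] by simp
      have xS': "snd (snd f') ?q \<in> S'" using S(2) W(2) hq by (simp add: S'_def)
      have "section_deriv f' \<alpha> I ?\<sigma> ?q = mdiff I (\<lambda>x. H \<alpha> (x, z)) (snd (snd f') ?q)"
        unfolding section_deriv_local_rep
      proof (rule mdiff_cong_open[OF S' xS'])
        fix x assume "x \<in> S'"
        then have "x \<in> S" "?h x \<in> W" by (auto simp: S'_def)
        then show "local_rep f' ?\<sigma> x $ \<alpha> = H \<alpha> (x, z)"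
          using bspec[OF S(5), of x] bspec[OF W(3), of "?h x"] by (simp add: H_def)
      qed
      also have "\<dots> = D (js I) (H \<alpha>) (?g (fst z), z)"
        unfolding mdiff_def js_def[symmetric] base(4)[OF z, symmetric] D_def
        by (rule foldr_pdiff_param(2)[OF smH \<Omega> base(5)[OF z]])
      finally show "snd (F z) $ jx \<alpha> I = section_deriv f' \<alpha> I ?\<sigma> ?q"
        by (simp add: F_def Fc_def Rep_jidx_jx[OF I])
    qed
    finally show ?thesis by simp
  qed
  have "smooth_on O' (snd ?c' \<circ> chart_inv ?c)"
    by (rule smooth_on_cong[OF smF O' eqF])
  then show ?thesis
    unfolding smooth_transition_def using O' unfolding O'_def by blast
qed

lemma jet_atlas: "smooth_atlas (jet_manifold P :: (('q, 'e) jet, ('n, 'm, 's::finite) jmodel) mfd)"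
proof
  let ?M = "jet_manifold P :: (('q, 'e) jet, ('n, 'm, 's) jmodel) mfd"
  have at: "atlas ?M = jet_chart P ` fibred_charts P" and pt: "points ?M = jet_space P (CARD('s) - 1)"
    by (simp_all add: jet_manifold_def)
  show "\<Union> (fst ` atlas ?M) = points ?M"
  proof (intro equalityI subsetI)
    fix p assume "p \<in> \<Union> (fst ` atlas ?M)"
    then obtain f where "p \<in> fst (jet_chart P f :: (_, ('n, 'm, 's) jmodel) chart)"
      unfolding at by blast
    then show "p \<in> points ?M" unfolding pt by (simp add: jet_chart_def)
  next
    fix p assume "p \<in> points ?M"
    then have p: "p \<in> jet_space P (CARD('s) - 1)" by (simp add: pt)
    obtain f where f: "f \<in> fibred_charts P" "jet_rep p (fst p) \<in> fst (fst f)"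
      using ex_fibred_chart[OF section_points(1)[OF jet_spaceD(1)[OF p]]] by blast
    have "p \<in> fst (jet_chart P f :: (_, ('n, 'm, 's) jmodel) chart)" using p f(2) by (simp add: jet_chart_def)
    then show "p \<in> \<Union> (fst ` atlas ?M)" unfolding at using f(1) by blast
  qed
  show "is_chart (points ?M) c" if c: "c \<in> atlas ?M" for c
  proof -
    obtain f where "f \<in> fibred_charts P" "c = jet_chart P f" using c unfolding at by blast
    then show ?thesis using jet_is_chart by simp
  qed
  show "smooth_transition c d" if c: "c \<in> atlas ?M" "d \<in> atlas ?M" for c d
  proof -
    obtain f f' where f: "f \<in> fibred_charts P" "c = jet_chart P f" "f' \<in> fibred_charts P" "d = jet_chart P f'"
      using c unfolding at by blast
    show ?thesis unfolding f(2,4) by (rule jet_smooth_transition[OF f(1,3)])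
  qed
qed

end

section \<open>The contact forms in jet coordinates\<close>

lemma mdeg_less_option: "mdeg I < CARD('k::finite) \<Longrightarrow> mdeg I < CARD('k option)"
  by simp

lemma mdeg_madd_less_option: "mdeg I < CARD('k::finite) \<Longrightarrow> mdeg (madd I i) < CARD('k option)"
  by simp

lemma mindices_card: "mindices (CARD('k::finite) - 1) = {I :: 'n::finite \<Rightarrow> nat. mdeg I < CARD('k)}"
proof -
  have "mdeg I \<le> CARD('k) - 1 \<longleftrightarrow> mdeg I < CARD('k)" for I :: "'n \<Rightarrow> nat"
    using zero_less_card_finite[where 'a = 'k] by linarith
  then show ?thesis by (simp add: mindices_def)
qed

lemma finite_le_index: "finite {I :: 'n::finite \<Rightarrow> nat. I \<le> J}"
  by (rule finite_subset[OF _ finite_mindices[of "mdeg J"]]) (auto simp: mindices_def mdeg_mono)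

lemma finite_ge_index [simp]: "finite {L :: 'n::finite \<Rightarrow> nat. J \<le> L \<and> mdeg L < s}"
  by (rule finite_subset[OF _ finite_mdeg_less[of s]]) auto

lemma FD_pdiff:
  fixes f :: "real^'n::finite \<Rightarrow> real"
  assumes "f differentiable (at x)"
  shows "FD f x h = (\<Sum>i\<in>UNIV. h $ i * pdiff i f x)"
proof -
  have "h = (\<Sum>i\<in>UNIV. h $ i *\<^sub>R axis i 1)"
    using vec_lambda_sum_axis[of "\<lambda>i. h $ i"] by simp
  then have "FD f x h = FD f x (\<Sum>i\<in>UNIV. h $ i *\<^sub>R axis i 1)" by simp
  then show ?thesis
    using FD_linear[OF assms] by (simp add: linear_sum linear_cmul pdiff_def)
qed

text \<open>The projection to the jets of order \<open>r - 1\<close>, in coordinates.\<close>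

definition jproj :: "('n::finite, 'm::finite, 'k::finite option) jmodel \<Rightarrow> ('n, 'm, 'k) jmodel" where
  "jproj z = (fst z, \<chi> A. case Rep_jidx A of (\<alpha>, I) \<Rightarrow> snd z $ jx \<alpha> I)"

lemma fst_jproj [simp]: "fst (jproj z) = fst z"
  by (simp add: jproj_def)

lemma jproj_nth [simp]:
  "mdeg I < CARD('k::finite) \<Longrightarrow>
    snd (jproj z :: ('n::finite, 'm::finite, 'k) jmodel) $ jx \<alpha> I = snd z $ jx \<alpha> I"
  by (simp add: jproj_def Rep_jidx_jx)

lemma linear_jproj: "linear jproj"
  by (rule linearI) (auto simp: jproj_def vec_eq_iff split: prod.split)

lemma jmodel_eqI:
  fixes z :: "('n::finite, 'm::finite, 's::finite) jmodel"
  assumes "fst z = fst z'" "\<And>\<alpha> I. mdeg I < CARD('s) \<Longrightarrow> snd z $ jx \<alpha> I = snd z' $ jx \<alpha> I"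
  shows "z = z'"
proof -
  have "snd z $ A = snd z' $ A" for A
  proof -
    obtain \<alpha> I where "A = jx \<alpha> I" "mdeg I < CARD('s)" by (rule jidx_cases)
    then show ?thesis using assms(2) by simp
  qed
  then show ?thesis using assms(1) by (simp add: prod_eq_iff vec_eq_iff)
qed

text \<open>The value of \<open>\<theta>\<^sup>\<alpha>\<^sub>I\<close> at the point with coordinates \<open>z\<close>. The name \<open>madd I i\<close> is a label of a coordinate only
  if \<open>I\<close> is below the top order.\<close>

definition ctheta :: "'m \<Rightarrow> ('n \<Rightarrow> nat) \<Rightarrow> ('n::finite, 'm::finite, 's::finite) jmodel \<Rightarrow> ('n, 'm, 's) jmodel \<Rightarrow> real" where
  "ctheta \<alpha> I z v = snd v $ jx \<alpha> I - (\<Sum>i\<in>UNIV. snd z $ jx \<alpha> (madd I i) * fst v $ i)"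

lemma linear_ctheta: "linear (ctheta \<alpha> I z)"
  by (rule linearI) (simp_all add: ctheta_def algebra_simps sum.distrib sum_distrib_left)

lemma ctheta_vertical: "fst v = 0 \<Longrightarrow> ctheta \<alpha> I z v = snd v $ jx \<alpha> I"
  by (simp add: ctheta_def)

lemma smooth_ctheta: "open S \<Longrightarrow> smooth_on S (\<lambda>z. ctheta \<alpha> I z v)"
  unfolding ctheta_def
  by (rule smooth_on_diff[OF smooth_on_const smooth_on_sum[OF smooth_on_mult[OF
        smooth_on_nth[OF smooth_on_snd[OF smooth_on_id]] smooth_on_const]]])

text \<open>The vertical part of \<open>v\<close> with respect to the Cartan distribution: it has the same values
  under the contact forms, and no components in the directions \<open>x\<^sup>i\<close> and \<open>u\<^sup>\<alpha>\<^sub>I\<close>, \<open>|I| = r\<close>.\<close>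

definition cvert :: "('n::finite, 'm::finite, 'k::finite option) jmodel \<Rightarrow>
    ('n, 'm, 'k option) jmodel \<Rightarrow> ('n, 'm, 'k option) jmodel" where
  "cvert z v = (0, \<chi> A. case Rep_jidx A of (\<alpha>, I) \<Rightarrow> if mdeg I < CARD('k) then ctheta \<alpha> I z v else 0)"

lemma fst_cvert [simp]: "fst (cvert z v) = 0"
  by (simp add: cvert_def)

lemma cvert_nth [simp]:
  "mdeg I < CARD('k::finite option) \<Longrightarrow>
    snd (cvert z v :: ('n::finite, 'm::finite, 'k option) jmodel) $ jx \<alpha> I =
      (if mdeg I < CARD('k) then ctheta \<alpha> I z v else 0)"
  unfolding cvert_def by (simp only: snd_conv vec_lambda_beta Rep_jidx_jx prod.case)

lemma linear_cvert: "linear (cvert z)"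
proof -
  have *: "ctheta \<alpha> I z (v + w) = ctheta \<alpha> I z v + ctheta \<alpha> I z w"
    "ctheta \<alpha> I z (c *\<^sub>R v) = c * ctheta \<alpha> I z v" for \<alpha> I v w c
    using linear_ctheta[of \<alpha> I z] by (simp_all add: linear_add linear_cmul)
  show ?thesis
    by (rule linearI) (auto simp: cvert_def vec_eq_iff * split: prod.split)
qed

lemma smooth_cvert: "open S \<Longrightarrow> smooth_on S (\<lambda>z. cvert z v)"
  for v :: "('n::finite, 'm::finite, 'k::finite option) jmodel"
proof -
  assume S: "open S"
  have "smooth_on S (\<lambda>z. case Rep_jidx A of (\<alpha>, I) \<Rightarrow> if mdeg I < CARD('k) then ctheta \<alpha> I z v else 0)"
    for A :: "('m, 'n, 'k option) jidx"
    by (cases "Rep_jidx A"; cases "mdeg (snd (Rep_jidx A)) < CARD('k)") (simp_all add: smooth_ctheta[OF S])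
  then show ?thesis
    unfolding cvert_def by (intro smooth_on_Pair[OF smooth_on_const smooth_on_vec[OF _ S] S])
qed

lemma ctheta_cvert:
  fixes z v :: "('n::finite, 'm::finite, 'k::finite option) jmodel"
  assumes "mdeg I < CARD('k)"
  shows "ctheta \<alpha> I z (cvert z v) = ctheta \<alpha> I z v"
  using assms cvert_nth[OF mdeg_less_option[OF assms], where \<alpha> = \<alpha> and z = z and v = v] by (simp add: ctheta_vertical)

lemma cvert_eq_0_iff:
  fixes z v :: "('n::finite, 'm::finite, 'k::finite option) jmodel"
  shows "cvert z v = 0 \<longleftrightarrow> (\<forall>\<alpha> I. mdeg I < CARD('k) \<longrightarrow> ctheta \<alpha> I z v = 0)"
proof
  assume 0: "cvert z v = 0"
  show "\<forall>\<alpha> I. mdeg I < CARD('k) \<longrightarrow> ctheta \<alpha> I z v = 0"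
  proof (intro allI impI)
    fix \<alpha> and I :: "'n \<Rightarrow> nat" assume I: "mdeg I < CARD('k)"
    show "ctheta \<alpha> I z v = 0"
      using cvert_nth[OF mdeg_less_option[OF I], where \<alpha> = \<alpha> and z = z and v = v] I 0 by simp
  qed
next
  assume "\<forall>\<alpha> I. mdeg I < CARD('k) \<longrightarrow> ctheta \<alpha> I z v = 0"
  then show "cvert z v = 0" by (intro jmodel_eqI) (simp_all del: card_option)
qed

lemma jproj_cvert_eq_0_iff: "jproj (cvert z v) = 0 \<longleftrightarrow> cvert z v = 0"
  for z v :: "('n::finite, 'm::finite, 'k::finite option) jmodel"
proof
  assume 0: "jproj (cvert z v) = 0"
  have "ctheta \<alpha> I z v = 0" if I: "mdeg I < CARD('k)" for \<alpha> I
    using jproj_nth[OF I, of "cvert z v" \<alpha>] cvert_nth[OF mdeg_less_option[OF I], where \<alpha> = \<alpha> and z = z and v = v] I 0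
    by simp
  then show "cvert z v = 0" by (simp add: cvert_eq_0_iff)
qed (simp add: linear_0[OF linear_jproj])

text \<open>The total derivative in the direction \<open>x\<^sup>k\<close>. Its components of top order would involve jets of
  order \<open>r + 1\<close>; they are set to zero, which amounts to differentiating along a polynomial section of degree at
  most \<open>r\<close>.\<close>

definition tderiv :: "'n \<Rightarrow> ('n::finite, 'm::finite, 'k::finite option) jmodel \<Rightarrow> ('n, 'm, 'k option) jmodel" where
  "tderiv k z = (axis k 1, \<chi> A. case Rep_jidx A of (\<alpha>, I) \<Rightarrow> if mdeg I < CARD('k) then snd z $ jx \<alpha> (madd I k) else 0)"

lemma tderiv_nth:
  "mdeg I < CARD('k::finite option) \<Longrightarrow>
    snd (tderiv k z :: ('n::finite, 'm::finite, 'k option) jmodel) $ jx \<alpha> I =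
      (if mdeg I < CARD('k) then snd z $ jx \<alpha> (madd I k) else 0)"
  unfolding tderiv_def by (simp only: snd_conv vec_lambda_beta Rep_jidx_jx prod.case)

text \<open>The contact forms vanish on the total derivatives; so after their subtraction the components below the
  top order are the values of the contact forms.\<close>

lemma jproj_horizontal:
  fixes z v :: "('n::finite, 'm::finite, 'k::finite option) jmodel"
  defines "w \<equiv> v - (\<Sum>k\<in>UNIV. fst v $ k *\<^sub>R tderiv k z)"
  shows "fst w = 0" "jproj w = jproj (cvert z v)"
proof -
  show f: "fst w = 0"
    using vec_lambda_sum_axis[of "\<lambda>k. fst v $ k"] by (simp add: w_def fst_sum tderiv_def)
  show "jproj w = jproj (cvert z v)"
  proof (rule jmodel_eqI)
    fix \<alpha> and I :: "'n \<Rightarrow> nat" assume I: "mdeg I < CARD('k)"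
    have "snd w $ jx \<alpha> I = ctheta \<alpha> I z v"
      using I tderiv_nth[OF mdeg_less_option[OF I], where \<alpha> = \<alpha> and z = z]
      by (simp add: w_def snd_sum ctheta_def mult.commute)
    then show "snd (jproj w) $ jx \<alpha> I = snd (jproj (cvert z v)) $ jx \<alpha> I"
      using I cvert_nth[OF mdeg_less_option[OF I], where \<alpha> = \<alpha> and z = z and v = v] by simp
  qed (simp add: f)
qed


section \<open>The form \<open>\<eta>\<close> in jet coordinates\<close>

definition ccoef :: "('n::finite \<Rightarrow> nat) \<Rightarrow> ('n \<Rightarrow> nat) \<Rightarrow> real^'n \<Rightarrow> real" where
  "ccoef J L x = (- 1) ^ mdeg (L - J) * dmon (L - J) x"

lemma ccoef_self [simp]: "ccoef J J x = 1"
proof -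
  have "J - J = (\<lambda>_. 0)" by auto
  then show ?thesis by (simp add: ccoef_def mdeg_def)
qed

lemma smooth_ccoef: "open S \<Longrightarrow> smooth_on S (ccoef J L)"
  unfolding ccoef_def[abs_def] by (rule smooth_on_mult[OF smooth_on_const smooth_on_dmon])

lemma FD_ccoef:
  assumes "J \<le> L"
  shows "FD (ccoef J L) x h = - (\<Sum>i\<in>UNIV. if J i < L i then h $ i * ccoef J (L(i := L i - 1)) x else 0)"
proof -
  have sm: "dmon (L - J) differentiable (at x)"
    using smooth_on_differentiable[OF smooth_on_dmon[OF open_UNIV]] by auto
  have "(ccoef J L has_derivative (\<lambda>h. (- 1) ^ mdeg (L - J) * FD (dmon (L - J)) x h)) (at x)"
    unfolding ccoef_def[abs_def] by (rule has_derivative_mult_right[OF FD_works[OF sm]])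
  then have "FD (ccoef J L) x h = (- 1) ^ mdeg (L - J) * FD (dmon (L - J)) x h"
    by (rule FD_eq[THEN fun_cong])
  also have "\<dots> = (\<Sum>i\<in>UNIV. (- 1) ^ mdeg (L - J) * (h $ i * pdiff i (dmon (L - J)) x))"
    unfolding FD_pdiff[OF sm] sum_distrib_left ..
  also have "\<dots> = (\<Sum>i\<in>UNIV. - (if J i < L i then h $ i * ccoef J (L(i := L i - 1)) x else 0))"
  proof (rule sum.cong[OF refl])
    fix i
    show "(- 1) ^ mdeg (L - J) * (h $ i * pdiff i (dmon (L - J)) x)
        = - (if J i < L i then h $ i * ccoef J (L(i := L i - 1)) x else 0)"
    proof (cases "J i < L i")
      case True
      let ?L = "L(i := L i - 1)"
      have e: "(L - J)(i := (L - J) i - 1) = ?L - J" by (auto simp: fun_eq_iff)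
      have "L - J = madd (?L - J) i" using True by (auto simp: madd_def fun_eq_iff)
      then have "mdeg (L - J) = Suc (mdeg (?L - J))" using mdeg_madd by metis
      then show ?thesis using True by (simp add: pdiff_dmon e[simplified] ccoef_def)
    qed (use assms in \<open>simp add: pdiff_dmon\<close>)
  qed
  finally show ?thesis by (simp add: sum_negf)
qed

text \<open>The expression of \<open>\<eta>\<close> in jet coordinates.\<close>

definition ceta :: "('n::finite, 'm::finite, 'k::finite option) jmodel \<Rightarrow> ('n, 'm, 'k option) jmodel \<Rightarrow>
    real^('m, 'n, 'k) jidx" where
  "ceta z v = (\<chi> A. case Rep_jidx A of (\<alpha>, J) \<Rightarrow>
     \<Sum>L | J \<le> L \<and> mdeg L < CARD('k). ccoef J L (fst z) * ctheta \<alpha> L z v)"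

lemma ceta_nth:
  assumes "mdeg J < CARD('k::finite)"
  shows "(ceta z v :: real^('m::finite, 'n::finite, 'k) jidx) $ jx \<alpha> J =
     (\<Sum>L | J \<le> L \<and> mdeg L < CARD('k). ccoef J L (fst z) * ctheta \<alpha> L z v)"
  using assms by (simp add: ceta_def Rep_jidx_jx)

lemma linear_ceta: "linear (ceta z)"
proof -
  have *: "ctheta \<alpha> I z (v + w) = ctheta \<alpha> I z v + ctheta \<alpha> I z w"
    "ctheta \<alpha> I z (c *\<^sub>R v) = c * ctheta \<alpha> I z v" for \<alpha> I v w c
    using linear_ctheta[of \<alpha> I z] by (simp_all add: linear_add linear_cmul)
  show ?thesis
    by (rule linearI)
      (auto simp: ceta_def vec_eq_iff * algebra_simps sum.distrib sum_distrib_left split: prod.split)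
qed

lemma smooth_ceta: "open S \<Longrightarrow> smooth_on S (\<lambda>z. ceta z v)"
  for v :: "('n::finite, 'm::finite, 'k::finite option) jmodel"
proof -
  assume S: "open S"
  have "smooth_on S (\<lambda>z. ccoef J L (fst z) * ctheta \<alpha> L z v)" for J L \<alpha>
    by (rule smooth_on_mult[OF smooth_on_compose[OF smooth_ccoef[OF open_UNIV]
            smooth_on_fst[OF smooth_on_id S] S subset_UNIV] smooth_ctheta[OF S] S])
  then have "smooth_on S (\<lambda>z. \<Sum>L | J \<le> L \<and> mdeg L < CARD('k). ccoef J L (fst z) * ctheta \<alpha> L z v)" for J \<alpha>
    by (rule smooth_on_sum[OF _ S])
  then have A: "smooth_on S (\<lambda>z. case Rep_jidx A of (\<alpha>, J) \<Rightarrow>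
     \<Sum>L | J \<le> L \<and> mdeg L < CARD('k). ccoef J L (fst z) * ctheta \<alpha> L z v)" for A :: "('m, 'n, 'k) jidx"
    by (cases "Rep_jidx A") simp
  show ?thesis
    unfolding ceta_def by (rule smooth_on_vec[OF A S])
qed

text \<open>The contact forms are recovered from \<open>\<eta>\<close>, because the two triangular systems of coefficients are
  inverse to each other.\<close>

lemma ctheta_from_ceta:
  fixes z v :: "('n::finite, 'm::finite, 'k::finite option) jmodel"
  assumes I: "mdeg I < CARD('k)"
  shows "(\<Sum>J | I \<le> J \<and> mdeg J < CARD('k). dmon (J - I) (fst z) * ceta z v $ jx \<alpha> J) = ctheta \<alpha> I z v"
proof -
  let ?U = "\<lambda>J. {L. J \<le> L \<and> mdeg L < CARD('k)}"
  have "(\<Sum>J\<in>?U I. dmon (J - I) (fst z) * ceta z v $ jx \<alpha> J)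
      = (\<Sum>J\<in>?U I. \<Sum>L\<in>?U J. ccoef J L (fst z) * dmon (J - I) (fst z) * ctheta \<alpha> L z v)"
    by (intro sum.cong) (auto simp: ceta_nth sum_distrib_left mult_ac)
  also have "\<dots> = (\<Sum>J\<in>?U I. \<Sum>L\<in>?U I. if J \<le> L then ccoef J L (fst z) * dmon (J - I) (fst z) * ctheta \<alpha> L z v else 0)"
  proof (rule sum.cong[OF refl])
    fix J assume "J \<in> ?U I"
    then have "?U J = {L \<in> ?U I. J \<le> L}" by auto
    then show "(\<Sum>L\<in>?U J. ccoef J L (fst z) * dmon (J - I) (fst z) * ctheta \<alpha> L z v) =
      (\<Sum>L\<in>?U I. if J \<le> L then ccoef J L (fst z) * dmon (J - I) (fst z) * ctheta \<alpha> L z v else 0)"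
      by (simp only: sum.inter_filter[OF finite_ge_index])
  qed
  also have "\<dots> = (\<Sum>L\<in>?U I. \<Sum>J\<in>?U I. if J \<le> L then ccoef J L (fst z) * dmon (J - I) (fst z) * ctheta \<alpha> L z v else 0)"
    by (rule sum.swap)
  also have "\<dots> = (\<Sum>L\<in>?U I. if L = I then ctheta \<alpha> I z v else 0)"
  proof (rule sum.cong[OF refl])
    fix L assume L: "L \<in> ?U I"
    have S: "{J \<in> ?U I. J \<le> L} = {J. I \<le> J \<and> J \<le> L}"
      using L mdeg_mono by (auto intro: le_less_trans)
    have "(\<Sum>J\<in>?U I. if J \<le> L then ccoef J L (fst z) * dmon (J - I) (fst z) * ctheta \<alpha> L z v else 0)
       = (\<Sum>J | I \<le> J \<and> J \<le> L. (- 1) ^ mdeg (L - J) * dmon (L - J) (fst z) * dmon (J - I) (fst z)) * ctheta \<alpha> L z v"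
      unfolding sum.inter_filter[OF finite_ge_index, symmetric] S sum_distrib_right ccoef_def ..
    also have "\<dots> = (if L = I then ctheta \<alpha> I z v else 0)"
      using dmon_convolution[of I L "fst z"] L by auto
    finally show "(\<Sum>J\<in>?U I. if J \<le> L then ccoef J L (fst z) * dmon (J - I) (fst z) * ctheta \<alpha> L z v else 0)
       = (if L = I then ctheta \<alpha> I z v else 0)" .
  qed
  also have "\<dots> = ctheta \<alpha> I z v" using I by simp
  finally show ?thesis .
qed

lemma ceta_eq_0_iff: "ceta z v = 0 \<longleftrightarrow> cvert z v = 0"
  for z v :: "('n::finite, 'm::finite, 'k::finite option) jmodel"
proof
  assume 0: "ceta z v = 0"
  have "ctheta \<alpha> I z v = 0" if I: "mdeg I < CARD('k)" for \<alpha> I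
    using ctheta_from_ceta[OF I, where z = z and v = v and \<alpha> = \<alpha>] by (simp add: 0)
  then show "cvert z v = 0" by (simp add: cvert_eq_0_iff)
next
  assume "cvert z v = 0"
  then have t: "ctheta \<alpha> I z v = 0" if "mdeg I < CARD('k)" for \<alpha> I using that by (simp add: cvert_eq_0_iff)
  show "ceta z v = 0"
    by (auto simp: ceta_def vec_eq_iff t split: prod.split intro!: sum.neutral)
qed

subsection \<open>The exterior derivative of \<open>\<eta>\<close>\<close>

text \<open>Summation by parts over multi-indices: \<open>L\<close> and \<open>L - e\<^sub>i\<close> exchange roles.\<close>

lemma sum_lower_index:
  fixes J :: "'n::finite \<Rightarrow> nat"
  shows "(\<Sum>L | J \<le> L \<and> mdeg L < s. \<Sum>i\<in>UNIV. if J i < L i then g i (L(i := L i - 1)) else 0)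
    = (\<Sum>L | J \<le> L \<and> Suc (mdeg L) < s. \<Sum>i\<in>UNIV. g i L)" (is "?l = ?r")
proof -
  have "?l = (\<Sum>i\<in>UNIV. \<Sum>L | J \<le> L \<and> mdeg L < s. if J i < L i then g i (L(i := L i - 1)) else 0)"
    by (rule sum.swap)
  also have "\<dots> = (\<Sum>i\<in>UNIV. \<Sum>L | J \<le> L \<and> Suc (mdeg L) < s. g i L)"
  proof (rule sum.cong[OF refl])
    fix i
    have "(\<Sum>L | J \<le> L \<and> mdeg L < s. if J i < L i then g i (L(i := L i - 1)) else 0)
        = (\<Sum>L\<in>{L \<in> {L. J \<le> L \<and> mdeg L < s}. J i < L i}. g i (L(i := L i - 1)))"
      by (simp only: sum.inter_filter[OF finite_ge_index])
    also have "\<dots> = (\<Sum>L | J \<le> L \<and> Suc (mdeg L) < s. g i L)"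
    proof (rule sum.reindex_bij_witness[of _ "\<lambda>L. madd L i" "\<lambda>L. L(i := L i - 1)"])
      fix L assume L: "L \<in> {L \<in> {L. J \<le> L \<and> mdeg L < s}. J i < L i}"
      show 1: "madd (L(i := L i - 1)) i = L" using L by (auto simp: madd_def)
      have "Suc (mdeg (L(i := L i - 1))) = mdeg L" using 1 mdeg_madd by metis
      then show "L(i := L i - 1) \<in> {L. J \<le> L \<and> Suc (mdeg L) < s}"
        using L by (auto simp: le_fun_def)
    next
      fix L assume L: "L \<in> {L. J \<le> L \<and> Suc (mdeg L) < s}"
      show "(madd L i)(i := madd L i i - 1) = L" by (auto simp: madd_def)
      have "J \<le> madd L i" "J i < madd L i i" using L by (auto simp: le_fun_def madd_def le_SucI less_Suc_eq_le)
      then show "madd L i \<in> {L \<in> {L. J \<le> L \<and> mdeg L < s}. J i < L i}" using L by simp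
    qed simp
    finally show "(\<Sum>L | J \<le> L \<and> mdeg L < s. if J i < L i then g i (L(i := L i - 1)) else 0)
        = (\<Sum>L | J \<le> L \<and> Suc (mdeg L) < s. g i L)" .
  qed
  also have "\<dots> = ?r" by (rule sum.swap)
  finally show ?thesis .
qed

text \<open>The first sum comes from the coefficients and is reindexed by \<open>L + e\<^sub>i\<close>; the second one comes from the
  contact forms. Both now pair the same coefficient with the index \<open>L + e\<^sub>i\<close>.\<close>

lemma FD_ceta:
  fixes z v w :: "('n::finite, 'm::finite, 'k::finite option) jmodel"
  assumes J: "mdeg J < CARD('k)"
  shows "FD (\<lambda>z. ceta z w) z v $ jx \<alpha> J =
    - (\<Sum>L | J \<le> L \<and> Suc (mdeg L) < CARD('k). \<Sum>i\<in>UNIV. fst v $ i * ccoef J L (fst z) * ctheta \<alpha> (madd L i) z w)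
    - (\<Sum>L | J \<le> L \<and> mdeg L < CARD('k). ccoef J L (fst z) * (\<Sum>i\<in>UNIV. snd v $ jx \<alpha> (madd L i) * fst w $ i))"
proof -
  let ?U = "{L. J \<le> L \<and> mdeg L < CARD('k)}"
  have dt: "((\<lambda>z. ctheta \<alpha> L z w) has_derivative (\<lambda>v. 0 - (\<Sum>i\<in>UNIV. snd v $ jx \<alpha> (madd L i) * fst w $ i))) (at z)" for L
    unfolding ctheta_def
  proof (rule has_derivative_diff[OF has_derivative_const has_derivative_sum])
    fix i
    have l: "bounded_linear (\<lambda>z::('n, 'm, 'k option) jmodel. snd z $ jx \<alpha> (madd L i))"
      by (simp add: linear_conv_bounded_linear[symmetric] linear_iff)
    show "((\<lambda>z. snd z $ jx \<alpha> (madd L i) * fst w $ i) has_derivative (\<lambda>v. snd v $ jx \<alpha> (madd L i) * fst w $ i)) (at z)"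
      by (rule has_derivative_mult_left[OF bounded_linear_imp_has_derivative[OF l]])
  qed
  have df: "(fst has_derivative (fst :: ('n, 'm, 'k option) jmodel \<Rightarrow> _)) (at z)"
    by (rule bounded_linear_imp_has_derivative[OF bounded_linear_fst])
  have dc: "((\<lambda>z::('n, 'm, 'k option) jmodel. ccoef J L (fst z)) has_derivative (\<lambda>v. FD (ccoef J L) (fst z) (fst v))) (at z)" for L
    by (rule has_derivative_compose[OF df smooth_on_has_derivative[OF smooth_ccoef[OF open_UNIV]]]) simp
  have D: "((\<lambda>z. \<Sum>L\<in>?U. ccoef J L (fst z) * ctheta \<alpha> L z w) has_derivative
      (\<lambda>v. \<Sum>L\<in>?U. ccoef J L (fst z) * (0 - (\<Sum>i\<in>UNIV. snd v $ jx \<alpha> (madd L i) * fst w $ i))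
         + FD (ccoef J L) (fst z) (fst v) * ctheta \<alpha> L z w)) (at z)"
    by (rule has_derivative_sum, rule has_derivative_mult[OF dc dt])
  have cd: "(\<lambda>z. ceta z w) differentiable (at z)"
    by (rule smooth_on_differentiable[OF smooth_ceta[OF open_UNIV] UNIV_I])
  have "FD (\<lambda>z. ceta z w) z v $ jx \<alpha> J = FD (\<lambda>z. ceta z w $ jx \<alpha> J) z v"
    by (rule FD_linear_compose[OF cd linear_vec_nth', symmetric])
  also have "\<dots> = (\<Sum>L\<in>?U. ccoef J L (fst z) * (0 - (\<Sum>i\<in>UNIV. snd v $ jx \<alpha> (madd L i) * fst w $ i))
         + FD (ccoef J L) (fst z) (fst v) * ctheta \<alpha> L z w)"
    unfolding ceta_nth[OF J] by (rule FD_eq[OF D, THEN fun_cong])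
  also have "\<dots> = (\<Sum>L\<in>?U. FD (ccoef J L) (fst z) (fst v) * ctheta \<alpha> L z w)
     - (\<Sum>L\<in>?U. ccoef J L (fst z) * (\<Sum>i\<in>UNIV. snd v $ jx \<alpha> (madd L i) * fst w $ i))"
    by (simp add: sum.distrib sum_negf sum_subtractf)
  also have "(\<Sum>L\<in>?U. FD (ccoef J L) (fst z) (fst v) * ctheta \<alpha> L z w) =
     - (\<Sum>L\<in>?U. \<Sum>i\<in>UNIV. if J i < L i then fst v $ i * ccoef J (L(i := L i - 1)) (fst z) * ctheta \<alpha> (madd (L(i := L i - 1)) i) z w else 0)"
  proof (subst sum_negf[symmetric], rule sum.cong[OF refl])
    fix L assume "L \<in> ?U"
    then have JL: "J \<le> L" by simp
    have "FD (ccoef J L) (fst z) (fst v) * ctheta \<alpha> L z w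
      = - (\<Sum>i\<in>UNIV. (if J i < L i then fst v $ i * ccoef J (L(i := L i - 1)) (fst z) else 0) * ctheta \<alpha> L z w)"
      unfolding FD_ccoef[OF JL] by (simp add: sum_distrib_right)
    also have "(\<Sum>i\<in>UNIV. (if J i < L i then fst v $ i * ccoef J (L(i := L i - 1)) (fst z) else 0) * ctheta \<alpha> L z w)
      = (\<Sum>i\<in>UNIV. if J i < L i then fst v $ i * ccoef J (L(i := L i - 1)) (fst z) * ctheta \<alpha> (madd (L(i := L i - 1)) i) z w else 0)"
    proof (rule sum.cong[OF refl])
      fix i
      have "madd (L(i := L i - 1)) i = L" if "J i < L i" using that by (auto simp: madd_def)
      then show "(if J i < L i then fst v $ i * ccoef J (L(i := L i - 1)) (fst z) else 0) * ctheta \<alpha> L z w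
        = (if J i < L i then fst v $ i * ccoef J (L(i := L i - 1)) (fst z) * ctheta \<alpha> (madd (L(i := L i - 1)) i) z w else 0)"
        by (cases "J i < L i") (simp_all only: if_True if_False mult_zero_left)
    qed
    finally show "FD (ccoef J L) (fst z) (fst v) * ctheta \<alpha> L z w =
      (- (\<Sum>i\<in>UNIV. if J i < L i then fst v $ i * ccoef J (L(i := L i - 1)) (fst z) * ctheta \<alpha> (madd (L(i := L i - 1)) i) z w else 0))" .
  qed
  also have "(\<Sum>L\<in>?U. \<Sum>i\<in>UNIV. if J i < L i then fst v $ i * ccoef J (L(i := L i - 1)) (fst z) * ctheta \<alpha> (madd (L(i := L i - 1)) i) z w else 0)
    = (\<Sum>L | J \<le> L \<and> Suc (mdeg L) < CARD('k). \<Sum>i\<in>UNIV. fst v $ i * ccoef J L (fst z) * ctheta \<alpha> (madd L i) z w)"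
    by (rule sum_lower_index[where g = "\<lambda>i L. fst v $ i * ccoef J L (fst z) * ctheta \<alpha> (madd L i) z w"])
  finally show ?thesis .
qed

text \<open>The alternating choice of the coefficients makes the terms of lower order telescope, so that
  only the contact forms of top order contribute to the exterior derivative.\<close>

lemma ceta_ext_deriv:
  fixes z v w :: "('n::finite, 'm::finite, 'k::finite option) jmodel"
  assumes J: "mdeg J < CARD('k)"
  shows "FD (\<lambda>z. ceta z w) z v $ jx \<alpha> J - FD (\<lambda>z. ceta z v) z w $ jx \<alpha> J =
    (\<Sum>L | J \<le> L \<and> Suc (mdeg L) = CARD('k). ccoef J L (fst z) *
       (\<Sum>i\<in>UNIV. fst v $ i * snd w $ jx \<alpha> (madd L i) - fst w $ i * snd v $ jx \<alpha> (madd L i)))"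
proof -
  let ?U = "{L. J \<le> L \<and> mdeg L < CARD('k)}" and ?V = "{L. J \<le> L \<and> Suc (mdeg L) < CARD('k)}"
    and ?T = "{L. J \<le> L \<and> Suc (mdeg L) = CARD('k)}"
  define E where "E L = (\<Sum>i\<in>UNIV. fst v $ i * snd w $ jx \<alpha> (madd L i) - fst w $ i * snd v $ jx \<alpha> (madd L i))" for L
  \<comment> \<open>the quadratic terms in the differentials of the base coordinates are symmetric\<close>
  have sym: "(\<Sum>i\<in>UNIV. fst v $ i * (\<Sum>k\<in>UNIV. snd z $ jx \<alpha> (madd (madd L i) k) * fst w $ k))
      = (\<Sum>i\<in>UNIV. fst w $ i * (\<Sum>k\<in>UNIV. snd z $ jx \<alpha> (madd (madd L i) k) * fst v $ k))" for L
    unfolding sum_distrib_left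
    by (subst sum.swap) (simp add: madd_commute[of L] mult_ac)
  have V: "(\<Sum>i\<in>UNIV. fst v $ i * ccoef J L (fst z) * ctheta \<alpha> (madd L i) z w)
      - (\<Sum>i\<in>UNIV. fst w $ i * ccoef J L (fst z) * ctheta \<alpha> (madd L i) z v) = ccoef J L (fst z) * E L" for L
  proof -
    have t: "(\<Sum>i\<in>UNIV. fst v $ i * ccoef J L (fst z) * ctheta \<alpha> (madd L i) z w)
      = ccoef J L (fst z) * ((\<Sum>i\<in>UNIV. fst v $ i * snd w $ jx \<alpha> (madd L i))
          - (\<Sum>i\<in>UNIV. fst v $ i * (\<Sum>k\<in>UNIV. snd z $ jx \<alpha> (madd (madd L i) k) * fst w $ k)))" for v w
      unfolding ctheta_def sum_subtractf[symmetric] sum_distrib_left[of "ccoef J L (fst z)"]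
      by (simp add: algebra_simps)
    show ?thesis
      unfolding t sym E_def by (simp add: sum_subtractf algebra_simps)
  qed
  have U: "ccoef J L (fst z) * (\<Sum>i\<in>UNIV. snd v $ jx \<alpha> (madd L i) * fst w $ i)
     - ccoef J L (fst z) * (\<Sum>i\<in>UNIV. snd w $ jx \<alpha> (madd L i) * fst v $ i) = - (ccoef J L (fst z) * E L)" for L
    unfolding E_def by (simp add: sum_subtractf algebra_simps)
  have "FD (\<lambda>z. ceta z w) z v $ jx \<alpha> J - FD (\<lambda>z. ceta z v) z w $ jx \<alpha> J
     = - (\<Sum>L\<in>?V. (\<Sum>i\<in>UNIV. fst v $ i * ccoef J L (fst z) * ctheta \<alpha> (madd L i) z w)
            - (\<Sum>i\<in>UNIV. fst w $ i * ccoef J L (fst z) * ctheta \<alpha> (madd L i) z v))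
       - (\<Sum>L\<in>?U. ccoef J L (fst z) * (\<Sum>i\<in>UNIV. snd v $ jx \<alpha> (madd L i) * fst w $ i)
            - ccoef J L (fst z) * (\<Sum>i\<in>UNIV. snd w $ jx \<alpha> (madd L i) * fst v $ i))"
    unfolding FD_ceta[OF J] sum_subtractf by simp
  also have "\<dots> = (\<Sum>L\<in>?U. ccoef J L (fst z) * E L) - (\<Sum>L\<in>?V. ccoef J L (fst z) * E L)"
    unfolding V U by (simp add: sum_negf)
  also have "?U = ?V \<union> ?T" by auto
  also have "(\<Sum>L\<in>?V \<union> ?T. ccoef J L (fst z) * E L) = (\<Sum>L\<in>?V. ccoef J L (fst z) * E L) + (\<Sum>L\<in>?T. ccoef J L (fst z) * E L)"
  proof (rule sum.union_disjoint)
    show "finite ?V" "finite ?T"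
      by (rule finite_subset[OF _ finite_ge_index[of J "CARD('k)"]], auto)+
  qed auto
  finally show ?thesis unfolding E_def by simp
qed

text \<open>For \<open>|J| = r - 1\<close> the sum in the exterior derivative has the single term \<open>L = J\<close> with coefficient 1. Pairing
  with \<open>\<partial>/\<partial>u\<^sup>\<alpha>\<^bsub>J+e\<^sub>i\<^esub>\<close> and with \<open>\<partial>/\<partial>x\<^sup>i\<close> shows that all \<open>dx\<^sup>i\<close> and \<open>du\<^sup>\<alpha>\<^sub>K\<close>, \<open>|K| = r\<close>, vanish on the kernel; conversely only
  these differentials occur in \<open>d\<eta>\<close>.\<close>

lemma dceta_kernel:
  fixes z v :: "('n::finite, 'm::finite, 'k::finite option) jmodel"
  shows "(\<forall>w \<alpha> J. mdeg J < CARD('k) \<longrightarrow> FD (\<lambda>z. ceta z w) z v $ jx \<alpha> J - FD (\<lambda>z. ceta z v) z w $ jx \<alpha> J = 0)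
    \<longleftrightarrow> fst v = 0 \<and> (\<forall>\<alpha> K. mdeg K = CARD('k) \<longrightarrow> snd v $ jx \<alpha> K = 0)" (is "?l \<longleftrightarrow> ?r")
proof
  assume ?r
  then have "FD (\<lambda>z. ceta z w) z v $ jx \<alpha> J - FD (\<lambda>z. ceta z v) z w $ jx \<alpha> J = 0" if "mdeg J < CARD('k)" for w \<alpha> J
    unfolding ceta_ext_deriv[OF that] by (intro sum.neutral) auto
  then show ?l by blast
next
  assume l: ?l
  have top: "(\<Sum>i\<in>UNIV. fst v $ i * snd w $ jx \<alpha> (madd J i) - fst w $ i * snd v $ jx \<alpha> (madd J i)) = 0"
    if J: "Suc (mdeg J) = CARD('k)" for w :: "('n, 'm, 'k option) jmodel" and \<alpha> J
  proof -
    have Jk: "mdeg J < CARD('k)" using J by simp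
    have "L = J" if L: "J \<le> L" "Suc (mdeg L) = CARD('k)" for L
    proof -
      have "mdeg (L - J) = 0" using mdeg_diff[OF L(1)] L(2) J by simp
      then have "L - J = (\<lambda>_. 0)" by (simp add: mdeg_eq_0)
      from fun_cong[OF this] have "L i \<le> J i" for i by simp
      then show "L = J" using L(1) by (intro ext antisym) (auto simp: le_fun_def)
    qed
    then have "{L. J \<le> L \<and> Suc (mdeg L) = CARD('k)} = {J}" using J by auto
    moreover have "FD (\<lambda>z. ceta z w) z v $ jx \<alpha> J - FD (\<lambda>z. ceta z v) z w $ jx \<alpha> J = 0"
      using l Jk by blast
    ultimately show ?thesis unfolding ceta_ext_deriv[OF Jk] by simp
  qed
  have f0: "fst v $ i = 0" for i
  proof -
    define J where "J = (\<lambda>j. if j = i then CARD('k) - 1 else 0)"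
    have J: "Suc (mdeg J) = CARD('k)"
      using zero_less_card_finite[where 'a = 'k] by (simp add: J_def mdeg_def)
    fix \<alpha> :: 'm
    define w where "w = (0 :: real^'n, axis (jx \<alpha> (madd J i)) 1 :: real^('m, 'n, 'k option) jidx)"
    have wn: "snd w $ jx \<alpha> (madd J j) = (if j = i then 1 else 0)" for j
    proof -
      have "(jx \<alpha> (madd J j) :: ('m, 'n, 'k option) jidx) = jx \<alpha> (madd J i) \<longleftrightarrow> madd J j = madd J i"
        using J by (subst jx_eq_iff) simp_all
      then show ?thesis using madd_inj[of J j i] by (auto simp: w_def axis_def)
    qed
    have "fst w = 0" by (simp add: w_def)
    then have "(\<Sum>j\<in>UNIV. fst v $ j * snd w $ jx \<alpha> (madd J j) - fst w $ j * snd v $ jx \<alpha> (madd J j)) = fst v $ i"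
    proof -
      assume "fst w = 0"
      then have "fst v $ j * snd w $ jx \<alpha> (madd J j) - fst w $ j * snd v $ jx \<alpha> (madd J j)
          = (if j = i then fst v $ i else 0)" for j
        by (simp add: wn)
      then show ?thesis by simp
    qed
    then show ?thesis using top[OF J, of w \<alpha>] by simp
  qed
  have "snd v $ jx \<alpha> K = 0" if K: "mdeg K = CARD('k)" for \<alpha> K
  proof -
    obtain s where s: "CARD('k) = Suc s" using zero_less_card_finite[where 'a = 'k] gr0_implies_Suc by blast
    obtain J i where J: "K = madd J i" "mdeg J = s" using mdeg_Suc_obtain K s by metis
    then have "Suc (mdeg J) = CARD('k)" using s by simp
    note t = top[OF this, of "(axis i 1, 0)" \<alpha>]
    have "fst v $ j * snd (axis i 1 :: real^'n, 0 :: real^('m, 'n, 'k option) jidx) $ jx \<alpha> (madd J j)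
        - fst (axis i 1 :: real^'n, 0 :: real^('m, 'n, 'k option) jidx) $ j * snd v $ jx \<alpha> (madd J j)
        = (if j = i then - (snd v $ jx \<alpha> K) else 0)" for j
      by (simp add: J(1) axis_def)
    then show ?thesis using t by simp
  qed
  then show ?r using f0 by (simp add: vec_eq_iff)
qed

subsection \<open>The Reeb vector fields in jet coordinates\<close>

definition creeb :: "'m \<Rightarrow> ('n \<Rightarrow> nat) \<Rightarrow> real^'n \<Rightarrow> ('n::finite, 'm::finite, 'k::finite option) jmodel" where
  "creeb \<alpha> J x = (\<Sum>I | I \<le> J. dmon (J - I) x *\<^sub>R (0, axis (jx \<alpha> I) 1))"

lemma fst_creeb [simp]: "fst (creeb \<alpha> J x) = 0"
  by (simp add: creeb_def fst_sum)

lemma smooth_creeb: "open S \<Longrightarrow> smooth_on S (creeb \<alpha> J)"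
  unfolding creeb_def[abs_def]
  by (rule smooth_on_sum[OF smooth_on_scaleR[OF smooth_on_dmon smooth_on_const]])

lemma creeb_nth:
  assumes J: "mdeg J < CARD('k::finite)" and I: "mdeg I < CARD('k option)"
  shows "snd (creeb \<alpha> J x :: ('n::finite, 'm::finite, 'k option) jmodel) $ jx \<beta> I = (if \<alpha> = \<beta> \<and> I \<le> J then dmon (J - I) x else 0)"
proof -
  have a: "axis (jx \<alpha> K :: ('m, 'n, 'k option) jidx) (1::real) $ jx \<beta> I = (if \<alpha> = \<beta> \<and> K = I then 1 else 0)"
    if "K \<le> J" for K
  proof -
    have "mdeg K < CARD('k option)" using mdeg_mono[OF that] J by simp
    then show ?thesis using jx_eq_iff[OF I, of K \<beta> \<alpha>] by (auto simp: axis_def)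
  qed
  have "snd (creeb \<alpha> J x :: ('n, 'm, 'k option) jmodel) $ jx \<beta> I = (\<Sum>K | K \<le> J. dmon (J - K) x * axis (jx \<alpha> K :: ('m, 'n, 'k option) jidx) 1 $ jx \<beta> I)"
    by (simp add: creeb_def snd_sum)
  also have "\<dots> = (\<Sum>K | K \<le> J. if K = I then (if \<alpha> = \<beta> then dmon (J - I) x else 0) else 0)"
    by (rule sum.cong[OF refl]) (simp add: a)
  also have "\<dots> = (if \<alpha> = \<beta> \<and> I \<le> J then dmon (J - I) x else 0)"
    using finite_le_index[of J] by simp
  finally show ?thesis .
qed

text \<open>The same inverse matrices as before, multiplied in the other order; the signs are moved from the
  lower to the upper half of the interval of multi-indices at the cost of a factor that is 1 on the diagonal.\<close>

lemma ceta_creeb: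
  fixes z :: "('n::finite, 'm::finite, 'k::finite option) jmodel"
  assumes J: "mdeg J < CARD('k)" and K: "mdeg K < CARD('k)"
  shows "ceta z (creeb \<alpha> J (fst z)) $ jx \<beta> K = (if \<alpha> = \<beta> \<and> J = K then 1 else 0)"
proof -
  let ?x = "fst z"
  have "ceta z (creeb \<alpha> J ?x) $ jx \<beta> K = (\<Sum>L | K \<le> L \<and> mdeg L < CARD('k). if L \<le> J then (if \<alpha> = \<beta> then ccoef K L ?x * dmon (J - L) ?x else 0) else 0)"
    unfolding ceta_nth[OF K]
    by (rule sum.cong[OF refl]) (auto simp: ctheta_vertical creeb_nth[OF J mdeg_less_option] simp del: card_option)
  also have "\<dots> = (\<Sum>L\<in>{L \<in> {L. K \<le> L \<and> mdeg L < CARD('k)}. L \<le> J}. if \<alpha> = \<beta> then ccoef K L ?x * dmon (J - L) ?x else 0)"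
    by (simp only: sum.inter_filter[OF finite_ge_index])
  also have "{L \<in> {L. K \<le> L \<and> mdeg L < CARD('k)}. L \<le> J} = {L. K \<le> L \<and> L \<le> J}"
    using J mdeg_mono by (auto intro: le_less_trans)
  also have "(\<Sum>L | K \<le> L \<and> L \<le> J. if \<alpha> = \<beta> then ccoef K L ?x * dmon (J - L) ?x else 0)
      = (if \<alpha> = \<beta> then (- 1) ^ mdeg (J - K) * (\<Sum>L | K \<le> L \<and> L \<le> J. (- 1) ^ mdeg (J - L) * dmon (J - L) ?x * dmon (L - K) ?x) else 0)"
  proof (cases "\<alpha> = \<beta>")
    case True
    have *: "ccoef K L ?x * dmon (J - L) ?x = (- 1) ^ mdeg (J - K) * ((- 1) ^ mdeg (J - L) * dmon (J - L) ?x * dmon (L - K) ?x)"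
      if "K \<le> L \<and> L \<le> J" for L
    proof -
      have KJ: "K \<le> J" using that by auto
      have "mdeg (J - K) = mdeg (J - L) + mdeg (L - K)"
        using mdeg_diff[of K J] mdeg_diff[of K L] mdeg_diff[of L J] mdeg_mono[of K L] mdeg_mono[of L J] that KJ by simp
      then have "(- 1 :: real) ^ mdeg (J - K) * (- 1) ^ mdeg (J - L) = (- 1) ^ mdeg (L - K)"
        by (simp add: power_add[symmetric]) (simp add: power_add)
      then show ?thesis by (simp add: ccoef_def mult.assoc[symmetric])
    qed
    show ?thesis
      unfolding if_P[OF True] sum_distrib_left
      by (rule sum.cong[OF refl], rule *) (simp only: mem_Collect_eq)
  qed simp
  also have "\<dots> = (if \<alpha> = \<beta> \<and> J = K then 1 else 0)"
  proof (cases "K \<le> J")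
    case True
    then show ?thesis by (simp add: dmon_convolution) (auto simp: mdeg_def)
  next
    case False
    then have e: "{L. K \<le> L \<and> L \<le> J} = {}" by auto
    show ?thesis unfolding e using False by auto
  qed
  finally show ?thesis .
qed

section \<open>Contact forms under a change of adapted coordinates\<close>

context fibred
begin

lemma jet_chart_charts:
  assumes "f \<in> fibred_charts P"
  shows "jet_chart P f \<in> charts (jet_manifold P :: (('q, 'e) jet, ('n, 'm, 's::finite) jmodel) mfd)"
proof -
  interpret J: smooth_atlas "jet_manifold P :: (('q, 'e) jet, ('n, 'm, 's) jmodel) mfd"
    by (rule jet_atlas)
  show ?thesis by (rule J.atlas_charts) (use assms in \<open>simp add: jet_manifold_def\<close>)
qed

lemma jproj_jcoord: "jproj (jcoord f q \<sigma>) = jcoord f q \<sigma>"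
  by (rule jmodel_eqI) (simp_all add: jcoord_nth)

lemma jet_proj_jet_of:
  fixes k :: "'k::finite itself"
  assumes "\<sigma> \<in> sections_at P q"
  shows "jet_proj P (CARD('k) - 1) (jet_of P (CARD('k option) - 1) q \<sigma>) = jet_of P (CARD('k) - 1) q \<sigma>"
proof -
  have "jet_equiv P (CARD('k option) - 1) q \<sigma> (jet_rep (jet_of P (CARD('k option) - 1) q \<sigma>))"
    by (rule jet_rep_jet_of(2)[OF assms])
  then have "jet_equiv P (CARD('k) - 1) q \<sigma> (jet_rep (jet_of P (CARD('k option) - 1) q \<sigma>))"
    by (auto simp: jet_equiv_def mindices_def)
  from jet_of_eqI[OF this] show ?thesis by (simp only: jet_proj_def fst_jet_of)
qed

lemma jet_proj_chart:
  assumes f: "f \<in> fibred_charts P"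
    and p: "p \<in> fst (jet_chart P f :: (_, ('n, 'm, 'k::finite option) jmodel) chart)"
  shows "jet_proj P (CARD('k) - 1) p \<in> fst (jet_chart P f :: (_, ('n, 'm, 'k) jmodel) chart)"
    and "snd (jet_chart P f :: (_, ('n, 'm, 'k) jmodel) chart) (jet_proj P (CARD('k) - 1) p) =
      jproj (snd (jet_chart P f :: (_, ('n, 'm, 'k option) jmodel) chart) p)"
proof -
  obtain q \<sigma> where s: "\<sigma> \<in> sections_at P q" "\<sigma> q \<in> fst (fst f)" "p = jet_of P (CARD('k option) - 1) q \<sigma>"
    "snd (jet_chart P f :: (_, ('n, 'm, 'k option) jmodel) chart) p = jcoord f q \<sigma>"
    by (rule jet_chart_obtain[OF p])
  have j: "jet_proj P (CARD('k) - 1) p = jet_of P (CARD('k) - 1) q \<sigma>"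
    unfolding s(3) by (rule jet_proj_jet_of[OF s(1)])
  show "jet_proj P (CARD('k) - 1) p \<in> fst (jet_chart P f :: (_, ('n, 'm, 'k) jmodel) chart)"
    unfolding j by (rule jet_of_in_chart(1)[OF s(1) f s(2)])
  show "snd (jet_chart P f :: (_, ('n, 'm, 'k) jmodel) chart) (jet_proj P (CARD('k) - 1) p) =
      jproj (snd (jet_chart P f :: (_, ('n, 'm, 'k option) jmodel) chart) p)"
    unfolding j s(4) jproj_jcoord by (rule jet_of_in_chart(2)[OF s(1) f s(2)])
qed

lemma T_proj_chart:
  assumes f: "f \<in> fibred_charts P"
    and p: "p \<in> fst (jet_chart P f :: (_, ('n, 'm, 'k::finite option) jmodel) chart)"
  shows "T_proj P p v = tvec (jet_manifold P :: (_, ('n, 'm, 'k) jmodel) mfd) (jet_chart P f) (jet_proj P (CARD('k) - 1) p)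
     (jproj (tcoord (jet_manifold P :: (_, ('n, 'm, 'k option) jmodel) mfd) (jet_chart P f) p v))"
proof -
  let ?c = "jet_chart P f :: (_, ('n, 'm, 'k option) jmodel) chart"
  let ?d = "jet_chart P f :: (_, ('n, 'm, 'k) jmodel) chart"
  let ?M = "jet_manifold P :: (_, ('n, 'm, 'k option) jmodel) mfd"
  let ?N = "jet_manifold P :: (_, ('n, 'm, 'k) jmodel) mfd"
  interpret M: smooth_atlas ?M by (rule jet_atlas)
  have c: "?c \<in> charts ?M" and d: "?d \<in> charts ?N" by (rule jet_chart_charts[OF f])+
  let ?S = "snd ?c ` fst ?c"
  have "T_proj P p v = tvec ?N ?d (jet_proj P (CARD('k) - 1) p) (FD jproj (snd ?c p) (tcoord ?M ?c p v))"
    unfolding T_proj_def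
  proof (rule tmap_charts[OF jet_atlas jet_atlas c p d])
    show "open ?S" by (rule M.open_chart_image[OF c])
    show "snd ?c p \<in> ?S" using p by (rule imageI)
    show "smooth_on ?S jproj" by (rule smooth_on_linear[OF linear_jproj])
    show "jet_proj P (CARD('k) - 1) q \<in> fst ?d \<and> snd ?d (jet_proj P (CARD('k) - 1) q) = jproj (snd ?c q)"
      if "q \<in> fst ?c" for q
      using jet_proj_chart[OF f that] by simp
  qed simp
  moreover have "(jproj has_derivative jproj) (at (snd ?c p))"
    using linear_jproj linear_conv_bounded_linear bounded_linear_imp_has_derivative by blast
  ultimately show ?thesis by (simp only: FD_eq)
qed

subsection \<open>The transition maps of jets\<close>

text \<open>In the overlap of two adapted charts, the coordinates \<open>z\<close> of a jet belong to a polynomial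
  section. Differentiating the identity that expresses the new jet coordinates of this section
  through the old ones gives the transformation law of the total derivatives.\<close>

context
  fixes f f' and O' :: "('n, 'm, 'k::finite option) jmodel set"
    and T :: "('n, 'm, 'k option) jmodel \<Rightarrow> ('n, 'm, 'k option) jmodel"
    and T' :: "('n, 'm, 'k) jmodel \<Rightarrow> ('n, 'm, 'k) jmodel"
  assumes f: "f \<in> fibred_charts P" and f': "f' \<in> fibred_charts P"
  defines "O' \<equiv> snd (jet_chart P f :: (_, ('n, 'm, 'k option) jmodel) chart) `
      (fst (jet_chart P f :: (_, ('n, 'm, 'k option) jmodel) chart) \<inter>
       fst (jet_chart P f' :: (_, ('n, 'm, 'k option) jmodel) chart))"
    and "T \<equiv> ctrans (jet_chart P f) (jet_chart P f')"
    and "T' \<equiv> ctrans (jet_chart P f) (jet_chart P f')"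
begin

lemma overlap_obtain:
  assumes "z \<in> O'"
  obtains q where "psec f z \<in> sections_at P q" "psec f z q \<in> fst (fst f)" "psec f z q \<in> fst (fst f')"
    "q \<in> fst (snd f)" "q \<in> fst (snd f')" "snd (snd f) q = fst z" "jcoord f q (psec f z) = z"
proof -
  let ?q = "chart_inv (snd f) (fst z)"
  have O': "O' = {z. (fst z, \<chi> \<alpha>. snd z $ jx \<alpha> (\<lambda>_. 0)) \<in> snd (fst f) ` (fst (fst f) \<inter> fst (fst f'))}"
    unfolding O'_def by (rule jet_overlap_image[OF f f'])
  have zj: "z \<in> jimage f" using assms unfolding O' jimage_def by blast
  note ps = psec[OF f zj]
  have w: "snd (fst f) (psec f z ?q) = (fst z, \<chi> \<alpha>. snd z $ jx \<alpha> (\<lambda>_. 0))"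
    by (rule section_value_jcoord[OF ps(1) f ps(2,4)])
  obtain e where e: "(fst z, \<chi> \<alpha>. snd z $ jx \<alpha> (\<lambda>_. 0)) = snd (fst f) e" "e \<in> fst (fst f)" "e \<in> fst (fst f')"
    using assms unfolding O' by blast
  have "psec f z ?q = e"
    using arg_cong[OF trans[OF w e(1)], of "chart_inv (fst f)"]
    unfolding E.cinv[OF fibred_chartD(1)[OF f] ps(2)] E.cinv[OF fibred_chartD(1)[OF f] e(2)] .
  then have f'q: "psec f z ?q \<in> fst (fst f')" using e(3) by simp
  show ?thesis
    by (rule that[OF ps(1,2) f'q section_base_in_chart[OF ps(1) f ps(2)] section_base_in_chart[OF ps(1) f' f'q] ps(3,4)])
qed

lemma open_overlap: "open O'"
  unfolding O'_def by (rule smooth_atlas.charts_transition(1)[OF jet_atlas jet_chart_charts[OF f] jet_chart_charts[OF f']])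

lemma smooth_T: "smooth_on O' T"
  unfolding O'_def T_def
  by (rule smooth_atlas.charts_transition(2)[OF jet_atlas jet_chart_charts[OF f] jet_chart_charts[OF f']])

lemma T_jcoord:
  assumes "\<sigma> \<in> sections_at P q" "\<sigma> q \<in> fst (fst f)" "\<sigma> q \<in> fst (fst f')"
  shows "T (jcoord f q \<sigma>) = jcoord f' q \<sigma>" "T' (jcoord f q \<sigma>) = jcoord f' q \<sigma>"
  unfolding T_def T'_def by (rule ctrans_jet_chart[OF f f' assms])+

text \<open>The coordinates below the top order are transformed among themselves; in particular they do not depend on
  those of top order.\<close>

lemma jproj_T: "z \<in> O' \<Longrightarrow> jproj (T z) = T' (jproj z)"
proof -
  assume "z \<in> O'"
  then obtain q where q: "psec f z \<in> sections_at P q" "psec f z q \<in> fst (fst f)" "psec f z q \<in> fst (fst f')"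
    "q \<in> fst (snd f)" "q \<in> fst (snd f')" "snd (snd f) q = fst z" "jcoord f q (psec f z) = z"
    by (rule overlap_obtain)
  have t: "T z = jcoord f' q (psec f z)" using T_jcoord(1)[OF q(1-3)] unfolding q(7) .
  have "jproj (jcoord f q (psec f z) :: ('n, 'm, 'k option) jmodel) = jcoord f q (psec f z)"
    by (rule jproj_jcoord)
  note j = this[unfolded q(7)]
  show ?thesis unfolding t j jproj_jcoord T_jcoord(2)[OF q(1-3)] ..
qed

lemma fst_T: "z \<in> O' \<Longrightarrow> fst (T z) = ctrans (snd f) (snd f') (fst z)"
proof -
  assume "z \<in> O'"
  then obtain q where q: "psec f z \<in> sections_at P q" "psec f z q \<in> fst (fst f)" "psec f z q \<in> fst (fst f')"
    "q \<in> fst (snd f)" "q \<in> fst (snd f')" "snd (snd f) q = fst z" "jcoord f q (psec f z) = z"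
    by (rule overlap_obtain)
  show ?thesis
    using T_jcoord(1)[OF q(1-3)] B.ctrans_chart[OF fibred_chartD(2)[OF f] q(4), of "snd f'"] by (simp add: q(6,7))
qed

lemma fst_overlap: "z \<in> O' \<Longrightarrow> fst z \<in> snd (snd f) ` (fst (snd f) \<inter> fst (snd f'))"
proof -
  assume "z \<in> O'"
  then obtain q where q: "psec f z \<in> sections_at P q" "psec f z q \<in> fst (fst f)" "psec f z q \<in> fst (fst f')"
    "q \<in> fst (snd f)" "q \<in> fst (snd f')" "snd (snd f) q = fst z" "jcoord f q (psec f z) = z"
    by (rule overlap_obtain)
  show ?thesis unfolding q(6)[symmetric] using q(4,5) by (intro imageI IntI)
qed

lemma fst_FD_T:
  assumes z: "z \<in> O'"
  shows "fst (FD T z v) = FD (ctrans (snd f) (snd f')) (fst z) (fst v)"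
proof -
  have "fst (FD T z v) = FD (\<lambda>z. fst (T z)) z v"
    by (rule FD_linear_compose[OF smooth_on_differentiable[OF smooth_T z] linear_fst', symmetric])
  also have "\<dots> = FD (\<lambda>z. ctrans (snd f) (snd f') (fst z)) z v"
    by (rule fun_cong[OF FD_cong_open[OF open_overlap z fst_T]])
  also have "\<dots> = FD (ctrans (snd f) (snd f')) (fst z) (fst v)"
  proof -
    have d: "ctrans (snd f) (snd f') differentiable (at (fst z))"
      by (rule smooth_on_differentiable[OF B.charts_transition(2)[OF fibred_chartD(2)[OF f] fibred_chartD(2)[OF f']] fst_overlap[OF z]])
    have "(fst has_derivative (fst :: ('n, 'm, 'k option) jmodel \<Rightarrow> _)) (at z)"
      by (rule bounded_linear_imp_has_derivative[OF bounded_linear_fst])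
    from FD_eq[OF has_derivative_compose[OF this FD_works[OF d]]] show ?thesis by simp
  qed
  finally show ?thesis .
qed

lemma jproj_FD_T:
  assumes z: "z \<in> O'"
  shows "jproj (FD T z v) = FD T' (jproj z) (jproj v)"
proof -
  let ?c = "jet_chart P f :: (_, ('n, 'm, 'k) jmodel) chart" and ?c' = "jet_chart P f' :: (_, ('n, 'm, 'k) jmodel) chart"
  obtain q where q: "psec f z \<in> sections_at P q" "psec f z q \<in> fst (fst f)" "psec f z q \<in> fst (fst f')"
    "q \<in> fst (snd f)" "q \<in> fst (snd f')" "snd (snd f) q = fst z" "jcoord f q (psec f z) = z"
    using z by (rule overlap_obtain)
  note j = jet_of_in_chart[OF q(1) f q(2), where 's = 'k] jet_of_in_chart(1)[OF q(1) f' q(3), where 's = 'k]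
  have "jproj (jcoord f q (psec f z) :: ('n, 'm, 'k option) jmodel) = jcoord f q (psec f z)"
    by (rule jproj_jcoord)
  note jz = this[unfolded q(7), folded j(2)]
  have "T' differentiable (at (jproj z))"
    unfolding T'_def jz
    by (rule smooth_atlas.ctrans_differentiable[OF jet_atlas jet_chart_charts[OF f] jet_chart_charts[OF f'] j(1,3)])
  note dT' = this
  have "jproj (FD T z v) = FD (\<lambda>z. jproj (T z)) z v"
    by (rule FD_linear_compose[OF smooth_on_differentiable[OF smooth_T z] linear_jproj, symmetric])
  also have "\<dots> = FD (\<lambda>z. T' (jproj z)) z v"
    by (rule fun_cong[OF FD_cong_open[OF open_overlap z jproj_T]])
  also have "\<dots> = FD T' (jproj z) (jproj v)"
  proof -
    have "(jproj has_derivative jproj) (at z)"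
      using linear_jproj linear_conv_bounded_linear bounded_linear_imp_has_derivative by blast
    from FD_eq[OF has_derivative_compose[OF this FD_works[OF dT']]] show ?thesis by simp
  qed
  finally show ?thesis .
qed

text \<open>Along the jet of the polynomial section through \<open>z\<close>, the new coordinates are the derivatives of the new
  representation at the moving point \<open>\<phi>(x)\<close>. The chain rule in \<open>x\<close> raises their order by one.\<close>

lemma FD_T_tderiv:
  assumes z: "z \<in> O'" and J: "mdeg J < CARD('k)"
  shows "snd (FD T z (tderiv k z)) $ jx \<alpha> J =
    (\<Sum>i\<in>UNIV. FD (ctrans (snd f) (snd f')) (fst z) (axis k 1) $ i * snd (T z) $ jx \<alpha> (madd J i))"
proof -
  note fD = fibred_chartD[OF f] and fD' = fibred_chartD[OF f']
  let ?\<sigma> = "psec f z" and ?\<phi> = "ctrans (snd f) (snd f')" and ?D = "snd (snd f) ` (fst (snd f) \<inter> fst (snd f'))"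
  obtain q where q: "?\<sigma> \<in> sections_at P q" "?\<sigma> q \<in> fst (fst f)" "?\<sigma> q \<in> fst (fst f')"
    "q \<in> fst (snd f)" "q \<in> fst (snd f')" "snd (snd f) q = fst z" "jcoord f q ?\<sigma> = z"
    using z by (rule overlap_obtain)
  have zj: "z \<in> jimage f"
    unfolding jet_chart_image[OF f, symmetric] using z unfolding O'_def by blast
  obtain W2 where W2: "open W2" "fst z \<in> W2" "\<forall>x\<in>W2. local_rep f ?\<sigma> x = tpoly z x"
    using psec(5)[OF f zj] by blast
  obtain W where W: "open W" "snd (snd f) q \<in> W" "smooth_on W (local_rep f ?\<sigma>)"
    "\<forall>x\<in>W. \<exists>y. y \<in> fst (snd f) \<and> x = snd (snd f) y \<and> ?\<sigma> y \<in> fst (fst f) \<and> ?\<sigma> \<in> sections_at P y \<and>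
       snd (fst f) (?\<sigma> y) = (x, local_rep f ?\<sigma> x)"
    by (rule section_local[OF q(1) f q(2)])
  obtain W' where W': "open W'" "snd (snd f') q \<in> W'" "smooth_on W' (local_rep f' ?\<sigma>)"
    "\<forall>x\<in>W'. \<exists>y. y \<in> fst (snd f') \<and> x = snd (snd f') y \<and> ?\<sigma> y \<in> fst (fst f') \<and> ?\<sigma> \<in> sections_at P y \<and>
       snd (fst f') (?\<sigma> y) = (x, local_rep f' ?\<sigma> x)"
    by (rule section_local[OF q(1) f' q(3)])
  note trB = B.charts_transition[OF fD(2) fD'(2)]
  define V where "V = {x \<in> ?D. ?\<phi> x \<in> W'} \<inter> (W \<inter> W2)"
  have V: "open V"
    unfolding V_def using open_preimage[OF smooth_on_continuous[OF trB(2)] trB(1) W'(1)] W(1) W2(1) by (intro open_Int)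
  have \<phi>z: "?\<phi> (fst z) = snd (snd f') q"
    using B.ctrans_chart[OF fD(2) q(4), of "snd f'"] by (simp add: q(6))
  have zD: "fst z \<in> ?D" by (rule fst_overlap[OF z])
  have zV: "fst z \<in> V" unfolding V_def using zD W(2) W'(2) W2(2) by (simp add: \<phi>z q(6))
  \<comment> \<open>the jet prolongation of the polynomial section, in coordinates\<close>
  define \<gamma> :: "real^'n \<Rightarrow> ('n, 'm, 'k option) jmodel"
    where "\<gamma> x = (x, \<chi> A. case Rep_jidx A of (\<beta>, I) \<Rightarrow> mdiff I (\<lambda>x. tpoly z x $ \<beta>) x)" for x
  have smt: "smooth_on UNIV (\<lambda>x. tpoly z x $ \<beta>)" for \<beta>
    by (rule smooth_on_nth[OF smooth_tpoly[OF open_UNIV smooth_on_const smooth_on_id] open_UNIV])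
  have sm\<gamma>: "smooth_on UNIV (\<lambda>x. case Rep_jidx A of (\<beta>, I) \<Rightarrow> mdiff I (\<lambda>x. tpoly z x $ \<beta>) x)" for A :: "('m, 'n, 'k option) jidx"
    by (cases "Rep_jidx A") (use smooth_on_mdiff[OF smt] in simp)
  have smg: "smooth_on UNIV \<gamma>"
    unfolding \<gamma>_def[abs_def]
    by (rule smooth_on_Pair[OF smooth_on_id smooth_on_vec[OF sm\<gamma> open_UNIV] open_UNIV])
  have point: "jcoord f y ?\<sigma> = \<gamma> x \<and> ?\<sigma> y \<in> fst (fst f) \<and> ?\<sigma> y \<in> fst (fst f') \<and> ?\<sigma> \<in> sections_at P y \<and> ?\<phi> x = snd (snd f') y"
    if x: "x \<in> V" and y: "y \<in> fst (snd f)" "y \<in> fst (snd f')" "x = snd (snd f) y" for x y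
  proof -
    have xV: "?\<phi> x \<in> W'" "x \<in> W" "x \<in> W2" using x by (auto simp: V_def)
    have \<phi>x: "?\<phi> x = snd (snd f') y" unfolding y(3) by (rule B.ctrans_chart[OF fD(2) y(1)])
    obtain y1 where y1: "y1 \<in> fst (snd f)" "x = snd (snd f) y1" "?\<sigma> y1 \<in> fst (fst f)" "?\<sigma> \<in> sections_at P y1"
      using bspec[OF W(4) xV(2)] by blast
    have "y1 = y" using y(3) y1(2) B.cinv[OF fD(2) y1(1)] B.cinv[OF fD(2) y(1)] by metis
    note y1 = y1(3,4)[unfolded this]
    obtain y2 where y2: "y2 \<in> fst (snd f')" "?\<phi> x = snd (snd f') y2" "?\<sigma> y2 \<in> fst (fst f')"
      using bspec[OF W'(4) xV(1)] by blast
    have "y2 = y" using \<phi>x y2(2) B.cinv[OF fD'(2) y2(1)] B.cinv[OF fD'(2) y(2)] by metis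
    note y2 = y2(3)[unfolded this]
    have "jcoord f y ?\<sigma> = \<gamma> x"
    proof (rule jcoord_eqI)
      show "fst (\<gamma> x) = snd (snd f) y" by (simp add: \<gamma>_def y(3))
      fix \<beta> and I :: "'n \<Rightarrow> nat" assume I: "mdeg I < CARD('k option)"
      have "section_deriv f \<beta> I ?\<sigma> y = mdiff I (\<lambda>x. tpoly z x $ \<beta>) x"
        unfolding section_deriv_local_rep y(3)[symmetric]
        by (rule mdiff_cong_open[OF W2(1) xV(3)]) (use W2(3) in simp)
      then show "snd (\<gamma> x) $ jx \<beta> I = section_deriv f \<beta> I ?\<sigma> y"
        unfolding \<gamma>_def by (simp only: snd_conv vec_lambda_beta Rep_jidx_jx[OF I] prod.case)
    qed
    then show ?thesis using y1 y2 \<phi>x by blast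
  qed
  have \<gamma>z: "\<gamma> (fst z) = z" using point[OF zV q(4,5) q(6)[symmetric]] q(7) by simp
  have dg: "\<gamma> differentiable (at (fst z))" by (rule smooth_on_differentiable[OF smg UNIV_I])
  have d\<gamma>: "FD \<gamma> (fst z) (axis k 1) = tderiv k z"
  proof -
    show ?thesis
    proof (rule jmodel_eqI)
      have "fst (FD \<gamma> (fst z) (axis k 1)) = FD (\<lambda>x. fst (\<gamma> x)) (fst z) (axis k 1)"
        by (rule FD_linear_compose[OF dg linear_fst', symmetric])
      then show "fst (FD \<gamma> (fst z) (axis k 1)) = fst (tderiv k z)"
        by (simp add: \<gamma>_def tderiv_def)
    next
      fix \<beta> and I :: "'n \<Rightarrow> nat" assume I: "mdeg I < CARD('k option)"
      have lin: "linear (\<lambda>z::('n, 'm, 'k option) jmodel. snd z $ jx \<beta> I)" by (simp add: linear_iff)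
      have c: "snd (\<gamma> x) $ jx \<beta> I = mdiff I (\<lambda>x. tpoly z x $ \<beta>) x" for x
        unfolding \<gamma>_def by (simp only: snd_conv vec_lambda_beta Rep_jidx_jx[OF I] prod.case)
      have "snd (FD \<gamma> (fst z) (axis k 1)) $ jx \<beta> I = FD (\<lambda>x. snd (\<gamma> x) $ jx \<beta> I) (fst z) (axis k 1)"
        by (rule FD_linear_compose[OF dg lin, symmetric])
      also have "\<dots> = pdiff k (mdiff I (\<lambda>x. tpoly z x $ \<beta>)) (fst z)"
        unfolding c pdiff_def ..
      also have "\<dots> = mdiff (madd I k) (\<lambda>x. tpoly z x $ \<beta>) (fst z)"
        by (rule mdiff_madd(1)[OF smt open_UNIV UNIV_I, symmetric])
      also have "\<dots> = (if mdeg I < CARD('k) then snd z $ jx \<beta> (madd I k) else 0)"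
        by (simp add: mdiff_tpoly)
      also have "\<dots> = snd (tderiv k z) $ jx \<beta> I" by (rule tderiv_nth[OF I, symmetric])
      finally show "snd (FD \<gamma> (fst z) (axis k 1)) $ jx \<beta> I = snd (tderiv k z) $ jx \<beta> I" .
    qed
  qed
  let ?F = "mdiff J (\<lambda>x. local_rep f' ?\<sigma> x $ \<alpha>)"
  have smF': "smooth_on W' (\<lambda>x. local_rep f' ?\<sigma> x $ \<alpha>)" by (rule smooth_on_nth[OF W'(3,1)])
  have smF: "smooth_on W' ?F" by (rule smooth_on_mdiff[OF smF'])
  have Jo: "mdeg J < CARD('k option)" using J by simp
  have eq: "snd (T (\<gamma> x)) $ jx \<alpha> J = ?F (?\<phi> x)" if x: "x \<in> V" for x
  proof -
    have "x \<in> ?D" using x by (simp add: V_def)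
    then obtain y where y: "y \<in> fst (snd f)" "y \<in> fst (snd f')" "x = snd (snd f) y" by blast
    note pt = point[OF x y]
    have "T (\<gamma> x) = jcoord f' y ?\<sigma>" using T_jcoord(1)[of ?\<sigma> y] pt by simp
    then show ?thesis using jcoord_nth[OF Jo, of f' y ?\<sigma> \<alpha>] pt by (simp add: section_deriv_local_rep)
  qed
  have xW': "?\<phi> (fst z) \<in> W'" using \<phi>z W'(2) by simp
  have dT: "T differentiable (at (\<gamma> (fst z)))" unfolding \<gamma>z by (rule smooth_on_differentiable[OF smooth_T z])
  have dTg: "(\<lambda>x. T (\<gamma> x)) differentiable (at (fst z))"
    using differentiable_chain_at[OF dg dT] by (simp add: o_def)
  have lin: "linear (\<lambda>z::('n, 'm, 'k option) jmodel. snd z $ jx \<alpha> J)" by (simp add: linear_iff)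
  have "snd (FD T z (tderiv k z)) $ jx \<alpha> J = snd (FD (\<lambda>x. T (\<gamma> x)) (fst z) (axis k 1)) $ jx \<alpha> J"
    unfolding FD_compose[OF dT dg] d\<gamma> \<gamma>z ..
  also have "\<dots> = FD (\<lambda>x. snd (T (\<gamma> x)) $ jx \<alpha> J) (fst z) (axis k 1)"
    by (rule FD_linear_compose[OF dTg lin, symmetric])
  also have "\<dots> = FD (\<lambda>x. ?F (?\<phi> x)) (fst z) (axis k 1)"
    by (rule fun_cong[OF FD_cong_open[OF V zV eq]])
  also have "\<dots> = FD ?F (?\<phi> (fst z)) (FD ?\<phi> (fst z) (axis k 1))"
    by (rule FD_compose[OF smooth_on_differentiable[OF smF xW'] smooth_on_differentiable[OF trB(2) zD]])
  also have "\<dots> = (\<Sum>i\<in>UNIV. FD ?\<phi> (fst z) (axis k 1) $ i * pdiff i ?F (?\<phi> (fst z)))"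
    by (rule FD_pdiff[OF smooth_on_differentiable[OF smF xW']])
  also have "\<dots> = (\<Sum>i\<in>UNIV. FD ?\<phi> (fst z) (axis k 1) $ i * snd (T z) $ jx \<alpha> (madd J i))"
  proof (rule sum.cong[OF refl])
    fix i
    have "pdiff i ?F (?\<phi> (fst z)) = section_deriv f' \<alpha> (madd J i) ?\<sigma> q"
      unfolding section_deriv_local_rep \<phi>z
      by (rule mdiff_madd(1)[OF smF' W'(1,2), symmetric])
    moreover have "T z = jcoord f' q ?\<sigma>" using T_jcoord(1)[OF q(1-3)] by (simp add: q(7))
    ultimately show "FD ?\<phi> (fst z) (axis k 1) $ i * pdiff i ?F (?\<phi> (fst z)) =
        FD ?\<phi> (fst z) (axis k 1) $ i * snd (T z) $ jx \<alpha> (madd J i)"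
      using jcoord_nth[OF mdeg_madd_less_option[OF J], of f' q ?\<sigma> \<alpha> i] by simp
  qed
  finally show ?thesis .
qed

text \<open>Subtract from \<open>v\<close> its total derivative part. By the preceding lemma, the transition map sends this part into
  the Cartan distribution; it sends the remainder to a vector whose components below the top order are
  given by the transition map \<open>T'\<close> of order \<open>r - 1\<close>.\<close>

lemma cvert_transition:
  assumes z: "z \<in> O'"
  shows "jproj (cvert (T z) (FD T z v)) = FD T' (jproj z) (jproj (cvert z v))"
proof -
  let ?\<phi> = "ctrans (snd f) (snd f')"
  define w where "w = v - (\<Sum>k\<in>UNIV. fst v $ k *\<^sub>R tderiv k z)"
  have w: "fst w = 0" "jproj w = jproj (cvert z v)"
    unfolding w_def by (rule jproj_horizontal)+
  have lin: "linear (FD T z)" by (rule smooth_on_FD_linear[OF smooth_T z])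
  have lin\<phi>: "linear (FD ?\<phi> (fst z))"
    by (rule smooth_on_FD_linear[OF B.charts_transition(2)[OF fibred_chartD(2)[OF f] fibred_chartD(2)[OF f']] fst_overlap[OF z]])
  have veq: "v = (\<Sum>k\<in>UNIV. fst v $ k *\<^sub>R tderiv k z) + w" by (simp add: w_def)
  have "FD T z ((\<Sum>k\<in>UNIV. c k *\<^sub>R tderiv k z) + w) = (\<Sum>k\<in>UNIV. c k *\<^sub>R FD T z (tderiv k z)) + FD T z w" for c
    by (simp add: linear_add[OF lin] linear_sum[OF lin] linear_cmul[OF lin])
  note Tv = trans[OF arg_cong[OF veq, of "FD T z"] this]
  have \<phi>v: "FD ?\<phi> (fst z) (fst v) $ i = (\<Sum>k\<in>UNIV. fst v $ k * FD ?\<phi> (fst z) (axis k 1) $ i)" for i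
  proof -
    have e: "fst v = (\<Sum>k\<in>UNIV. fst v $ k *\<^sub>R axis k 1)"
      using vec_lambda_sum_axis[of "\<lambda>k. fst v $ k"] by simp
    have "FD ?\<phi> (fst z) (fst v) = FD ?\<phi> (fst z) (\<Sum>k\<in>UNIV. fst v $ k *\<^sub>R axis k 1)"
      by (rule arg_cong[OF e])
    also have "\<dots> = (\<Sum>k\<in>UNIV. fst v $ k *\<^sub>R FD ?\<phi> (fst z) (axis k 1))"
      by (simp add: linear_sum[OF lin\<phi>] linear_cmul[OF lin\<phi>])
    finally show ?thesis by simp
  qed
  have "jproj (cvert (T z) (FD T z v)) = jproj (FD T z w)"
  proof (rule jmodel_eqI)
    show "fst (jproj (cvert (T z) (FD T z v))) = fst (jproj (FD T z w))"
      using w(1) linear_0[OF lin\<phi>] by (simp add: fst_FD_T[OF z])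
    fix \<alpha> and J :: "'n \<Rightarrow> nat" assume J: "mdeg J < CARD('k)"
    have "snd (jproj (cvert (T z) (FD T z v))) $ jx \<alpha> J = ctheta \<alpha> J (T z) (FD T z v)"
      using J cvert_nth[OF mdeg_less_option[OF J], where \<alpha> = \<alpha> and z = "T z" and v = "FD T z v"] by simp
    also have "\<dots> = (\<Sum>k\<in>UNIV. fst v $ k * snd (FD T z (tderiv k z)) $ jx \<alpha> J) + snd (FD T z w) $ jx \<alpha> J
        - (\<Sum>i\<in>UNIV. snd (T z) $ jx \<alpha> (madd J i) * (\<Sum>k\<in>UNIV. fst v $ k * FD ?\<phi> (fst z) (axis k 1) $ i))"
    proof -
      have "snd (FD T z v) $ jx \<alpha> J = (\<Sum>k\<in>UNIV. fst v $ k * snd (FD T z (tderiv k z)) $ jx \<alpha> J) + snd (FD T z w) $ jx \<alpha> J"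
        by (subst Tv) (simp add: snd_sum)
      then show ?thesis unfolding ctheta_def fst_FD_T[OF z] \<phi>v by simp
    qed
    also have "(\<Sum>k\<in>UNIV. fst v $ k * snd (FD T z (tderiv k z)) $ jx \<alpha> J) =
        (\<Sum>i\<in>UNIV. snd (T z) $ jx \<alpha> (madd J i) * (\<Sum>k\<in>UNIV. fst v $ k * FD ?\<phi> (fst z) (axis k 1) $ i))"
      unfolding FD_T_tderiv[OF z J] sum_distrib_left
      by (subst sum.swap) (simp add: mult_ac)
    finally show "snd (jproj (cvert (T z) (FD T z v))) $ jx \<alpha> J = snd (jproj (FD T z w)) $ jx \<alpha> J"
      using J by simp
  qed
  then show ?thesis unfolding jproj_FD_T[OF z] w(2) .
qed

end

end

section \<open>The number of contact forms\<close>

text \<open>Listing the values of a multi-index gives a composition of \<open>N\<close> into as many parts as there are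
  variables.\<close>

lemma card_mdeg_eq: "card {I :: 'n::finite \<Rightarrow> nat. mdeg I = N} = (N + CARD('n) - 1) choose N"
proof -
  obtain xs :: "'n list" where xs: "set xs = UNIV" "distinct xs"
    using finite_distinct_list[of "UNIV :: 'n set"] by auto
  have len: "length xs = CARD('n)" using distinct_card[OF xs(2)] xs(1) by simp
  have "bij_betw (\<lambda>I. map I xs) {I :: 'n \<Rightarrow> nat. mdeg I = N} {l. length l = CARD('n) \<and> sum_list l = N}"
    unfolding bij_betw_def
  proof (intro conjI equalityI subsetI)
    show "inj_on (\<lambda>I. map I xs) {I. mdeg I = N}"
      using xs(1) by (auto simp: inj_on_def map_eq_conv)
    have s: "sum_list (map I xs) = mdeg I" for I :: "'n \<Rightarrow> nat"
      using sum_list_distinct_conv_sum_set[OF xs(2), of I] xs(1) by (simp add: mdeg_def)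
    show "l \<in> {l. length l = CARD('n) \<and> sum_list l = N}" if "l \<in> (\<lambda>I. map I xs) ` {I. mdeg I = N}" for l
      using that s len by auto
    fix l :: "nat list" assume l: "l \<in> {l. length l = CARD('n) \<and> sum_list l = N}"
    define I where "I i = the (map_of (zip xs l) i)" for i
    have "map I xs = l"
    proof (rule nth_equalityI)
      show "length (map I xs) = length l" using l len by simp
      fix i assume "i < length (map I xs)"
      then have i: "i < length xs" "i < length l" using l len by simp_all
      have "map_of (zip xs l) (xs ! i) = Some (l ! i)"
        by (rule map_of_zip_nth) (use l len xs(2) i in simp_all)
      then show "map I xs ! i = l ! i" using i by (simp add: I_def)
    qed
    then show "l \<in> (\<lambda>I. map I xs) ` {I. mdeg I = N}" using l s[of I] by (auto intro!: image_eqI[of _ _ I])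
  qed
  then have "card {I :: 'n \<Rightarrow> nat. mdeg I = N} = card {l :: nat list. length l = CARD('n) \<and> sum_list l = N}"
    by (rule bij_betw_same_card)
  also have "\<dots> = (N + CARD('n) - 1) choose N" by (rule card_length_sum_list)
  finally show ?thesis .
qed

lemma card_mdeg_le: "card {I :: 'n::finite \<Rightarrow> nat. mdeg I \<le> s} = (CARD('n) + s) choose s"
proof -
  obtain n where n: "CARD('n) = Suc n" using zero_less_card_finite[where 'a = 'n] gr0_implies_Suc by blast
  have "{I :: 'n \<Rightarrow> nat. mdeg I \<le> s} = (\<Union>N\<in>{..s}. {I. mdeg I = N})" by auto
  then have "card {I :: 'n \<Rightarrow> nat. mdeg I \<le> s} = card (\<Union>N\<in>{..s}. {I :: 'n \<Rightarrow> nat. mdeg I = N})" by simp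
  also have "\<dots> = (\<Sum>N\<le>s. card {I :: 'n \<Rightarrow> nat. mdeg I = N})"
  proof (rule card_UN_disjoint)
    show "\<forall>N\<in>{..s}. finite {I :: 'n \<Rightarrow> nat. mdeg I = N}"
      by (intro ballI finite_subset[OF _ finite_mindices[of s]]) (auto simp: mindices_def)
  qed auto
  also have "\<dots> = (\<Sum>N\<le>s. (n + N) choose N)" by (simp add: card_mdeg_eq n add.commute)
  also have "\<dots> = Suc (n + s) choose s" by (rule sum_choose_lower)
  finally show ?thesis by (simp add: n)
qed

lemma card_jidx: "CARD(('m::finite, 'n::finite, 'k::finite) jidx) = CARD('m) * ((CARD('n) + CARD('k) - 1) choose (CARD('k) - 1))"
proof -
  have "CARD(('m, 'n, 'k) jidx) = (\<Sum>A\<in>(UNIV :: ('m, 'n, 'k) jidx set). 1)" by simp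
  also have "\<dots> = CARD('m) * card {I :: 'n \<Rightarrow> nat. mdeg I < CARD('k)}"
    by (simp only: sum_jidx) simp
  also have "{I :: 'n \<Rightarrow> nat. mdeg I < CARD('k)} = {I. mdeg I \<le> CARD('k) - 1}"
    using mindices_card[where 'k = 'k and 'n = 'n] by (simp add: mindices_def)
  finally show ?thesis using zero_less_card_finite[where 'a = 'k] by (simp add: card_mdeg_le)
qed


section \<open>The contact structure on the jet manifold\<close>

text \<open>Turns sums over \<open>\<alpha>\<close> and \<open>I\<close> into vectors, so that the formulas with basis vectors need no manipulation of
  sums.\<close>

lemma vertical_expansion:
  fixes g :: "'m::finite \<Rightarrow> ('n::finite \<Rightarrow> nat) \<Rightarrow> real"
  shows "(0, \<chi> A. case Rep_jidx A of (\<alpha>, I) \<Rightarrow> g \<alpha> I) =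
    (\<Sum>\<alpha>\<in>UNIV. \<Sum>I | mdeg I < CARD('s). g \<alpha> I *\<^sub>R ((0, axis (jx \<alpha> I) 1) :: ('n, 'm, 's::finite) jmodel))"
proof -
  let ?h = "\<lambda>A :: ('m, 'n, 's) jidx. case Rep_jidx A of (\<alpha>, I) \<Rightarrow> g \<alpha> I"
  have "((0, \<chi> A. ?h A) :: ('n, 'm, 's) jmodel) = (0, \<Sum>A\<in>UNIV. ?h A *\<^sub>R axis A 1)"
    by (simp only: vec_lambda_sum_axis)
  also have "\<dots> = (\<Sum>A\<in>UNIV. ?h A *\<^sub>R (0, axis A 1))"
    by (simp add: prod_eq_iff fst_sum snd_sum)
  also have "\<dots> = (\<Sum>\<alpha>\<in>UNIV. \<Sum>I | mdeg I < CARD('s). ?h (jx \<alpha> I) *\<^sub>R (0, axis (jx \<alpha> I) 1))"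
    by (rule sum_jidx)
  also have "\<dots> = (\<Sum>\<alpha>\<in>UNIV. \<Sum>I | mdeg I < CARD('s). g \<alpha> I *\<^sub>R (0, axis (jx \<alpha> I) 1))"
    by (intro sum.cong refl) (simp add: Rep_jidx_jx)
  finally show ?thesis .
qed

lemma vec_jidx_eqI:
  fixes y y' :: "real^('m::finite, 'n::finite, 's::finite) jidx"
  assumes "\<And>\<alpha> I. mdeg I < CARD('s) \<Longrightarrow> y $ jx \<alpha> I = y' $ jx \<alpha> I"
  shows "y = y'"
  using jmodel_eqI[of "(0, y)" "(0, y')"] assms by simp

context fibred
begin

context
  fixes f and M :: "(('q, 'e) jet, ('n, 'm, 'k::finite option) jmodel) mfd"
    and c :: "(('q, 'e) jet, ('n, 'm, 'k option) jmodel) chart"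
    and N :: "(('q, 'e) jet, ('n, 'm, 'k) jmodel) mfd"
    and d :: "(('q, 'e) jet, ('n, 'm, 'k) jmodel) chart"
    and \<eta> :: "('q, 'e) jet \<Rightarrow> ('n, 'm, 'k option) jmodel \<Rightarrow> real^('m, 'n, 'k) jidx"
  assumes f: "f \<in> fibred_charts P"
  defines "M \<equiv> jet_manifold P" and "c \<equiv> jet_chart P f" and "N \<equiv> jet_manifold P" and "d \<equiv> jet_chart P f"
    and "\<eta> \<equiv> eta P f"
begin

interpretation M: smooth_atlas M
  unfolding M_def by (rule jet_atlas)

interpretation N: smooth_atlas N
  unfolding N_def by (rule jet_atlas)

lemma cM: "c \<in> charts M" and dN: "d \<in> charts N"
  unfolding c_def M_def d_def N_def by (rule jet_chart_charts[OF f])+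

lemma fst_c: "fst (snd c p) = snd (snd f) (fst p)"
  by (simp add: c_def jet_chart_def)

lemma proj_in_d: "p \<in> fst c \<Longrightarrow> jet_proj P (CARD('k) - 1) p \<in> fst d"
  and d_proj: "p \<in> fst c \<Longrightarrow> snd d (jet_proj P (CARD('k) - 1) p) = jproj (snd c p)"
  unfolding c_def d_def by (rule jet_proj_chart(1)[OF f], assumption, rule jet_proj_chart(2)[OF f], assumption)

subsection \<open>Contact forms and their combinations in coordinates\<close>

lemma theta_coord: "theta P f \<alpha> I p v = ctheta \<alpha> I (snd c p) (tcoord M c p v)"
  by (simp add: theta_def Let_def ctheta_def c_def M_def)

lemma eta_comp_coord:
  "mdeg J < CARD('k) \<Longrightarrow> eta_comp P f \<alpha> J p v = ceta (snd c p) (tcoord M c p v) $ jx \<alpha> J"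
  unfolding eta_comp_def ceta_nth mindices_card theta_coord ccoef_def dmon_def fst_c by simp

lemma eta_nth: "mdeg J < CARD('k) \<Longrightarrow> \<eta> p v $ jx \<alpha> J = eta_comp P f \<alpha> J p v"
proof -
  assume J: "mdeg J < CARD('k)"
  have "((0, \<eta> p v) :: ('n, 'm, 'k) jmodel) = (0, \<chi> A. case Rep_jidx A of (\<alpha>, I) \<Rightarrow> eta_comp P f \<alpha> I p v)"
    unfolding vertical_expansion \<eta>_def eta_def mindices_card by (simp add: prod_eq_iff fst_sum snd_sum)
  then show ?thesis by (simp add: Rep_jidx_jx[OF J])
qed

lemma eta_coord: "\<eta> p v = ceta (snd c p) (tcoord M c p v)"
  by (rule vec_jidx_eqI) (simp add: eta_nth eta_comp_coord)

lemma partial_u_coord: "partial_u P f \<alpha> I p = tvec M c p (0, axis (jx \<alpha> I) 1)"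
  "partial_u P f \<alpha> I p = tvec N d p (0, axis (jx \<alpha> I) 1)"
  by (simp_all add: partial_u_def M_def N_def c_def d_def)

lemma reeb_coord:
  assumes p: "p \<in> fst c"
  shows "reeb P f \<alpha> J p = tvec M c p (creeb \<alpha> J (fst (snd c p)))"
  unfolding reeb_def creeb_def fst_c dmon_def[symmetric] partial_u_coord(1)
  by (simp only: linear_sum[OF M.linear_tvec[OF cM p]] linear_cmul[OF M.linear_tvec[OF cM p]])

lemma cvert_expansion:
  "cvert z v = (\<Sum>\<alpha>\<in>UNIV. \<Sum>I | mdeg I < CARD('k). ctheta \<alpha> I z v *\<^sub>R ((0, axis (jx \<alpha> I) 1) :: ('n, 'm, 'k option) jmodel))"
proof -
  have "(\<Sum>I | mdeg I < CARD('k option). (if mdeg I < CARD('k) then ctheta \<alpha> I z v else 0) *\<^sub>R ((0, axis (jx \<alpha> I) 1) :: ('n, 'm, 'k option) jmodel))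
    = (\<Sum>I | mdeg I < CARD('k). ctheta \<alpha> I z v *\<^sub>R (0, axis (jx \<alpha> I) 1))" for \<alpha>
    by (rule sum.mono_neutral_cong_right[OF finite_mdeg_less]) (auto simp: zero_prod_def)
  then show ?thesis unfolding cvert_def vertical_expansion by simp
qed

lemma jproj_cvert_expansion:
  "jproj (cvert z v) = (\<Sum>\<alpha>\<in>UNIV. \<Sum>I | mdeg I < CARD('k). ctheta \<alpha> I z v *\<^sub>R ((0, axis (jx \<alpha> I) 1) :: ('n, 'm, 'k) jmodel))"
  unfolding vertical_expansion[symmetric]
proof (rule jmodel_eqI)
  fix \<alpha> and I :: "'n \<Rightarrow> nat" assume I: "mdeg I < CARD('k)"
  then show "snd (jproj (cvert z v)) $ jx \<alpha> I = snd ((0, \<chi> A. case Rep_jidx A of (\<alpha>, I) \<Rightarrow> ctheta \<alpha> I z v) :: ('n, 'm, 'k) jmodel) $ jx \<alpha> I"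
    using cvert_nth[OF mdeg_less_option[OF I], where \<alpha> = \<alpha> and z = z and v = v] by (simp add: Rep_jidx_jx[OF I])
qed simp

lemma theta_sum_M:
  assumes p: "p \<in> fst c"
  shows "(\<Sum>\<alpha>\<in>UNIV. \<Sum>I\<in>mindices (CARD('k) - 1). theta P f \<alpha> I p v *\<^sub>R partial_u P f \<alpha> I p)
    = tvec M c p (cvert (snd c p) (tcoord M c p v))"
  unfolding mindices_card theta_coord partial_u_coord(1) cvert_expansion
  by (simp only: linear_sum[OF M.linear_tvec[OF cM p]] linear_cmul[OF M.linear_tvec[OF cM p]])

lemma theta_sum_N:
  assumes p: "p \<in> fst c"
  shows "(\<Sum>\<alpha>\<in>UNIV. \<Sum>I\<in>mindices (CARD('k) - 1). theta P f \<alpha> I p v *\<^sub>R partial_u P f \<alpha> I (jet_proj P (CARD('k) - 1) p))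
    = tvec N d (jet_proj P (CARD('k) - 1) p) (jproj (cvert (snd c p) (tcoord M c p v)))"
  unfolding mindices_card theta_coord partial_u_coord(2) jproj_cvert_expansion
  by (simp only: linear_sum[OF N.linear_tvec[OF dN proj_in_d[OF p]]] linear_cmul[OF N.linear_tvec[OF dN proj_in_d[OF p]]])

lemma tvec_eq_0_iff:
  assumes p: "p \<in> fst c"
  shows "tvec M c p w = 0 \<longleftrightarrow> w = 0"
  using M.tcoord_tvec[OF cM p, of w] linear_0[OF M.linear_tvec[OF cM p]] linear_0[OF M.linear_tcoord[OF cM p]] by metis

lemma tvec_N_eq_0_iff:
  assumes p: "p \<in> fst d"
  shows "tvec N d p w = 0 \<longleftrightarrow> w = 0"
  using N.tcoord_tvec[OF dN p, of w] linear_0[OF N.linear_tvec[OF dN p]] linear_0[OF N.linear_tcoord[OF dN p]] by metis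

lemma T_proj_coord:
  "p \<in> fst c \<Longrightarrow> T_proj P p v = tvec N d (jet_proj P (CARD('k) - 1) p) (jproj (tcoord M c p v))"
  unfolding c_def d_def M_def N_def by (rule T_proj_chart[OF f])

lemma linear_T_proj:
  assumes p: "p \<in> fst c"
  shows "linear (T_proj P p :: _ \<Rightarrow> ('n, 'm, 'k) jmodel)"
proof -
  have "linear (\<lambda>v. tvec N d (jet_proj P (CARD('k) - 1) p) (jproj (tcoord M c p v)))"
    using linear_compose[OF linear_compose[OF M.linear_tcoord[OF cM p] linear_jproj] N.linear_tvec[OF dN proj_in_d[OF p]]]
    by (simp add: o_def)
  moreover have "T_proj P p = (\<lambda>v. tvec N d (jet_proj P (CARD('k) - 1) p) (jproj (tcoord M c p v)))"
    using T_proj_coord[OF p] by blast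
  ultimately show ?thesis by simp
qed

text \<open>After the order of summation is exchanged, the coefficient of \<open>\<partial>/\<partial>u\<^sup>\<alpha>\<^sub>I\<close> is the combination of the \<open>\<eta>\<^sup>\<alpha>\<^sub>J\<close> that recovers
  \<open>\<theta>\<^sup>\<alpha>\<^sub>I\<close>.\<close>

lemma reeb_lift_eta:
  assumes p: "p \<in> fst c"
  shows "reeb_lift P f p (\<eta> p v) =
      (\<Sum>\<alpha>\<in>UNIV. \<Sum>J\<in>mindices (CARD('k) - 1). eta_comp P f \<alpha> J p v *\<^sub>R reeb P f \<alpha> J p)"
    and "reeb_lift P f p (\<eta> p v) = tvec M c p (cvert (snd c p) (tcoord M c p v))"
proof -
  let ?x = "fst (snd c p)" and ?e = "\<lambda>\<alpha> J. ceta (snd c p) (tcoord M c p v) $ jx \<alpha> J"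
  let ?ax = "\<lambda>\<alpha> I. (0, axis (jx \<alpha> I) 1) :: ('n, 'm, 'k option) jmodel"
  show 1: "reeb_lift P f p (\<eta> p v) =
      (\<Sum>\<alpha>\<in>UNIV. \<Sum>J\<in>mindices (CARD('k) - 1). eta_comp P f \<alpha> J p v *\<^sub>R reeb P f \<alpha> J p)"
    unfolding reeb_lift_def mindices_card by (intro sum.cong refl) (simp add: eta_nth)
  also have "\<dots> = tvec M c p (\<Sum>\<alpha>\<in>UNIV. \<Sum>J | mdeg J < CARD('k). ?e \<alpha> J *\<^sub>R creeb \<alpha> J ?x)"
    unfolding mindices_card
    by (simp add: linear_sum[OF M.linear_tvec[OF cM p]] linear_cmul[OF M.linear_tvec[OF cM p]] reeb_coord[OF p] eta_comp_coord)
  also have "(\<Sum>\<alpha>\<in>UNIV. \<Sum>J | mdeg J < CARD('k). ?e \<alpha> J *\<^sub>R creeb \<alpha> J ?x) = cvert (snd c p) (tcoord M c p v)"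
    unfolding cvert_expansion
  proof (rule sum.cong[OF refl])
    fix \<alpha> :: 'm
    let ?R = "{I :: 'n \<Rightarrow> nat. mdeg I < CARD('k)}"
    have le: "{I. I \<le> J} = {I \<in> ?R. I \<le> J}" if "J \<in> ?R" for J
      using that mdeg_mono by (auto intro: le_less_trans)
    have "(\<Sum>J\<in>?R. ?e \<alpha> J *\<^sub>R creeb \<alpha> J ?x) = (\<Sum>J\<in>?R. \<Sum>I\<in>?R. if I \<le> J then (dmon (J - I) ?x * ?e \<alpha> J) *\<^sub>R ?ax \<alpha> I else 0)"
    proof (rule sum.cong[OF refl])
      fix J assume J: "J \<in> ?R"
      have "?e \<alpha> J *\<^sub>R creeb \<alpha> J ?x = (\<Sum>I\<in>{I \<in> ?R. I \<le> J}. (dmon (J - I) ?x * ?e \<alpha> J) *\<^sub>R ?ax \<alpha> I)"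
        unfolding creeb_def le[OF J, symmetric] scaleR_sum_right scaleR_scaleR by (simp only: mult.commute)
      then show "?e \<alpha> J *\<^sub>R creeb \<alpha> J ?x = (\<Sum>I\<in>?R. if I \<le> J then (dmon (J - I) ?x * ?e \<alpha> J) *\<^sub>R ?ax \<alpha> I else 0)"
        by (simp only: sum.inter_filter[OF finite_mdeg_less])
    qed
    also have "\<dots> = (\<Sum>I\<in>?R. \<Sum>J\<in>?R. if I \<le> J then (dmon (J - I) ?x * ?e \<alpha> J) *\<^sub>R ?ax \<alpha> I else 0)"
      by (rule sum.swap)
    also have "\<dots> = (\<Sum>I\<in>?R. ctheta \<alpha> I (snd c p) (tcoord M c p v) *\<^sub>R ?ax \<alpha> I)"
    proof (rule sum.cong[OF refl])
      fix I assume "I \<in> ?R"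
      then have I: "mdeg I < CARD('k)" by simp
      have "(\<Sum>J\<in>?R. if I \<le> J then (dmon (J - I) ?x * ?e \<alpha> J) *\<^sub>R ?ax \<alpha> I else 0)
         = (\<Sum>J\<in>{J \<in> ?R. I \<le> J}. (dmon (J - I) ?x * ?e \<alpha> J) *\<^sub>R ?ax \<alpha> I)"
        by (simp only: sum.inter_filter[OF finite_mdeg_less])
      also have "{J \<in> ?R. I \<le> J} = {J. I \<le> J \<and> mdeg J < CARD('k)}" by auto
      finally show "(\<Sum>J\<in>?R. if I \<le> J then (dmon (J - I) ?x * ?e \<alpha> J) *\<^sub>R ?ax \<alpha> I else 0)
         = ctheta \<alpha> I (snd c p) (tcoord M c p v) *\<^sub>R ?ax \<alpha> I"
        unfolding scaleR_sum_left[symmetric] ctheta_from_ceta[OF I] .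
    qed
    finally show "(\<Sum>J\<in>?R. ?e \<alpha> J *\<^sub>R creeb \<alpha> J ?x) = (\<Sum>I\<in>?R. ctheta \<alpha> I (snd c p) (tcoord M c p v) *\<^sub>R ?ax \<alpha> I)" .
  qed
  finally show "reeb_lift P f p (\<eta> p v) = tvec M c p (cvert (snd c p) (tcoord M c p v))" .
qed

subsection \<open>\<open>\<eta>\<close> as a contact form\<close>

lemma openin_U: "openin (mtop M) (fst c)"
  by (rule M.openin_chart[OF cM])

lemma open_cU: "open (snd c ` fst c)"
  by (rule M.open_chart_image[OF cM])

lemma form_ker_eta_0: "form_ker \<eta> p = {v. \<eta> p v = 0}"
  unfolding form_ker_def vec_eq_iff zero_index by blast

lemma form_ker_eta: "form_ker \<eta> p = {v. cvert (snd c p) (tcoord M c p v) = 0}"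
  unfolding form_ker_eta_0 eta_coord ceta_eq_0_iff ..

lemma smooth_eta: "smooth_one_form M (fst c) \<eta>"
  by (rule M.smooth_one_form_chart[OF cM openin_U subset_refl linear_ceta smooth_ceta[OF open_cU] eta_coord])

lemma ext_deriv_eta:
  assumes p: "p \<in> fst c"
  shows "ext_deriv M \<eta> p v w =
    FD (\<lambda>y. ceta y (tcoord M c p w)) (snd c p) (tcoord M c p v) -
    FD (\<lambda>y. ceta y (tcoord M c p v)) (snd c p) (tcoord M c p w)"
  by (rule M.ext_deriv_chart[OF cM openin_U subset_refl linear_ceta smooth_ceta[OF open_cU] eta_coord p])

lemma dform_ker_eta:
  assumes p: "p \<in> fst c"
  shows "dform_ker M \<eta> p = {v. fst (tcoord M c p v) = 0 \<and>
    (\<forall>\<alpha> K. mdeg K = CARD('k) \<longrightarrow> snd (tcoord M c p v) $ jx \<alpha> K = 0)}"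
proof -
  have "v \<in> dform_ker M \<eta> p \<longleftrightarrow>
    (\<forall>w \<alpha> J. mdeg J < CARD('k) \<longrightarrow> FD (\<lambda>y. ceta y w) (snd c p) (tcoord M c p v) $ jx \<alpha> J -
       FD (\<lambda>y. ceta y (tcoord M c p v)) (snd c p) w $ jx \<alpha> J = 0)" (is "_ \<longleftrightarrow> ?r") for v
  proof
    assume v: "v \<in> dform_ker M \<eta> p"
    show ?r
    proof (intro allI impI)
      fix w \<alpha> J
      have "ext_deriv M \<eta> p v (tvec M c p w) $ jx \<alpha> J = 0"
        using v unfolding dform_ker_def by blast
      then show "FD (\<lambda>y. ceta y w) (snd c p) (tcoord M c p v) $ jx \<alpha> J -
          FD (\<lambda>y. ceta y (tcoord M c p v)) (snd c p) w $ jx \<alpha> J = 0"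
        unfolding ext_deriv_eta[OF p] M.tcoord_tvec[OF cM p] by simp
    qed
  next
    assume r: ?r
    have "ext_deriv M \<eta> p v w $ A = 0" for w A
    proof -
      obtain \<alpha> J where A: "A = jx \<alpha> J" "mdeg J < CARD('k)" by (rule jidx_cases)
      show ?thesis
        unfolding ext_deriv_eta[OF p] A(1) using r[rule_format, OF A(2), of "tcoord M c p w" \<alpha>] by simp
    qed
    then show "v \<in> dform_ker M \<eta> p" by (simp add: dform_ker_def)
  qed
  then show ?thesis unfolding dceta_kernel by blast
qed

lemma linear_eta:
  assumes p: "p \<in> fst c"
  shows "linear (\<eta> p :: ('n, 'm, 'k option) jmodel \<Rightarrow> _)"
proof -
  have "\<eta> p = ceta (snd c p) \<circ> tcoord M c p"
    unfolding o_def by (rule ext, rule eta_coord)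
  then show ?thesis using linear_compose[OF M.linear_tcoord[OF cM p] linear_ceta] by (simp only:)
qed

lemma eta_reeb:
  assumes p: "p \<in> fst c"
  shows "\<eta> p (case Rep_jidx A of (\<alpha>, J) \<Rightarrow> reeb P f \<alpha> J p) $ B = (if A = B then 1 else 0)"
proof -
  obtain \<alpha> J where A: "A = jx \<alpha> J" "mdeg J < CARD('k)" by (rule jidx_cases)
  obtain \<beta> K where B: "B = jx \<beta> K" "mdeg K < CARD('k)" by (rule jidx_cases)
  show ?thesis
    unfolding A(1) B(1) Rep_jidx_jx[OF A(2)] prod.case eta_coord reeb_coord[OF p] M.tcoord_tvec[OF cM p]
      ceta_creeb[OF A(2) B(2)] jx_eq_iff[OF A(2) B(2)] ..
qed

lemma surj_eta:
  assumes p: "p \<in> fst c"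
  shows "surj (\<eta> p :: ('n, 'm, 'k option) jmodel \<Rightarrow> _)"
proof -
  let ?R = "\<lambda>A. case Rep_jidx A of (\<alpha>, J) \<Rightarrow> reeb P f \<alpha> J p"
  have "\<eta> p (\<Sum>A\<in>UNIV. y $ A *\<^sub>R ?R A) = y" for y
    unfolding linear_sum[OF linear_eta[OF p]] linear_cmul[OF linear_eta[OF p]]
    by (rule vec_eq_iff[THEN iffD2]) (simp add: eta_reeb[OF p] if_distrib[of "(*) _"] cong: if_cong)
  then show ?thesis by (rule surjI)
qed

text \<open>The rank is that of the surjective map \<open>\<eta>\<close>. Removing the vertical part is a projection onto the kernel, so the
  images of the basis vectors span it and depend smoothly on the point.\<close>

lemma regular_eta: "regular_distribution M (fst c) CARD(('m, 'n, 'k) jidx) (form_ker \<eta>)"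
  unfolding regular_distribution_def
proof (intro conjI ballI)
  fix p assume p: "p \<in> fst c"
  show sub: "subspace (form_ker \<eta> p)" if "p \<in> fst c" for p
    unfolding form_ker_eta_0 by (rule subspace_kernel'[OF linear_eta[OF that]])
  show "dim (form_ker \<eta> p) + CARD(('m, 'n, 'k) jidx) = DIM(('n, 'm, 'k option) jmodel)"
    unfolding form_ker_eta_0 using dim_kernel_surj[OF linear_eta[OF p] surj_eta[OF p]] by simp
  define X where "X b q = tvec M c q (b - cvert (snd c q) b)" for b q
  have "form_ker \<eta> q = span ((\<lambda>X. X q) ` (X ` Basis))" if q: "q \<in> fst c" for q
  proof
    show "span ((\<lambda>X. X q) ` (X ` Basis)) \<subseteq> form_ker \<eta> q"
    proof (rule span_minimal[OF _ sub[OF q]], rule subsetI)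
      fix v assume "v \<in> (\<lambda>X. X q) ` (X ` Basis)"
      then obtain b where v: "v = X b q" by blast
      have "cvert (snd c q) (b - cvert (snd c q) b) = 0"
      proof (unfold cvert_eq_0_iff, intro allI impI)
        fix \<alpha> and I :: "'n \<Rightarrow> nat" assume "mdeg I < CARD('k)"
        then show "ctheta \<alpha> I (snd c q) (b - cvert (snd c q) b) = 0"
          by (simp add: linear_diff[OF linear_ctheta] ctheta_cvert)
      qed
      then show "v \<in> form_ker \<eta> q"
        unfolding form_ker_eta v X_def by (simp add: M.tcoord_tvec[OF cM q])
    qed
    show "form_ker \<eta> q \<subseteq> span ((\<lambda>X. X q) ` (X ` Basis))"
    proof
      fix v assume "v \<in> form_ker \<eta> q"
      then have 0: "cvert (snd c q) (tcoord M c q v) = 0" by (simp add: form_ker_eta)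
      let ?w = "tcoord M c q v"
      have l: "linear (\<lambda>b. b - cvert (snd c q) b)"
        by (rule linear_compose_sub[OF linear_ident linear_cvert])
      have "v = tvec M c q (?w - cvert (snd c q) ?w)" by (simp add: 0 M.tvec_tcoord[OF cM q])
      also have "\<dots> = (\<Sum>b\<in>Basis. (?w \<bullet> b) *\<^sub>R X b q)"
        unfolding X_def using linear_basis_expansion[OF linear_compose[OF l M.linear_tvec[OF cM q]], of ?w]
        by (simp add: o_def)
      finally have v: "v = (\<Sum>b\<in>Basis. (?w \<bullet> b) *\<^sub>R X b q)" .
      show "v \<in> span ((\<lambda>X. X q) ` (X ` Basis))"
        by (subst v) (intro span_sum span_scale span_base; blast)
    qed
  qed
  moreover have "smooth_vector_field M (fst c) Y" if Y: "Y \<in> X ` Basis" for Y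
  proof -
    obtain b where b: "Y = X b" using Y by blast
    have "smooth_on (snd c ` fst c) (\<lambda>z. b - cvert z b)"
      by (rule smooth_on_diff[OF smooth_on_const smooth_cvert[OF open_cU] open_cU])
    then show ?thesis
      by (rule M.smooth_vector_field_chart[OF cM openin_U subset_refl]) (simp add: b X_def)
  qed
  ultimately show "\<exists>V XX. openin (mtop M) V \<and> p \<in> V \<and> V \<subseteq> fst c \<and> finite XX \<and>
      (\<forall>X\<in>XX. smooth_vector_field M V X) \<and> (\<forall>q\<in>V. form_ker \<eta> q = span ((\<lambda>X. X q) ` XX))"
    using openin_U p by (intro exI[of _ "fst c"] exI[of _ "X ` Basis"]) simp
qed

text \<open>Subtracting the vertical part splits a vector along the two kernels. A vector in both has neither
  vertical part nor any other component. The kernel is non-zero since it contains \<open>\<partial>/\<partial>u\<^sup>\<alpha>\<^sub>K\<close> with \<open>|K| = r\<close>.\<close>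

lemma contact_form_eta: "contact_form M (fst c) \<eta>"
  unfolding contact_form_def
proof (intro conjI ballI)
  fix p assume p: "p \<in> fst c"
  let ?z = "snd c p"
  show "form_ker \<eta> p \<noteq> {0}"
  proof -
    obtain K :: "'n \<Rightarrow> nat" where K: "mdeg K = CARD('k)"
    proof -
      fix i :: 'n
      have "mdeg (\<lambda>j. if j = i then CARD('k) else 0) = CARD('k)" by (simp add: mdeg_def)
      then show ?thesis by (rule that)
    qed
    fix \<alpha> :: 'm
    define w :: "('n, 'm, 'k option) jmodel" where "w = (0, axis (jx \<alpha> K) 1)"
    have "cvert ?z w = 0"
    proof (unfold cvert_eq_0_iff, intro allI impI)
      fix \<beta> and I :: "'n \<Rightarrow> nat" assume I: "mdeg I < CARD('k)"
      have "(jx \<beta> I :: ('m, 'n, 'k option) jidx) \<noteq> jx \<alpha> K" using I K by (subst jx_eq_iff) auto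
      then show "ctheta \<beta> I ?z w = 0" by (simp add: ctheta_vertical w_def axis_def)
    qed
    then have "tvec M c p w \<in> form_ker \<eta> p" by (simp add: form_ker_eta M.tcoord_tvec[OF cM p])
    moreover have "tvec M c p w \<noteq> 0"
      unfolding tvec_eq_0_iff[OF p] by (simp add: w_def prod_eq_iff axis_eq_0_iff)
    ultimately show ?thesis by blast
  qed
  show "form_ker \<eta> p \<inter> dform_ker M \<eta> p = {0}"
  proof (intro equalityI subsetI)
    fix v assume "v \<in> form_ker \<eta> p \<inter> dform_ker M \<eta> p"
    then have v: "cvert ?z (tcoord M c p v) = 0" "fst (tcoord M c p v) = 0"
      "\<And>\<alpha> K. mdeg K = CARD('k) \<Longrightarrow> snd (tcoord M c p v) $ jx \<alpha> K = 0"
      by (auto simp: form_ker_eta dform_ker_eta[OF p])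
    have "tcoord M c p v = 0"
    proof (rule jmodel_eqI)
      fix \<alpha> and I :: "'n \<Rightarrow> nat" assume I: "mdeg I < CARD('k option)"
      show "snd (tcoord M c p v) $ jx \<alpha> I = snd (0 :: ('n, 'm, 'k option) jmodel) $ jx \<alpha> I"
      proof (cases "mdeg I < CARD('k)")
        case True
        then have "ctheta \<alpha> I ?z (tcoord M c p v) = 0" using v(1) by (simp add: cvert_eq_0_iff)
        then show ?thesis by (simp add: ctheta_vertical[OF v(2)])
      next
        case False
        then show ?thesis using I v(3)[of I \<alpha>] by simp
      qed
    qed (simp add: v(2))
    then show "v \<in> {0}" using M.tvec_tcoord[OF cM p, of v] linear_0[OF M.linear_tvec[OF cM p]] by simp
  next
    fix v :: "('n, 'm, 'k option) jmodel" assume "v \<in> {0}"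
    then show "v \<in> form_ker \<eta> p \<inter> dform_ker M \<eta> p"
      using linear_0[OF M.linear_tcoord[OF cM p]] linear_0[OF linear_cvert]
      by (simp add: form_ker_eta dform_ker_eta[OF p])
  qed
  show "{v + w |v w. v \<in> form_ker \<eta> p \<and> w \<in> dform_ker M \<eta> p} = UNIV"
  proof (intro equalityI subsetI UNIV_I CollectI)
    fix v :: "('n, 'm, 'k option) jmodel"
    let ?v = "tcoord M c p v"
    let ?u = "cvert ?z ?v"
    have 1: "tvec M c p ?u \<in> dform_ker M \<eta> p"
    proof -
      have "snd ?u $ jx \<alpha> K = 0" if "mdeg K = CARD('k)" for \<alpha> K
        using that cvert_nth[of K, where \<alpha> = \<alpha> and z = ?z and v = ?v] by simp
      then show ?thesis by (simp add: dform_ker_eta[OF p] M.tcoord_tvec[OF cM p])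
    qed
    have "cvert ?z (?v - ?u) = 0"
    proof (unfold cvert_eq_0_iff, intro allI impI)
      fix \<alpha> and I :: "'n \<Rightarrow> nat" assume "mdeg I < CARD('k)"
      then show "ctheta \<alpha> I ?z (?v - ?u) = 0"
        by (simp add: linear_diff[OF linear_ctheta] ctheta_cvert)
    qed
    then have 2: "tvec M c p (?v - ?u) \<in> form_ker \<eta> p"
      by (simp add: form_ker_eta M.tcoord_tvec[OF cM p])
    have 3: "v = tvec M c p (?v - ?u) + tvec M c p ?u"
      by (simp add: linear_diff[OF M.linear_tvec[OF cM p]] M.tvec_tcoord[OF cM p])
    show "\<exists>x y. v = x + y \<and> x \<in> form_ker \<eta> p \<and> y \<in> dform_ker M \<eta> p"
      by (intro exI conjI, rule 3, rule 2, rule 1)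
  qed
qed (rule openin_U smooth_eta regular_eta)+

lemma reeb_vector_fields_eta:
  "reeb_vector_fields M (fst c) \<eta> (\<lambda>A. case Rep_jidx A of (\<alpha>, J) \<Rightarrow> reeb P f \<alpha> J)"
proof -
  let ?R = "\<lambda>A :: ('m, 'n, 'k) jidx. case Rep_jidx A of (\<alpha>, J) \<Rightarrow> reeb P f \<alpha> J"
  have Rp: "?R A p = (case Rep_jidx A of (\<alpha>, J) \<Rightarrow> reeb P f \<alpha> J p)" for A p
    by (simp add: case_prod_unfold)
  have sm: "smooth_vector_field M (fst c) (?R A)" for A
  proof -
    obtain \<alpha> J where A: "Rep_jidx A = (\<alpha>, J)" by (cases "Rep_jidx A")
    have "smooth_on (snd c ` fst c) (\<lambda>z. creeb \<alpha> J (fst z) :: ('n, 'm, 'k option) jmodel)"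
      by (rule smooth_on_compose[OF smooth_creeb[OF open_UNIV] smooth_on_fst[OF smooth_on_id open_cU] open_cU subset_UNIV])
    then have "smooth_vector_field M (fst c) (reeb P f \<alpha> J)"
      by (rule M.smooth_vector_field_chart[OF cM openin_U subset_refl _ reeb_coord])
    then show ?thesis by (simp add: A)
  qed
  have kerR: "?R A p \<in> dform_ker M \<eta> p" if p: "p \<in> fst c" for A p
  proof -
    obtain \<alpha> J where A: "A = jx \<alpha> J" "mdeg J < CARD('k)" by (rule jidx_cases)
    have "snd (creeb \<alpha> J x :: ('n, 'm, 'k option) jmodel) $ jx \<beta> K = 0" if K: "mdeg K = CARD('k)" for \<beta> K x
    proof -
      have "\<not> K \<le> J" using mdeg_mono[of K J] K A(2) by auto
      then show ?thesis using creeb_nth[OF A(2), of K] K by simp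
    qed
    then show ?thesis
      unfolding dform_ker_eta[OF p] A(1) Rep_jidx_jx[OF A(2)] prod.case reeb_coord[OF p]
      by (simp add: M.tcoord_tvec[OF cM p])
  qed
  have R: "reeb_conditions M (fst c) \<eta> ?R"
    unfolding reeb_conditions_def
  proof (intro conjI allI ballI)
    show "smooth_vector_field M (fst c) (?R A)" for A by (rule sm)
    show "\<eta> p (?R A p) $ B = (if A = B then 1 else 0)" if "p \<in> fst c" for p A B
      unfolding Rp by (rule eta_reeb[OF that])
    show "ext_deriv M \<eta> p (?R A p) w $ B = 0" if "p \<in> fst c" for p A B w
      using kerR[OF that, of A] unfolding dform_ker_def by blast
  qed
  have "R' A p = ?R A p" if R': "reeb_conditions M (fst c) \<eta> R'" and p: "p \<in> fst c" for R' A p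
  proof -
    \<comment> \<open>the difference lies in the kernel of \<open>\<eta>\<close> and in the kernel of \<open>d\<eta>\<close>\<close>
    let ?v = "R' A p - ?R A p"
    have "\<eta> p ?v $ B = 0" for B
      using R R' p by (simp add: reeb_conditions_def linear_diff[OF linear_eta[OF p]])
    then have 1: "?v \<in> form_ker \<eta> p" by (simp add: form_ker_def)
    have "R' A p \<in> dform_ker M \<eta> p"
      using R' p by (simp add: reeb_conditions_def dform_ker_def)
    then have 2: "?v \<in> dform_ker M \<eta> p"
      using kerR[OF p, of A] unfolding dform_ker_eta[OF p] by (simp add: linear_diff[OF M.linear_tcoord[OF cM p]])
    have "form_ker \<eta> p \<inter> dform_ker M \<eta> p = {0}"
      using contact_form_eta p by (simp add: contact_form_def)
    then have "?v = 0" using 1 2 by blast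
    then show ?thesis by simp
  qed
  then show ?thesis using R unfolding reeb_vector_fields_def by blast
qed

end

subsection \<open>Independence of the chart\<close>

text \<open>Both sides are tangent vectors on the jets of order \<open>r - 1\<close>, and \<open>cvert_transition\<close> says that their components
  are related by the differential of the transition map.\<close>

lemma spencer_chart_independent:
  fixes v :: "('n, 'm, 'k::finite option) jmodel"
  assumes f: "f \<in> fibred_charts P" and f': "f' \<in> fibred_charts P"
    and p: "p \<in> fst (jet_chart P f :: (_, ('n, 'm, 'k option) jmodel) chart)"
    and p': "p \<in> fst (jet_chart P f' :: (_, ('n, 'm, 'k option) jmodel) chart)"
  defines "M \<equiv> jet_manifold P :: (_, ('n, 'm, 'k option) jmodel) mfd"
    and "N \<equiv> jet_manifold P :: (_, ('n, 'm, 'k) jmodel) mfd"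
  shows "tvec N (jet_chart P f) (jet_proj P (CARD('k) - 1) p) (jproj (cvert (snd (jet_chart P f) p) (tcoord M (jet_chart P f) p v)))
    = tvec N (jet_chart P f') (jet_proj P (CARD('k) - 1) p) (jproj (cvert (snd (jet_chart P f') p) (tcoord M (jet_chart P f') p v)))"
proof -
  interpret M: smooth_atlas M unfolding M_def by (rule jet_atlas)
  interpret N: smooth_atlas N unfolding N_def by (rule jet_atlas)
  define c where "c = (jet_chart P f :: (_, ('n, 'm, 'k option) jmodel) chart)"
  define c' where "c' = (jet_chart P f' :: (_, ('n, 'm, 'k option) jmodel) chart)"
  define d where "d = (jet_chart P f :: (_, ('n, 'm, 'k) jmodel) chart)"
  define d' where "d' = (jet_chart P f' :: (_, ('n, 'm, 'k) jmodel) chart)"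
  let ?p = "jet_proj P (CARD('k) - 1) p"
  have c: "c \<in> charts M" "c' \<in> charts M" and d: "d \<in> charts N" "d' \<in> charts N"
    unfolding c_def c'_def d_def d'_def M_def N_def by (rule jet_chart_charts[OF f] jet_chart_charts[OF f'])+
  have pc: "p \<in> fst c" "p \<in> fst c'" using p p' by (simp_all add: c_def c'_def)
  have pd: "?p \<in> fst d" "?p \<in> fst d'" "snd d ?p = jproj (snd c p)"
    using jet_proj_chart[OF f p] jet_proj_chart[OF f' p'] by (simp_all add: c_def d_def d'_def)
  have z: "snd c p \<in> snd c ` (fst c \<inter> fst c')" using pc by blast
  note tr = cvert_transition[OF f f' z[unfolded c_def c'_def], folded c_def c'_def d_def d'_def]
  have "tvec N d ?p (jproj (cvert (snd c p) (tcoord M c p v)))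
      = tvec N d' ?p (FD (ctrans d d') (snd d ?p) (jproj (cvert (snd c p) (tcoord M c p v))))"
    by (rule N.tvec_trans[OF d(1) pd(1) d(2) pd(2)])
  also have "\<dots> = tvec N d' ?p (jproj (cvert (ctrans c c' (snd c p)) (FD (ctrans c c') (snd c p) (tcoord M c p v))))"
    unfolding pd(3) tr ..
  also have "\<dots> = tvec N d' ?p (jproj (cvert (snd c' p) (tcoord M c' p v)))"
    unfolding M.ctrans_chart[OF c(1) pc(1)] M.tcoord_trans[OF c(1) pc(1) c(2) pc(2), symmetric] ..
  finally show ?thesis unfolding c_def c'_def d_def d'_def .
qed

text \<open>The contact forms of a chart vanish on \<open>v\<close> if and only if the vertical vector that they define on the jets of
  order \<open>r - 1\<close> does; this vector is the same in all charts.\<close>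

lemma cartan_chart:
  assumes f: "f \<in> fibred_charts P"
    and p: "p \<in> fst (jet_chart P f :: (_, ('n, 'm, 'k::finite option) jmodel) chart)"
  shows "cartan P p = form_ker (eta P f :: _ \<Rightarrow> _ \<Rightarrow> real^('m, 'n, 'k) jidx) p"
proof -
  let ?M = "jet_manifold P :: (_, ('n, 'm, 'k option) jmodel) mfd"
  let ?N = "jet_manifold P :: (_, ('n, 'm, 'k) jmodel) mfd"
  let ?S = "\<lambda>f v. tvec ?N (jet_chart P f) (jet_proj P (CARD('k) - 1) p)
      (jproj (cvert (snd (jet_chart P f) p) (tcoord ?M (jet_chart P f) p v)))"
  have *: "(\<forall>\<alpha>. \<forall>I\<in>mindices (CARD('k) - 1). theta P f \<alpha> I p v = 0) \<longleftrightarrow> ?S f v = 0"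
    if f: "f \<in> fibred_charts P" and p: "p \<in> fst (jet_chart P f :: (_, ('n, 'm, 'k option) jmodel) chart)" for f v
    unfolding tvec_N_eq_0_iff[OF f proj_in_d[OF f p]] jproj_cvert_eq_0_iff cvert_eq_0_iff mindices_card theta_coord[OF f] by simp
  have "v \<in> cartan P p \<longleftrightarrow> ?S f v = 0" for v
  proof
    assume "v \<in> cartan P p"
    then have "\<forall>\<alpha>. \<forall>I\<in>mindices (CARD('k) - 1). theta P f \<alpha> I p v = 0" using f p by (simp add: cartan_def)
    then show "?S f v = 0" using *[OF f p] by blast
  next
    assume 0: "?S f v = 0"
    have "\<forall>\<alpha>. \<forall>I\<in>mindices (CARD('k) - 1). theta P f' \<alpha> I p v = 0"
      if f': "f' \<in> fibred_charts P" and p': "p \<in> fst (jet_chart P f' :: (_, ('n, 'm, 'k option) jmodel) chart)" for f'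
      unfolding *[OF f' p'] spencer_chart_independent[OF f f' p p', symmetric] by (rule 0)
    then show "v \<in> cartan P p" unfolding cartan_def by blast
  qed
  moreover have "?S f v = 0 \<longleftrightarrow> v \<in> form_ker (eta P f) p" for v
    unfolding tvec_N_eq_0_iff[OF f proj_in_d[OF f p]] jproj_cvert_eq_0_iff form_ker_eta[OF f] by simp
  ultimately show ?thesis by blast
qed

text \<open>The formula in one chart satisfies the conditions that characterise the Spencer operator, and the chart at hand
  leaves no other choice.\<close>

lemma spencer_chart:
  assumes f: "f \<in> fibred_charts P"
    and p: "p \<in> fst (jet_chart P f :: (_, ('n, 'm, 'k::finite option) jmodel) chart)"
  shows "spencer P p v = (\<Sum>\<alpha>\<in>UNIV. \<Sum>I\<in>mindices (CARD('k) - 1).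
    theta P f \<alpha> I p v *\<^sub>R (partial_u P f \<alpha> I (jet_proj P (CARD('k) - 1) p) :: ('n, 'm, 'k) jmodel))"
proof -
  let ?N = "jet_manifold P :: (_, ('n, 'm, 'k) jmodel) mfd"
  let ?p = "jet_proj P (CARD('k) - 1) p"
  let ?S = "\<lambda>f (v :: ('n, 'm, 'k option) jmodel). \<Sum>\<alpha>\<in>UNIV. \<Sum>I\<in>mindices (CARD('k) - 1). theta P f \<alpha> I p v *\<^sub>R (partial_u P f \<alpha> I ?p :: ('n, 'm, 'k) jmodel)"
  let ?d = "jet_chart P f :: (_, ('n, 'm, 'k) jmodel) chart"
  note fD = fibred_chartD[OF f]
  interpret N: smooth_atlas ?N by (rule jet_atlas)
  have d: "?d \<in> charts ?N" by (rule jet_chart_charts[OF f])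
  have pd: "?p \<in> fst ?d" by (rule proj_in_d[OF f p])
  have base: "fst q \<in> fst (snd f) \<and> snd (snd f) (fst q) = fst (snd ?d q)" if q: "q \<in> fst ?d" for q
  proof -
    obtain q0 \<sigma> where s: "\<sigma> \<in> sections_at P q0" "\<sigma> q0 \<in> fst (fst f)" "q = jet_of P (CARD('k) - 1) q0 \<sigma>" "snd ?d q = jcoord f q0 \<sigma>"
      by (rule jet_chart_obtain[OF q])
    show ?thesis using section_base_in_chart[OF s(1) f s(2)] unfolding s(3) fst_jet_of s(4)[unfolded s(3)] by simp
  qed
  have vert: "tmap ?N (base P) fst ?p (?S f v) = 0" for v
  proof -
    let ?w = "jproj (cvert (snd (jet_chart P f) p) (tcoord (jet_manifold P :: (_, ('n, 'm, 'k option) jmodel) mfd) (jet_chart P f) p v)) :: ('n, 'm, 'k) jmodel"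
    have S: "?S f v = tvec ?N ?d ?p ?w" by (rule theta_sum_N[OF f p])
    have "tmap ?N (base P) fst ?p (?S f v) = tvec (base P) (snd f) (fst ?p) (FD fst (snd ?d ?p) (tcoord ?N ?d ?p (?S f v)))"
    proof (rule tmap_charts[OF jet_atlas B.smooth_atlas_axioms d pd fD(2)])
      show "open (snd ?d ` fst ?d)" by (rule N.open_chart_image[OF d])
      show "snd ?d ?p \<in> snd ?d ` fst ?d" using pd by (rule imageI)
      show "smooth_on (snd ?d ` fst ?d) (fst :: ('n, 'm, 'k) jmodel \<Rightarrow> _)" by (rule smooth_on_linear[OF linear_fst'])
    qed (use base in auto)
    also have "tcoord ?N ?d ?p (?S f v) = ?w" unfolding S by (rule N.tcoord_tvec[OF d pd])
    also have "FD fst (snd ?d ?p) ?w = fst ?w"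
      by (rule fun_cong[OF FD_eq[OF bounded_linear_imp_has_derivative[OF bounded_linear_fst]]])
    also have "fst ?w = 0" by simp
    also have "tvec (base P) (snd f) (fst ?p) 0 = 0"
      by (rule linear_0[OF B.linear_tvec[OF fD(2)]]) (use base[OF pd] in simp)
    finally show ?thesis .
  qed
  have "spencer P p = ?S f"
    unfolding spencer_def
  proof (rule the_equality)
    show "(\<forall>v. tmap ?N (base P) fst ?p (?S f v) = 0) \<and>
      (\<forall>f'\<in>fibred_charts P. p \<in> fst (jet_chart P f' :: (_, ('n, 'm, 'k option) jmodel) chart) \<longrightarrow> (\<forall>v. ?S f v = ?S f' v))"
    proof (intro conjI allI ballI impI)
      show "tmap ?N (base P) fst ?p (?S f v) = 0" for v by (rule vert)
      fix f' v assume f': "f' \<in> fibred_charts P" "p \<in> fst (jet_chart P f' :: (_, ('n, 'm, 'k option) jmodel) chart)"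
      show "?S f v = ?S f' v"
        unfolding theta_sum_N[OF f p] theta_sum_N[OF f'] by (rule spencer_chart_independent[OF f f'(1) p f'(2)])
    qed
  next
    fix S assume S: "(\<forall>v. tmap ?N (base P) fst ?p (S v) = 0) \<and>
      (\<forall>f'\<in>fibred_charts P. p \<in> fst (jet_chart P f' :: (_, ('n, 'm, 'k option) jmodel) chart) \<longrightarrow> (\<forall>v. S v = ?S f' v))"
    then have "\<forall>v. S v = ?S f v" using f p by blast
    then show "S = ?S f" by (intro ext) (rule spec)
  qed
  then show ?thesis by (rule fun_cong)
qed

text \<open>In coordinates the differential of the projection forgets the components of top order, which the Reeb lift does
  not have.\<close>

lemma T_proj_reeb_lift:
  assumes f: "f \<in> fibred_charts P"
    and p: "p \<in> fst (jet_chart P f :: (_, ('n, 'm, 'k::finite option) jmodel) chart)"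
  shows "(T_proj P p (reeb_lift P f p (eta P f p v)) :: ('n, 'm, 'k) jmodel) = spencer P p v"
proof -
  interpret M: smooth_atlas "jet_manifold P :: (_, ('n, 'm, 'k option) jmodel) mfd" by (rule jet_atlas)
  show ?thesis
    unfolding spencer_chart[OF f p] theta_sum_N[OF f p] reeb_lift_eta(2)[OF f p] T_proj_coord[OF f p]
      M.tcoord_tvec[OF jet_chart_charts[OF f] p] ..
qed

lemma vclass_eq_iff:
  assumes f: "f \<in> fibred_charts P"
    and p: "p \<in> fst (jet_chart P f :: (_, ('n, 'm, 'k::finite option) jmodel) chart)"
  shows "vclass P p v = {w. (T_proj P p w :: ('n, 'm, 'k) jmodel) = T_proj P p v}"
  unfolding vclass_def using linear_diff[OF linear_T_proj[OF f p]] by simp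

lemma contact_distribution_cartan:
  "contact_distribution TYPE(('m, 'n, 'k::finite) jidx)
     (jet_manifold P :: (('q, 'e) jet, ('n, 'm, 'k option) jmodel) mfd) (cartan P)"
proof -
  let ?M = "jet_manifold P :: (('q, 'e) jet, ('n, 'm, 'k option) jmodel) mfd"
  interpret M: smooth_atlas ?M by (rule jet_atlas)
  have ex: "\<exists>f\<in>fibred_charts P. p \<in> fst (jet_chart P f :: (_, ('n, 'm, 'k option) jmodel) chart)" if p: "p \<in> points ?M" for p
  proof -
    obtain a where "a \<in> atlas ?M" "p \<in> fst a" using p by (rule M.obtain_atlas_chart)
    then show ?thesis unfolding jet_manifold_def mfd.simps by blast
  qed
  have reg: "regular_distribution ?M (points ?M) CARD(('m, 'n, 'k) jidx) (cartan P)"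
    unfolding regular_distribution_def
  proof (rule conjI; rule ballI)
    fix p assume "p \<in> points ?M"
    then obtain f where f: "f \<in> fibred_charts P" and p: "p \<in> fst (jet_chart P f :: (_, ('n, 'm, 'k option) jmodel) chart)"
      using ex by blast
    let ?U = "fst (jet_chart P f :: (_, ('n, 'm, 'k option) jmodel) chart)"
    note R = regular_eta[OF f, where 'k = 'k, unfolded regular_distribution_def]
    show "subspace (cartan P p :: ('n, 'm, 'k option) jmodel set) \<and> dim (cartan P p :: ('n, 'm, 'k option) jmodel set) + CARD(('m, 'n, 'k) jidx) = DIM(('n, 'm, 'k option) jmodel)"
      unfolding cartan_chart[OF f p] using R p by blast
    obtain V XX where V: "openin (mtop ?M) V" "p \<in> V" "V \<subseteq> ?U" "finite XX" "\<forall>X\<in>XX. smooth_vector_field ?M V X"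
      "\<forall>q\<in>V. form_ker (eta P f :: _ \<Rightarrow> _ \<Rightarrow> real^('m, 'n, 'k) jidx) q = span ((\<lambda>X. X q) ` XX)"
      using R p by blast
    have "\<forall>q\<in>V. cartan P q = span ((\<lambda>X. X q) ` XX)"
      using V(3,6) cartan_chart[OF f] by blast
    moreover have "V \<subseteq> points ?M" using V(3) M.charts_subset[OF jet_chart_charts[OF f]] by blast
    ultimately show "\<exists>V XX. openin (mtop ?M) V \<and> p \<in> V \<and> V \<subseteq> points ?M \<and> finite XX \<and>
        (\<forall>X\<in>XX. smooth_vector_field ?M V X) \<and> (\<forall>q\<in>V. cartan P q = span ((\<lambda>X. X q) ` XX))"
      using V(1,2,4,5) by blast
  qed
  show ?thesis
    unfolding contact_distribution_def
  proof (rule conjI[OF reg], rule ballI)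
    fix p assume "p \<in> points ?M"
    then obtain f where f: "f \<in> fibred_charts P" and p: "p \<in> fst (jet_chart P f :: (_, ('n, 'm, 'k option) jmodel) chart)"
      using ex by blast
    show "\<exists>U (\<eta> :: ('q, 'e) jet \<Rightarrow> ('n, 'm, 'k option) jmodel \<Rightarrow> real^('m, 'n, 'k) jidx).
        p \<in> U \<and> contact_form ?M U \<eta> \<and> (\<forall>q\<in>U. cartan P q = form_ker \<eta> q)"
      by (intro exI conjI ballI, rule p, rule contact_form_eta[OF f], rule cartan_chart[OF f])
  qed
qed

end

theorem theorem5p3:
  fixes P :: "('e, 'q, 'n::finite, 'm::finite) fibration" and r :: nat
  assumes "fibred_manifold P" and "r = CARD('k::finite)"
  shows
    "CARD(('m, 'n, 'k) jidx) = CARD('m) * ((CARD('n) + r - 1) choose (r - 1)) \<and>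
     contact_distribution TYPE(('m, 'n, 'k) jidx)
       (jet_manifold P :: (('q, 'e) jet, ('n, 'm, 'k option) jmodel) mfd) (cartan P) \<and>
     (\<forall>f\<in>fibred_charts P.
        let M = (jet_manifold P :: (('q, 'e) jet, ('n, 'm, 'k option) jmodel) mfd);
            U = fst (jet_chart P f :: (('q, 'e) jet, ('n, 'm, 'k option) jmodel) chart);
            \<eta> = (eta P f :: ('q, 'e) jet \<Rightarrow> ('n, 'm, 'k option) jmodel \<Rightarrow> real^('m, 'n, 'k) jidx)
        in
          contact_form M U \<eta> \<and>
          (\<forall>p\<in>U. form_ker \<eta> p = cartan P p) \<and>
          reeb_vector_fields M U \<eta> (\<lambda>A. case Rep_jidx A of (\<alpha>, J) \<Rightarrow> reeb P f \<alpha> J) \<and>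
          (\<forall>p\<in>U. \<forall>v.
             reeb_lift P f p (\<eta> p v) =
               (\<Sum>\<alpha>\<in>UNIV. \<Sum>J\<in>mindices (r - 1). eta_comp P f \<alpha> J p v *\<^sub>R reeb P f \<alpha> J p) \<and>
             reeb_lift P f p (\<eta> p v) =
               (\<Sum>\<alpha>\<in>UNIV. \<Sum>I\<in>mindices (r - 1). theta P f \<alpha> I p v *\<^sub>R partial_u P f \<alpha> I p) \<and>
             spencer P p v =
               (\<Sum>\<alpha>\<in>UNIV. \<Sum>I\<in>mindices (r - 1).
                  theta P f \<alpha> I p v *\<^sub>R partial_u P f \<alpha> I (jet_proj P (r - 1) p)) \<and>
             T_proj P p ` vclass P p (reeb_lift P f p (\<eta> p v)) = {spencer P p v}) \<and>
          (\<forall>f'\<in>fibred_charts P.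
             \<forall>p\<in>U \<inter> fst (jet_chart P f' :: (('q, 'e) jet, ('n, 'm, 'k option) jmodel) chart). \<forall>v.
               vclass P p (reeb_lift P f p (\<eta> p v)) =
               vclass P p (reeb_lift P f' p (eta P f' p v))))"
proof -
  interpret fibred P by (rule fibred.intro[OF assms(1)])
  show ?thesis
    unfolding Let_def assms(2)
  proof (intro conjI ballI allI)
    fix f assume f: "f \<in> fibred_charts P"
    let ?U = "fst (jet_chart P f :: (('q, 'e) jet, ('n, 'm, 'k option) jmodel) chart)"
    show "contact_form (jet_manifold P) ?U (eta P f :: _ \<Rightarrow> _ \<Rightarrow> real^('m, 'n, 'k) jidx)"
      by (rule contact_form_eta[OF f])
    show "reeb_vector_fields (jet_manifold P) ?U (eta P f :: _ \<Rightarrow> _ \<Rightarrow> real^('m, 'n, 'k) jidx)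
        (\<lambda>A. case Rep_jidx A of (\<alpha>, J) \<Rightarrow> reeb P f \<alpha> J)"
      by (rule reeb_vector_fields_eta[OF f])
    fix p assume p: "p \<in> ?U"
    show "form_ker (eta P f :: _ \<Rightarrow> _ \<Rightarrow> real^('m, 'n, 'k) jidx) p = cartan P p"
      by (rule cartan_chart[OF f p, symmetric])
    fix v :: "('n, 'm, 'k option) jmodel"
    let ?L = "reeb_lift P f p (eta P f p v)"
    show "?L = (\<Sum>\<alpha>\<in>UNIV. \<Sum>J\<in>mindices (CARD('k) - 1). eta_comp P f \<alpha> J p v *\<^sub>R reeb P f \<alpha> J p)"
      by (rule reeb_lift_eta(1)[OF f p])
    show "?L = (\<Sum>\<alpha>\<in>UNIV. \<Sum>I\<in>mindices (CARD('k) - 1). theta P f \<alpha> I p v *\<^sub>R partial_u P f \<alpha> I p)"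
      unfolding theta_sum_M[OF f p] by (rule reeb_lift_eta(2)[OF f p])
    show "spencer P p v = (\<Sum>\<alpha>\<in>UNIV. \<Sum>I\<in>mindices (CARD('k) - 1).
        theta P f \<alpha> I p v *\<^sub>R partial_u P f \<alpha> I (jet_proj P (CARD('k) - 1) p))"
      by (rule spencer_chart[OF f p])
    show "T_proj P p ` vclass P p ?L = {spencer P p v}"
      unfolding vclass_eq_iff[OF f p] T_proj_reeb_lift[OF f p, symmetric] by blast
  next
    fix f f' p and v :: "('n, 'm, 'k option) jmodel"
    assume f: "f \<in> fibred_charts P" and f': "f' \<in> fibred_charts P"
      and p: "p \<in> fst (jet_chart P f :: (('q, 'e) jet, ('n, 'm, 'k option) jmodel) chart)
        \<inter> fst (jet_chart P f' :: (('q, 'e) jet, ('n, 'm, 'k option) jmodel) chart)"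
    then have p: "p \<in> fst (jet_chart P f :: (_, ('n, 'm, 'k option) jmodel) chart)"
      "p \<in> fst (jet_chart P f' :: (_, ('n, 'm, 'k option) jmodel) chart)" by blast+
    show "vclass P p (reeb_lift P f p (eta P f p v)) = vclass P p (reeb_lift P f' p (eta P f' p v))"
      unfolding vclass_eq_iff[OF f p(1)] T_proj_reeb_lift[OF f p(1)] T_proj_reeb_lift[OF f' p(2)] ..
  qed (rule card_jidx contact_distribution_cartan)+
qed

end
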